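(* Let $p$ be a prime and let $L$ be a free abelian group of finite rank. Let $(E_r,d_r)_{r\ge 1}$ be the Bockstein spectral sequence at $p$ of the integral de Rham complex $(\Omega^{\star},d)$ of $S^*(L)$, so that $E_1=H(\Omega^{\star}\otimes\mathbb{Z}/p)$. Then the spectral sequence is stationary, each page being identified, via the Cartier isomorphism, with the de Rham complex over the field with $p$ elements. Precisely: the map $\varphi_1:=C^{-1}\colon(\Omega^{\star}\otimes\mathbb{Z}/p,\,d)\to(E_1,d_1)$ is an isomorphism of complexes; and, defining inductively $$\varphi_{r+1}:=H(\varphi_r)\circ C^{-1}\colon\ \Omega^{\star}\otimes\mathbb{Z}/p\to H(\Omega^{\star}\otimes\mathbb{Z}/p)\to H(E_r,d_r)=E_{r+1},$$ each $\varphi_r\colon(\Omega^{\star}\otimes\mathbb{Z}/p,\,d)\to(E_r,d_r)$, $r\ge1$, is an isomorphism of complexes.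
   Context: For a free abelian group $L$ of finite rank, $S^j(L)$ and $\Lambda^i(L)$ denote symmetric and exterior powers over $\mathbb{Z}$. Put $\Omega^i_n=S^{n-i}(L)\otimes\Lambda^i(L)$ (zero if $i>n$ or $i<0$) and $\Omega^i=\bigoplus_{n\ge0}\Omega^i_n$. Then $\Omega^*=\Lambda^*_A(\Omega^1_A)$ is the algebra of (absolute) differential forms of the polynomial ring $A=S^*(L)$, and $d$ is the usual exterior derivative $\Omega^i\to\Omega^{i+1}$. It preserves the total degree $n$. For each $n$ this gives the integral de Rham complex in total degree $n$, $$\Omega_n^{\star}:\ S^n\xrightarrow{d}S^{n-1}\otimes\Lambda^1\xrightarrow{d}\cdots\xrightarrow{d}\Lambda^n\to0,$$ and $\Omega^{\star}=\bigoplus_n\Omega_n^{\star}$. Cartier isomorphism: choose a basis $(x_j)$ of $L$. The ring endomorphism of $\Omega^*$ with $x_j\mapsto x_j^p$ and $dx_j\mapsto x_j^{p-1}dx_j$ induces an algebra morphism $C^{-1}\colon\Omega^*\otimes\mathbb{Z}/p\to H(\Omega^{\star}\otimes\mathbb{Z}/p)$, preserving the cohomological degree $i$ and multiplying the total degree by $p$. It is a theorem of Cartier that $C^{-1}$ is an isomorphism, independent of the basis; its inverse is called the Cartier isomorphism. Bockstein spectral sequence: the short exact sequence of complexes $0\to\Omega^{\star}\xrightarrow{p}\Omega^{\star}\to\Omega^{\star}\otimes\mathbb{Z}/p\to0$ gives an exact couple with $D_1=H(\Omega^{\star})$, $E_1=H(\Omega^{\star}\otimes\mathbb{Z}/p)$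 and maps $p\colon D_1\to D_1$, $\rho\colon D_1\to E_1$ (reduction mod $p$), $\partial\colon E_1\to D_1$ (connecting map, $\partial[\overline{\omega}]=[d\omega/p]$). The page $(E_r,d_r)$ comes from the $(r-1)$-st derived couple, with $d_1=\rho\partial$ and $E_{r+1}=H(E_r,d_r)$. *)

theory Defs
  imports Complex_Main "HOL-Computational_Algebra.Primes" "HOL-Algebra.Weak_Morphisms"
begin

section \<open>Abelian groups as modules over the integers\<close>

definition int_scale :: "int \<Rightarrow> 'a::ab_group_add \<Rightarrow> 'a" where
  "int_scale n x = (\<Sum>_<nat n. x) - (\<Sum>_<nat (- n). x)"

lemma int_scale_Suc: "int_scale (n + 1) x = int_scale n x + x"
proof (cases "n \<ge> 0")
  case True
  then have "nat (n + 1) = Suc (nat n)" "nat (- n) = 0" "nat (- (n + 1)) = 0" by auto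
  then show ?thesis by (simp add: int_scale_def add.commute)
next
  case False
  then have "nat (- n) = Suc (nat (- (n + 1)))" "nat n = 0" "nat (n + 1) = 0" by auto
  then show ?thesis by (simp add: int_scale_def)
qed

lemma int_scale_pred: "int_scale (n - 1) x = int_scale n x - x"
  using int_scale_Suc[of "n - 1" x] by simp

lemma int_scale_0 [simp]: "int_scale 0 x = 0"
  by (simp add: int_scale_def)

lemma int_scale_1: "int_scale 1 x = x"
  by (simp add: int_scale_def)

lemma int_scale_add_left: "int_scale (m + n) x = int_scale m x + int_scale n x"
proof (induction m rule: int_induct[where k = 0])
  case (step1 i)
  have "i + 1 + n = (i + n) + 1" by simp
  with step1 show ?case by (simp only: int_scale_Suc) (simp add: ac_simps)
next
  case (step2 i)
  have "i - 1 + n = (i + n) - 1" by simp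
  with step2 show ?case by (simp only: int_scale_pred) simp
qed simp

lemma int_scale_add_right: "int_scale n (x + y) = int_scale n x + int_scale n y"
  by (simp add: int_scale_def sum.distrib)

lemma int_scale_mult: "int_scale m (int_scale n x) = int_scale (m * n) x"
proof (induction m rule: int_induct[where k = 0])
  case (step1 i)
  then show ?case by (simp add: int_scale_Suc distrib_right int_scale_add_left int_scale_1)
next
  case (step2 i)
  have "int_scale (i * n) x = int_scale ((i - 1) * n) x + int_scale n x"
    using int_scale_add_left[of "(i - 1) * n" n x] by (simp add: left_diff_distrib)
  with step2 show ?case by (simp add: int_scale_pred)
qed simp

interpretation int_mod: Modules.module "int_scale :: int \<Rightarrow> 'a::ab_group_add \<Rightarrow> 'a"
  by standard (simp_all add: int_scale_add_left int_scale_add_right int_scale_mult int_scale_1)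

lemma int_scale_eq_of_int_mult: "int_scale n x = of_int n * (x :: 'a::ring_1)"
proof (induction n rule: int_induct[where k = 0])
  case (step1 i)
  then show ?case by (simp add: int_scale_Suc distrib_right)
next
  case (step2 i)
  then show ?case by (simp add: int_scale_pred left_diff_distrib)
qed simp

section \<open>The algebra of differential forms\<close>

text \<open>
  The free abelian group \<open>L\<close> is the type \<open>'l\<close>.  The algebra
  \<open>\<Omega>\<^sup>* = S\<^sup>*(L) \<otimes> \<Lambda>\<^sup>*(L)\<close> is the unital ring presented by generators
  \<open>x\<^sub>l\<close> and \<open>dx\<^sub>l\<close> for \<open>l \<in> L\<close>, both additive in \<open>l\<close>, where the \<open>x\<^sub>l\<close> commute with each
  other and with the \<open>dx\<^sub>l\<close>, and \<open>dx\<^sub>l dx\<^sub>l = 0\<close>.  It is built as the quotient of ring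
  expressions by the smallest congruence that contains the ring axioms and these relations.
\<close>

datatype 'l expr =
    EZero | EOne | ENeg "'l expr" | EAdd "'l expr" "'l expr" | EMul "'l expr" "'l expr"
  | EVar 'l | EDiff 'l

inductive form_eq :: "'l::ab_group_add expr \<Rightarrow> 'l expr \<Rightarrow> bool" where
  refl: "form_eq a a"
| sym: "form_eq a b \<Longrightarrow> form_eq b a"
| trans: "form_eq a b \<Longrightarrow> form_eq b c \<Longrightarrow> form_eq a c"
| neg_cong: "form_eq a b \<Longrightarrow> form_eq (ENeg a) (ENeg b)"
| add_cong: "form_eq a b \<Longrightarrow> form_eq a' b' \<Longrightarrow> form_eq (EAdd a a') (EAdd b b')"
| mul_cong: "form_eq a b \<Longrightarrow> form_eq a' b' \<Longrightarrow> form_eq (EMul a a') (EMul b b')"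
| add_assoc: "form_eq (EAdd (EAdd a b) c) (EAdd a (EAdd b c))"
| add_comm: "form_eq (EAdd a b) (EAdd b a)"
| add_zero: "form_eq (EAdd EZero a) a"
| add_neg: "form_eq (EAdd (ENeg a) a) EZero"
| mul_assoc: "form_eq (EMul (EMul a b) c) (EMul a (EMul b c))"
| mul_one_left: "form_eq (EMul EOne a) a"
| mul_one_right: "form_eq (EMul a EOne) a"
| distrib_left: "form_eq (EMul a (EAdd b c)) (EAdd (EMul a b) (EMul a c))"
| distrib_right: "form_eq (EMul (EAdd a b) c) (EAdd (EMul a c) (EMul b c))"
| X_add: "form_eq (EVar (l + m)) (EAdd (EVar l) (EVar m))"
| D_add: "form_eq (EDiff (l + m)) (EAdd (EDiff l) (EDiff m))"
| X_X: "form_eq (EMul (EVar l) (EVar m)) (EMul (EVar m) (EVar l))"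
| X_D: "form_eq (EMul (EVar l) (EDiff m)) (EMul (EDiff m) (EVar l))"
| D_D: "form_eq (EMul (EDiff l) (EDiff l)) EZero"

quotient_type (overloaded) 'l forms = "'l::ab_group_add expr" / form_eq
  by (rule equivpI) (auto intro: reflpI sympI transpI form_eq.refl form_eq.sym form_eq.trans)

primrec expr_eval :: "('l \<Rightarrow> 'r::ring_1) \<Rightarrow> ('l \<Rightarrow> 'r) \<Rightarrow> 'l expr \<Rightarrow> 'r" where
  "expr_eval f g EZero = 0"
| "expr_eval f g EOne = 1"
| "expr_eval f g (ENeg a) = - expr_eval f g a"
| "expr_eval f g (EAdd a b) = expr_eval f g a + expr_eval f g b"
| "expr_eval f g (EMul a b) = expr_eval f g a * expr_eval f g b"
| "expr_eval f g (EVar l) = f l"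
| "expr_eval f g (EDiff l) = g l"

lemma form_eq_eval:
  assumes "form_eq a b"
    and "\<And>l m. f (l + m) = f l + f m" "\<And>l m. g (l + m) = g l + g m"
    and "\<And>l m. f l * f m = f m * f l" "\<And>l m. f l * g m = g m * f l" "\<And>l. g l * g l = 0"
  shows "expr_eval f g a = expr_eval f g b"
  using assms(1) by induction (auto simp: assms(2-) algebra_simps)

lemma not_form_eq_0_1: "\<not> form_eq EZero (EOne :: 'l::ab_group_add expr)"
proof
  assume "form_eq EZero (EOne :: 'l expr)"
  then have "expr_eval (\<lambda>_::'l. 0 :: int) (\<lambda>_. 0) EZero = expr_eval (\<lambda>_::'l. 0 :: int) (\<lambda>_. 0) EOne"
    by (rule form_eq_eval) auto
  then show False by simp
qed

instantiation forms :: (ab_group_add) ring_1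
begin

lift_definition zero_forms :: "'a forms" is EZero .
lift_definition one_forms :: "'a forms" is EOne .
lift_definition uminus_forms :: "'a forms \<Rightarrow> 'a forms" is ENeg
  by (rule form_eq.neg_cong)
lift_definition plus_forms :: "'a forms \<Rightarrow> 'a forms \<Rightarrow> 'a forms" is EAdd
  by (rule form_eq.add_cong)
lift_definition times_forms :: "'a forms \<Rightarrow> 'a forms \<Rightarrow> 'a forms" is EMul
  by (rule form_eq.mul_cong)
definition minus_forms :: "'a forms \<Rightarrow> 'a forms \<Rightarrow> 'a forms" where
  "minus_forms a b = a + - b"

instance
proof
  fix a b c :: "'a forms"
  show "a + b + c = a + (b + c)" by transfer (rule form_eq.add_assoc)
  show "a + b = b + a" by transfer (rule form_eq.add_comm)
  show "0 + a = a" by transfer (rule form_eq.add_zero)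
  show "- a + a = 0" by transfer (rule form_eq.add_neg)
  show "a - b = a + - b" by (rule minus_forms_def)
  show "a * b * c = a * (b * c)" by transfer (rule form_eq.mul_assoc)
  show "1 * a = a" by transfer (rule form_eq.mul_one_left)
  show "a * 1 = a" by transfer (rule form_eq.mul_one_right)
  show "(a + b) * c = a * c + b * c" by transfer (rule form_eq.distrib_right)
  show "a * (b + c) = a * b + a * c" by transfer (rule form_eq.distrib_left)
  show "(0 :: 'a forms) \<noteq> 1" by transfer (rule not_form_eq_0_1)
qed

end

lift_definition xf :: "'l::ab_group_add \<Rightarrow> 'l forms" is EVar .
lift_definition dxf :: "'l::ab_group_add \<Rightarrow> 'l forms" is EDiff .

lemma xf_add: "xf (l + m) = xf l + xf m"
  by transfer (rule form_eq.X_add)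

lemma dxf_add: "dxf (l + m) = dxf l + dxf m"
  by transfer (rule form_eq.D_add)

lemma xf_xf: "xf l * xf m = xf m * xf l"
  by transfer (rule form_eq.X_X)

lemma xf_dxf: "xf l * dxf m = dxf m * xf l"
  by transfer (rule form_eq.X_D)

lemma dxf_sq: "dxf l * dxf l = 0"
  by transfer (rule form_eq.D_D)

lemma dxf_anticomm: "dxf l * dxf m = - (dxf m * dxf l)"
proof -
  have "0 = dxf (l + m) * dxf (l + m)" by (simp only: dxf_sq)
  also have "\<dots> = dxf l * dxf m + dxf m * dxf l"
    by (simp add: dxf_add ring_distribs dxf_sq)
  finally show ?thesis by (simp add: eq_neg_iff_add_eq_0)
qed

text \<open>The homogeneous piece \<open>\<Omega>\<^sup>i\<^sub>n = S\<^sup>n\<^sup>-\<^sup>i(L) \<otimes> \<Lambda>\<^sup>i(L)\<close> and \<open>\<Omega>\<^sup>i = \<Oplus>\<^sub>n \<Omega>\<^sup>i\<^sub>n\<close>.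
  The degree \<open>i\<close> is an integer, so that the pieces with \<open>i < 0\<close> or \<open>i > n\<close> are zero.\<close>

definition Omega_hom :: "int \<Rightarrow> nat \<Rightarrow> 'l::ab_group_add forms set" where
  "Omega_hom i n = int_mod.span
     {prod_list (map xf ls) * prod_list (map dxf ms) | ls ms.
        int (length ls) = int n - i \<and> int (length ms) = i}"

definition Omega :: "int \<Rightarrow> 'l::ab_group_add forms set" where
  "Omega i = int_mod.span (\<Union>n. Omega_hom i n)"

text \<open>The grading automorphism, multiplication by \<open>(-1)\<^sup>i\<close> on \<open>\<Omega>\<^sup>i\<close>, and the exterior
  derivative, the additive map with \<open>d(x\<^sub>l) = dx\<^sub>l\<close>, \<open>d(dx\<^sub>l) = 0\<close> and
  \<open>d(\<omega>\<eta>) = d\<omega> \<eta> + (-1)\<^sup>i \<omega> d\<eta>\<close> for \<open>\<omega> \<in> \<Omega>\<^sup>i\<close>.\<close>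

lift_definition grade_inv :: "'l::ab_group_add forms \<Rightarrow> 'l forms"
  is "expr_eval xf (\<lambda>l. - dxf l)"
  by (rule form_eq_eval) (auto simp: xf_add dxf_add xf_xf xf_dxf dxf_sq)

primrec expr_deriv :: "'l::ab_group_add expr \<Rightarrow> 'l forms" where
  "expr_deriv EZero = 0"
| "expr_deriv EOne = 0"
| "expr_deriv (ENeg a) = - expr_deriv a"
| "expr_deriv (EAdd a b) = expr_deriv a + expr_deriv b"
| "expr_deriv (EMul a b) =
     expr_deriv a * abs_forms b + grade_inv (abs_forms a) * expr_deriv b"
| "expr_deriv (EVar l) = dxf l"
| "expr_deriv (EDiff l) = 0"

lemma abs_forms_simps:
  "abs_forms EZero = 0" "abs_forms EOne = 1" "abs_forms (ENeg a) = - abs_forms a"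
  "abs_forms (EAdd a b) = abs_forms a + abs_forms b"
  "abs_forms (EMul a b) = abs_forms a * abs_forms b"
  "abs_forms (EVar l) = xf l" "abs_forms (EDiff l) = dxf l"
  by (simp_all add: zero_forms.abs_eq one_forms.abs_eq uminus_forms.abs_eq plus_forms.abs_eq
      times_forms.abs_eq xf.abs_eq dxf.abs_eq)

lemma grade_inv_simps [simp]:
  fixes a b :: "'l::ab_group_add forms" and l :: 'l
  shows "grade_inv 0 = (0 :: 'l forms)" "grade_inv 1 = (1 :: 'l forms)" "grade_inv (- a) = - grade_inv a"
  "grade_inv (a + b) = grade_inv a + grade_inv b"
  "grade_inv (a * b) = grade_inv a * grade_inv b"
  "grade_inv (xf l) = xf l" "grade_inv (dxf l) = - dxf l"
proof -
  have ev: "grade_inv (abs_forms e) = expr_eval xf (\<lambda>l. - dxf l) e" for e :: "'l expr"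
    by (rule grade_inv.abs_eq)
  show "grade_inv 0 = (0 :: 'l forms)" "grade_inv 1 = (1 :: 'l forms)"
    "grade_inv (xf l) = xf l" "grade_inv (dxf l) = - dxf l"
    using ev[of EZero] ev[of EOne] ev[of "EVar l"] ev[of "EDiff l"]
    by (simp_all add: abs_forms_simps)
  show "grade_inv (- a) = - grade_inv a"
    by (induct a rule: forms.abs_induct) (simp add: ev flip: abs_forms_simps)
  show "grade_inv (a + b) = grade_inv a + grade_inv b"
    by (induct a rule: forms.abs_induct, induct b rule: forms.abs_induct)
      (simp add: ev flip: abs_forms_simps)
  show "grade_inv (a * b) = grade_inv a * grade_inv b"
    by (induct a rule: forms.abs_induct, induct b rule: forms.abs_induct)
      (simp add: ev flip: abs_forms_simps)
qed

lift_definition ext_d :: "'l::ab_group_add forms \<Rightarrow> 'l forms" is expr_deriv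
proof -
  fix a b :: "'l expr"
  assume "form_eq a b"
  then show "expr_deriv a = expr_deriv b"
  proof induction
    case (mul_cong a b a' b')
    then have "abs_forms a = abs_forms b" "abs_forms a' = abs_forms b'"
      by (simp_all add: forms.abs_eq_iff)
    with mul_cong show ?case by simp
  next
    case (X_X l m)
    then show ?case by (simp add: abs_forms_simps xf_dxf add.commute)
  next
    case (X_D l m)
    then show ?case using dxf_anticomm[of l m] by (simp add: abs_forms_simps)
  qed (simp_all add: abs_forms_simps dxf_add algebra_simps)
qed

lemma ext_d_simps [simp]:
  fixes a b :: "'l::ab_group_add forms" and l :: 'l
  shows "ext_d 0 = (0 :: 'l forms)" "ext_d 1 = (0 :: 'l forms)" "ext_d (- a) = - ext_d a" "ext_d (a + b) = ext_d a + ext_d b"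
  "ext_d (xf l) = dxf l" "ext_d (dxf l) = 0"
  "ext_d (a * b) = ext_d a * b + grade_inv a * ext_d b"
proof -
  note ev = ext_d.abs_eq
  show "ext_d 0 = (0 :: 'l forms)" "ext_d 1 = (0 :: 'l forms)"
    "ext_d (xf l) = dxf l" "ext_d (dxf l) = 0"
    using ev[of EZero] ev[of EOne] ev[of "EVar l"] ev[of "EDiff l"]
    by (simp_all add: abs_forms_simps)
  show "ext_d (- a) = - ext_d a"
    by (induct a rule: forms.abs_induct) (simp add: ev flip: abs_forms_simps)
  show "ext_d (a + b) = ext_d a + ext_d b"
    by (induct a rule: forms.abs_induct, induct b rule: forms.abs_induct)
      (simp add: ev flip: abs_forms_simps)
  show "ext_d (a * b) = ext_d a * b + grade_inv a * ext_d b"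
    by (induct a rule: forms.abs_induct, induct b rule: forms.abs_induct)
      (simp add: ev abs_forms_simps(5)[symmetric])
qed

lemma ext_d_ext_d: "ext_d (ext_d a) = 0"
proof -
  have g: "ext_d (grade_inv a) = - grade_inv (ext_d a)" for a :: "'a forms"
  proof (induction a rule: forms.abs_induct)
    case (1 e)
    show ?case by (induction e) (simp_all add: abs_forms_simps algebra_simps)
  qed
  show ?thesis
  proof (induction a rule: forms.abs_induct)
    case (1 e)
    show ?case by (induction e) (simp_all add: abs_forms_simps g)
  qed
qed

section \<open>Cochain complexes of abelian groups\<close>

record 'a cochain =
  grp :: "int \<Rightarrow> 'a monoid"
  diff :: "int \<Rightarrow> 'a \<Rightarrow> 'a"

definition cochain_complex :: "'a cochain \<Rightarrow> bool" where
  "cochain_complex C \<longleftrightarrow>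
     (\<forall>i. comm_group (grp C i)) \<and>
     (\<forall>i. diff C i \<in> hom (grp C i) (grp C (i + 1))) \<and>
     (\<forall>i. \<forall>x \<in> carrier (grp C i). diff C (i + 1) (diff C i x) = \<one>\<^bsub>grp C (i + 2)\<^esub>)"

definition cochain_iso :: "'a cochain \<Rightarrow> 'b cochain \<Rightarrow> (int \<Rightarrow> 'a \<Rightarrow> 'b) \<Rightarrow> bool" where
  "cochain_iso C C' f \<longleftrightarrow>
     cochain_complex C \<and> cochain_complex C' \<and>
     (\<forall>i. f i \<in> iso (grp C i) (grp C' i)) \<and>
     (\<forall>i. \<forall>x \<in> carrier (grp C i). f (i + 1) (diff C i x) = diff C' i (f i x))"

definition cocycles :: "'a cochain \<Rightarrow> int \<Rightarrow> 'a set" where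
  "cocycles C i = kernel (grp C i) (grp C (i + 1)) (diff C i)"

definition coboundaries :: "'a cochain \<Rightarrow> int \<Rightarrow> 'a set" where
  "coboundaries C i = diff C (i - 1) ` carrier (grp C (i - 1))"

definition cohom :: "'a cochain \<Rightarrow> int \<Rightarrow> 'a set monoid" where
  "cohom C i = (grp C i)\<lparr>carrier := cocycles C i\<rparr> Mod coboundaries C i"

definition cohom_class :: "'a cochain \<Rightarrow> int \<Rightarrow> 'a \<Rightarrow> 'a set" where
  "cohom_class C i z = coboundaries C i #>\<^bsub>grp C i\<^esub> z"

definition cohom_map :: "'b cochain \<Rightarrow> (int \<Rightarrow> 'a \<Rightarrow> 'b) \<Rightarrow> int \<Rightarrow> 'a set \<Rightarrow> 'b set" where
  "cohom_map C' f i c = the_elem ((\<lambda>z. cohom_class C' i (f i z)) ` c)"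

definition mult_image :: "nat \<Rightarrow> 'a cochain \<Rightarrow> int \<Rightarrow> 'a set" where
  "mult_image p C i = (\<lambda>x. x [^]\<^bsub>grp C i\<^esub> p) ` carrier (grp C i)"

definition reduce :: "nat \<Rightarrow> 'a cochain \<Rightarrow> int \<Rightarrow> 'a \<Rightarrow> 'a set" where
  "reduce p C i x = mult_image p C i #>\<^bsub>grp C i\<^esub> x"

text \<open>\<open>C \<otimes> \<int>/p\<close>, realised as \<open>C / pC\<close>.\<close>

definition mod_p :: "nat \<Rightarrow> 'a cochain \<Rightarrow> 'a set cochain" where
  "mod_p p C =
     \<lparr>grp = (\<lambda>i. grp C i Mod mult_image p C i),
      diff = (\<lambda>i X. the_elem ((\<lambda>x. reduce p C (i + 1) (diff C i x)) ` X))\<rparr>"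

section \<open>Exact couples and the Bockstein spectral sequence\<close>

text \<open>The maps of a couple are \<open>i : D\<^sup>n \<rightarrow> D\<^sup>n\<close>, \<open>j : D\<^sup>n \<rightarrow> E\<^sup>n\<close> and
  \<open>k : E\<^sup>n \<rightarrow> D\<^sup>n\<^sup>+\<^sup>1\<close>.\<close>

record ('d, 'e) couple =
  Dgrp :: "int \<Rightarrow> 'd monoid"
  Egrp :: "int \<Rightarrow> 'e monoid"
  imap :: "int \<Rightarrow> 'd \<Rightarrow> 'd"
  jmap :: "int \<Rightarrow> 'd \<Rightarrow> 'e"
  kmap :: "int \<Rightarrow> 'e \<Rightarrow> 'd"

definition couple_complex :: "('d, 'e) couple \<Rightarrow> 'e cochain" where
  "couple_complex X = \<lparr>grp = Egrp X, diff = (\<lambda>n e. jmap X (n + 1) (kmap X n e))\<rparr>"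

text \<open>
  The iterated quotients \<open>E\<^sub>r\<^sub>+\<^sub>1 = H(E\<^sub>r, d\<^sub>r)\<close> must share one type.  The elements of all
  the groups \<open>E\<^sub>r\<close> considered are nonempty, pairwise disjoint sets (cosets), so a coset of
  \<open>E\<^sub>r\<close>, that is a set of elements of \<open>E\<^sub>r\<close>, is determined by its union.  This union
  represents the coset: \<open>flat_cohom\<close> is the cohomology group transported along the map
  \<open>\<Union>\<close>, which is injective on it.
\<close>

definition flat_cohom :: "'a set cochain \<Rightarrow> int \<Rightarrow> 'a set monoid" where
  "flat_cohom C i = image_group Union (cohom C i)"

definition flat_class :: "'a set cochain \<Rightarrow> int \<Rightarrow> 'a set \<Rightarrow> 'a set" where
  "flat_class C i z = \<Union> (cohom_class C i z)"

definition derived_couple :: "('d, 'e set) couple \<Rightarrow> ('d, 'e set) couple" where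
  "derived_couple X =
     \<lparr>Dgrp = (\<lambda>n. (Dgrp X n)\<lparr>carrier := imap X n ` carrier (Dgrp X n)\<rparr>),
      Egrp = flat_cohom (couple_complex X),
      imap = imap X,
      jmap = (\<lambda>n y. the_elem
        {flat_class (couple_complex X) n (jmap X n a) | a. a \<in> carrier (Dgrp X n) \<and> imap X n a = y}),
      kmap = (\<lambda>n c. the_elem
        {kmap X n e | e. e \<in> cocycles (couple_complex X) n \<and> flat_class (couple_complex X) n e = c})\<rparr>"

text \<open>The exact couple of \<open>0 \<rightarrow> C \<rightarrow> C \<rightarrow> C/p \<rightarrow> 0\<close>; the map \<open>k\<close> is the connecting map,
  sending the class of the reduction of \<open>\<omega>\<close> to the class of \<open>\<eta>\<close> where \<open>d\<omega> = p\<eta>\<close>.\<close>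

definition bockstein_couple :: "nat \<Rightarrow> 'a cochain \<Rightarrow> ('a set, 'a set set) couple" where
  "bockstein_couple p C =
     \<lparr>Dgrp = cohom C,
      Egrp = cohom (mod_p p C),
      imap = (\<lambda>n c. c [^]\<^bsub>cohom C n\<^esub> p),
      jmap = cohom_map (mod_p p C) (reduce p C),
      kmap = (\<lambda>n c. the_elem
        {cohom_class C (n + 1) \<eta> | \<eta> \<omega> z. z \<in> c \<and> \<omega> \<in> z \<and>
           \<eta> \<in> carrier (grp C (n + 1)) \<and> diff C n \<omega> = \<eta> [^]\<^bsub>grp C (n + 1)\<^esub> p})\<rparr>"

text \<open>The page \<open>(E\<^sub>r, d\<^sub>r)\<close> for \<open>r \<ge> 1\<close> (for \<open>r = 0\<close> the value is \<open>E\<^sub>1\<close> as well).\<close>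

definition bockstein_page :: "nat \<Rightarrow> 'a cochain \<Rightarrow> nat \<Rightarrow> 'a set set cochain" where
  "bockstein_page p C r = couple_complex ((derived_couple ^^ (r - 1)) (bockstein_couple p C))"

section \<open>The de Rham complex and the inverse Cartier map\<close>

definition deRham :: "'l::ab_group_add forms cochain" where
  "deRham =
     \<lparr>grp = (\<lambda>i. \<lparr>carrier = Omega i, monoid.mult = (+), one = 0\<rparr>),
      diff = (\<lambda>i. ext_d)\<rparr>"

text \<open>The ring endomorphism with \<open>x\<^sub>b \<mapsto> x\<^sub>b\<^sup>p\<close> and \<open>dx\<^sub>b \<mapsto> x\<^sub>b\<^sup>p\<^sup>-\<^sup>1 dx\<^sub>b\<close> for the elements
  \<open>b\<close> of a basis \<open>B\<close>.\<close>

definition frob_lift :: "nat \<Rightarrow> 'l::ab_group_add set \<Rightarrow> 'l forms \<Rightarrow> 'l forms" where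
  "frob_lift p B = (THE F.
     F 1 = 1 \<and> (\<forall>a b. F (a + b) = F a + F b) \<and> (\<forall>a b. F (a * b) = F a * F b) \<and>
     (\<forall>b\<in>B. F (xf b) = xf b ^ p \<and> F (dxf b) = xf b ^ (p - 1) * dxf b))"

definition cartier_inv ::
  "nat \<Rightarrow> 'l::ab_group_add set \<Rightarrow> int \<Rightarrow> 'l forms set \<Rightarrow> 'l forms set set" where
  "cartier_inv p B i X =
     the_elem ((\<lambda>\<omega>. cohom_class (mod_p p deRham) i (reduce p deRham i (frob_lift p B \<omega>))) ` X)"

text \<open>\<open>\<phi>\<^sub>r\<close> for \<open>r \<ge> 1\<close>; the union is the identification of \<open>H(E\<^sub>r, d\<^sub>r)\<close> with \<open>E\<^sub>r\<^sub>+\<^sub>1\<close>.\<close>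

primrec phi ::
  "nat \<Rightarrow> 'l::ab_group_add set \<Rightarrow> nat \<Rightarrow> int \<Rightarrow> 'l forms set \<Rightarrow> 'l forms set set" where
  "phi p B 0 = undefined"
| "phi p B (Suc r) =
     (if r = 0 then cartier_inv p B
      else (\<lambda>i X. \<Union> (cohom_map (bockstein_page p deRham r) (phi p B r) i (cartier_inv p B i X))))"

end

theory Submission
  imports Defs
begin

text \<open>
  Let \<open>F\<close> be the ring endomorphism of \<open>\<Omega>\<^sup>*\<close> that lifts the inverse Cartier map.  Integrally
  \<open>dF = pFd\<close>, so \<open>dF\<^sup>r\<omega> = p\<^sup>rF\<^sup>rd\<omega>\<close> and the Bockstein differential \<open>d\<^sub>r\<close> takes the class of
  \<open>F\<^sup>r\<omega>\<close> to that of \<open>F\<^sup>rd\<omega>\<close>.  Hence all \<open>\<phi>\<^sub>r\<close> are isomorphisms as soon as \<open>F\<close> induces an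
  isomorphism from \<open>\<Omega>/p\<close> to \<open>H(\<Omega>/p)\<close>; this part works for every complex without \<open>p\<close>-torsion.

  Cartier's theorem is proved with the basis of monomials \<open>x\<^sup>m \<Prod>\<^bsub>b\<in>S\<^esub> d log x\<^sub>b\<close>.  On this basis
  \<open>F\<close> multiplies \<open>m\<close> by \<open>p\<close>, and so has a left inverse \<open>\<psi>\<close> with \<open>\<psi>d = pd\<psi>\<close>, which gives
  injectivity.  Where \<open>m\<^sub>b\<close> is prime to \<open>p\<close>, contraction with \<open>x\<^sub>b \<partial>/\<partial>x\<^sub>b\<close> is a homotopy
  from multiplication by \<open>m\<^sub>b\<close> to zero.  These contractions add up to a map \<open>h\<close> with
  \<open>dh + hd \<equiv> 1 - F\<psi>\<close> modulo \<open>p\<close>, which gives surjectivity.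
\<close>

section \<open>Quotients and cohomology\<close>

text \<open>The forms are a quotient of ring expressions, so neither the independence of monomials
  nor the absence of torsion is available at the outset. An action of the ring on integer-valued
  coefficient functions supplies both: it yields coordinates, and through them maps prescribed
  monomial by monomial. The logarithmic indexing is chosen because d(x^m) is x^m times the sum of
  the m_b dlog x_b: d stays within one exponent function m, so divisibility of m by p separates the
  part reached by \<open>F\<close> from the part that is contractible modulo p. The relation between
  \<open>\<psi>\<close> and d is then forced: where p divides m, the monomial is \<open>F\<close> of
  another one and dF = pFd applies; elsewhere \<open>\<psi>\<close> vanishes. Torsion matters
  because the connecting map divides by p. Without torsion the quotient is unique and again a
  cocycle, so each d_r can be read off from the single representative \<open>F^r \<omega>\<close>,
  whose differential is visibly divisible by p^r.\<close>

context comm_group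
begin

lemma r_coset_eq_iff:
  assumes "subgroup H G" "x \<in> carrier G" "y \<in> carrier G"
  shows "H #> x = H #> y \<longleftrightarrow> (\<exists>h\<in>H. x = h \<otimes> y)"
proof -
  have "H #> x = H #> y \<longleftrightarrow> x \<in> H #> y"
    using assms repr_independence rcos_self by metis
  then show ?thesis by (auto simp: r_coset_def)
qed

lemma r_coset_mult:
  assumes "subgroup H G" "x \<in> carrier G" "y \<in> carrier G"
  shows "H #> (x \<otimes> y) = (H #> x) \<otimes>\<^bsub>G Mod H\<^esub> (H #> y)"
  using normal.rcos_sum[OF subgroup_imp_normal[OF assms(1)] assms(2,3)]
  by (simp add: FactGroup_def)

lemma carrier_Mod: "carrier (G Mod H) = (\<lambda>x. H #> x) ` carrier G"
  by (auto simp: FactGroup_def RCOSETS_def)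

lemma one_Mod: "subgroup H G \<Longrightarrow> \<one>\<^bsub>G Mod H\<^esub> = H #> \<one>"
  using coset_join2[OF one_closed _ subgroup.one_closed] by (simp add: FactGroup_def)

end

section \<open>Cocycles, coboundaries and cohomology classes\<close>

locale cochain =
  fixes C :: "'a cochain"
  assumes complex: "cochain_complex C"
begin

lemma grp_comm: "comm_group (grp C i)"
  using complex by (simp add: cochain_complex_def)

lemma grp_group: "group (grp C i)"
  using grp_comm by (rule comm_group.axioms(2))

lemma diff_hom: "diff C i \<in> hom (grp C i) (grp C (i + 1))"
  using complex by (simp add: cochain_complex_def)

lemma diff_group_hom: "group_hom (grp C i) (grp C (i + 1)) (diff C i)"
  using diff_hom grp_group by (simp add: group_hom_def group_hom_axioms_def)

lemma diff_pred_group_hom: "group_hom (grp C (i - 1)) (grp C i) (diff C (i - 1))"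
  using diff_group_hom[of "i - 1"] by simp

lemma diff_diff:
  assumes "x \<in> carrier (grp C i)"
  shows "diff C (i + 1) (diff C i x) = \<one>\<^bsub>grp C (i + 1 + 1)\<^esub>"
proof -
  have "i + 1 + 1 = i + 2" by simp
  then show ?thesis using complex assms by (simp only: cochain_complex_def)
qed

lemma diff_pred_diff:
  "x \<in> carrier (grp C (i - 1)) \<Longrightarrow> diff C i (diff C (i - 1) x) = \<one>\<^bsub>grp C (i + 1)\<^esub>"
  using diff_diff[of x "i - 1"] by simp

lemma cocycles_iff:
  "z \<in> cocycles C i \<longleftrightarrow> z \<in> carrier (grp C i) \<and> diff C i z = \<one>\<^bsub>grp C (i + 1)\<^esub>"
  by (simp add: cocycles_def kernel_def)

lemma cocycles_subgroup: "subgroup (cocycles C i) (grp C i)"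
  unfolding cocycles_def by (rule group_hom.subgroup_kernel[OF diff_group_hom])

abbreviation cocycle_grp :: "int \<Rightarrow> 'a monoid" where
  "cocycle_grp i \<equiv> (grp C i)\<lparr>carrier := cocycles C i\<rparr>"

lemma cocycle_grp_comm: "comm_group (cocycle_grp i)"
proof (rule group.group_comm_groupI)
  show "group (cocycle_grp i)"
    by (rule subgroup.subgroup_is_group[OF cocycles_subgroup grp_group])
qed (auto simp: cocycles_iff intro: comm_monoid.m_comm comm_group.axioms(1) grp_comm)

lemma diff_in_cocycles:
  "y \<in> carrier (grp C (i - 1)) \<Longrightarrow> diff C (i - 1) y \<in> cocycles C i"
  using group_hom.hom_closed[OF diff_pred_group_hom]
  by (simp add: cocycles_iff diff_pred_diff)

lemma coboundaries_subgroup: "subgroup (coboundaries C i) (cocycle_grp i)"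
proof (rule group.subgroup_incl[OF grp_group])
  show "subgroup (coboundaries C i) (grp C i)"
    using group_hom.img_is_subgroup[OF diff_pred_group_hom] by (simp add: coboundaries_def)
  show "coboundaries C i \<subseteq> cocycles C i"
    by (auto simp: coboundaries_def diff_in_cocycles)
qed (rule cocycles_subgroup)

text \<open>A coset depends on the multiplication and not on the carrier, so it may be formed inside
  the group of cocycles, where the quotient lemmas apply.\<close>

lemma cohom_class_alt: "cohom_class C i z = coboundaries C i #>\<^bsub>cocycle_grp i\<^esub> z"
  by (simp add: cohom_class_def r_coset_def)

lemma cohom_comm: "comm_group (cohom C i)"
  unfolding cohom_def
  by (rule comm_group.abelian_FactGroup[OF cocycle_grp_comm coboundaries_subgroup])

lemma cohom_carrier: "carrier (cohom C i) = cohom_class C i ` cocycles C i"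
  using comm_group.carrier_Mod[OF cocycle_grp_comm] by (simp add: cohom_def cohom_class_alt)

lemma cohom_class_mult:
  "\<lbrakk>x \<in> cocycles C i; y \<in> cocycles C i\<rbrakk> \<Longrightarrow>
    cohom_class C i (x \<otimes>\<^bsub>grp C i\<^esub> y) = cohom_class C i x \<otimes>\<^bsub>cohom C i\<^esub> cohom_class C i y"
  using comm_group.r_coset_mult[OF cocycle_grp_comm coboundaries_subgroup]
  by (simp add: cohom_def cohom_class_alt)

lemma cohom_class_hom: "cohom_class C i \<in> hom (cocycle_grp i) (cohom C i)"
  by (auto simp: hom_def cohom_class_mult cohom_carrier)

lemma cohom_one: "\<one>\<^bsub>cohom C i\<^esub> = cohom_class C i \<one>\<^bsub>grp C i\<^esub>"
  using comm_group.one_Mod[OF cocycle_grp_comm coboundaries_subgroup]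
  by (simp add: cohom_def cohom_class_alt)

lemma cohom_class_pow:
  assumes "x \<in> cocycles C i"
  shows "cohom_class C i (x [^]\<^bsub>grp C i\<^esub> (n::nat)) = cohom_class C i x [^]\<^bsub>cohom C i\<^esub> n"
proof -
  have "group_hom (cocycle_grp i) (cohom C i) (cohom_class C i)"
    using cohom_class_hom cocycle_grp_comm cohom_comm
    by (simp add: group_hom_def group_hom_axioms_def comm_group.axioms(2))
  then have "cohom_class C i (x [^]\<^bsub>cocycle_grp i\<^esub> n) = cohom_class C i x [^]\<^bsub>cohom C i\<^esub> n"
    using assms group_hom.hom_nat_pow by fastforce
  then show ?thesis by (simp add: nat_pow_def)
qed

lemma cohom_class_eq_iff:
  assumes "x \<in> cocycles C i" "y \<in> cocycles C i"
  shows "cohom_class C i x = cohom_class C i y \<longleftrightarrow>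
    (\<exists>w\<in>carrier (grp C (i - 1)). x = diff C (i - 1) w \<otimes>\<^bsub>grp C i\<^esub> y)"
  using comm_group.r_coset_eq_iff[OF cocycle_grp_comm coboundaries_subgroup] assms
  by (simp add: cohom_class_alt coboundaries_def)

lemma cohom_class_eq_one_iff:
  assumes "x \<in> cocycles C i"
  shows "cohom_class C i x = \<one>\<^bsub>cohom C i\<^esub> \<longleftrightarrow>
    (\<exists>w\<in>carrier (grp C (i - 1)). x = diff C (i - 1) w)"
proof -
  interpret G: group "grp C i" by (rule grp_group)
  interpret d: group_hom "grp C (i - 1)" "grp C i" "diff C (i - 1)" by (rule diff_pred_group_hom)
  show ?thesis
    using assms by (simp add: cohom_one cohom_class_eq_iff subgroup.one_closed[OF cocycles_subgroup])
qed

text \<open>Classes are literal sets, and the induced maps are defined by \<open>the_elem\<close>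
  over their elements; this turns membership into equality of classes.\<close>

lemma mem_cohom_class:
  assumes "x \<in> cocycles C i"
  shows "y \<in> cohom_class C i x \<longleftrightarrow> y \<in> cocycles C i \<and> cohom_class C i y = cohom_class C i x"
proof -
  interpret Z: comm_group "cocycle_grp i" by (rule cocycle_grp_comm)
  have "y \<in> cocycles C i" if "y \<in> cohom_class C i x"
    using that assms Z.r_coset_subset_G[OF subgroup.subset[OF coboundaries_subgroup]]
    by (auto simp: cohom_class_alt)
  moreover have "y \<in> cohom_class C i x \<longleftrightarrow> cohom_class C i y = cohom_class C i x"
    if "y \<in> cocycles C i"
    using that assms
    by (simp add: cohom_class_eq_iff) (auto simp: cohom_class_def r_coset_def coboundaries_def)
  ultimately show ?thesis by blast
qed

end

text \<open>A chain map takes coboundaries to coboundaries, so all elements of a class give the same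
  value and \<open>the_elem\<close> is determined.\<close>

lemma cohom_map_class:
  assumes C: "cochain C" and C': "cochain C'" and z: "z \<in> cocycles C i"
    and f: "\<And>i. f i \<in> hom (grp C i) (grp C' i)"
    and comm: "\<And>i x. x \<in> carrier (grp C i) \<Longrightarrow> f (i + 1) (diff C i x) = diff C' i (f i x)"
  shows "f i z \<in> cocycles C' i"
    and "cohom_map C' f i (cohom_class C i z) = cohom_class C' i (f i z)"
proof -
  interpret C: cochain C by (rule C)
  interpret C': cochain C' by (rule C')
  have fh: "group_hom (grp C i) (grp C' i) (f i)" for i
    using f C.grp_group C'.grp_group by (simp add: group_hom_def group_hom_axioms_def)
  have coc: "f i w \<in> cocycles C' i" if "w \<in> cocycles C i" for w
    using that comm[of w i] group_hom.hom_closed[OF fh] group_hom.hom_one[OF fh]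
    by (auto simp: C.cocycles_iff C'.cocycles_iff)
  then show "f i z \<in> cocycles C' i" using z .
  have "cohom_class C' i (f i w) = cohom_class C' i (f i z)" if w: "w \<in> cohom_class C i z" for w
  proof -
    from w z have wc: "w \<in> cocycles C i" and "cohom_class C i w = cohom_class C i z"
      by (auto simp: C.mem_cohom_class)
    with z obtain y where y: "y \<in> carrier (grp C (i - 1))"
      and weq: "w = diff C (i - 1) y \<otimes>\<^bsub>grp C i\<^esub> z" by (auto simp: C.cohom_class_eq_iff)
    have "f i w = diff C' (i - 1) (f (i - 1) y) \<otimes>\<^bsub>grp C' i\<^esub> f i z"
      using comm[OF y] y z C.diff_in_cocycles[OF y]
      by (simp add: weq C.cocycles_iff group_hom.hom_mult[OF fh])
    then show ?thesis
      using coc[OF wc] coc[OF z] group_hom.hom_closed[OF fh y] by (auto simp: C'.cohom_class_eq_iff)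
  qed
  moreover have "z \<in> cohom_class C i z" using z by (simp add: C.mem_cohom_class)
  ultimately show "cohom_map C' f i (cohom_class C i z) = cohom_class C' i (f i z)"
    unfolding cohom_map_def by (intro the_elem_image_unique) blast+
qed

text \<open>Injectivity pulls a bounding cochain back through the bijection in degree
  \<open>i - 1\<close>; surjectivity uses injectivity in degree \<open>i + 1\<close> to see that the
  preimage of a cocycle is a cocycle.\<close>

lemma cohom_map_iso:
  assumes "cochain_iso C C' f"
  shows "cohom_map C' f i \<in> iso (cohom C i) (cohom C' i)"
proof -
  interpret C: cochain C using assms by (simp add: cochain_iso_def cochain_def)
  interpret C': cochain C' using assms by (simp add: cochain_iso_def cochain_def)
  have f: "f i \<in> hom (grp C i) (grp C' i)" and bij: "bij_betw (f i) (carrier (grp C i)) (carrier (grp C' i))"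
    and comm: "x \<in> carrier (grp C i) \<Longrightarrow> f (i + 1) (diff C i x) = diff C' i (f i x)" for i x
    using assms by (auto simp: cochain_iso_def iso_def)
  have fh: "group_hom (grp C i) (grp C' i) (f i)" for i
    using f C.grp_group C'.grp_group by (simp add: group_hom_def group_hom_axioms_def)
  note cl = cohom_map_class[OF C.cochain_axioms C'.cochain_axioms _ f comm]
  have hom: "cohom_map C' f i \<in> hom (cohom C i) (cohom C' i)"
  proof (rule homI)
    fix c c' assume "c \<in> carrier (cohom C i)" "c' \<in> carrier (cohom C i)"
    then obtain x y where x: "x \<in> cocycles C i" "c = cohom_class C i x"
      and y: "y \<in> cocycles C i" "c' = cohom_class C i y" by (auto simp: C.cohom_carrier)
    have xy: "x \<otimes>\<^bsub>grp C i\<^esub> y \<in> cocycles C i"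
      using x y subgroup.m_closed[OF C.cocycles_subgroup] by blast
    have xc: "x \<in> carrier (grp C i)" "y \<in> carrier (grp C i)" using x y by (auto simp: C.cocycles_iff)
    show "cohom_map C' f i (c \<otimes>\<^bsub>cohom C i\<^esub> c') =
        cohom_map C' f i c \<otimes>\<^bsub>cohom C' i\<^esub> cohom_map C' f i c'"
      using x y cl(2)[OF xy] cl(2)[OF x(1)] cl(2)[OF y(1)] cl(1)[OF x(1)] cl(1)[OF y(1)] xc
      by (simp add: C.cohom_class_mult[symmetric] C'.cohom_class_mult[symmetric]
          group_hom.hom_mult[OF fh])
  qed (use cl in \<open>auto simp: C.cohom_carrier C'.cohom_carrier\<close>)
  interpret h: group_hom "cohom C i" "cohom C' i" "cohom_map C' f i"
    using hom C.cohom_comm C'.cohom_comm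
    by (simp add: group_hom_def group_hom_axioms_def comm_group.axioms(2))
  have inj: "c = \<one>\<^bsub>cohom C i\<^esub>"
    if c: "c \<in> carrier (cohom C i)" "cohom_map C' f i c = \<one>\<^bsub>cohom C' i\<^esub>" for c
  proof -
    obtain x where x: "x \<in> cocycles C i" "c = cohom_class C i x" using c by (auto simp: C.cohom_carrier)
    with c cl obtain w where w: "w \<in> carrier (grp C' (i - 1))" and fx: "f i x = diff C' (i - 1) w"
      by (auto simp: C'.cohom_class_eq_one_iff)
    from w bij obtain v where v: "v \<in> carrier (grp C (i - 1))" "w = f (i - 1) v"
      by (metis bij_betw_imp_surj_on imageE)
    have "f i x = f i (diff C (i - 1) v)" using fx v comm[OF v(1)] by simp
    then have "x = diff C (i - 1) v"
      using bij x(1) C.diff_in_cocycles[OF v(1)] by (auto simp: C.cocycles_iff bij_betw_def inj_on_def)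
    then show ?thesis using x v by (auto simp: C.cohom_class_eq_one_iff)
  qed
  have surj: "c \<in> cohom_map C' f i ` carrier (cohom C i)" if c: "c \<in> carrier (cohom C' i)" for c
  proof -
    obtain y where y: "y \<in> cocycles C' i" "c = cohom_class C' i y" using c by (auto simp: C'.cohom_carrier)
    then obtain x where x: "x \<in> carrier (grp C i)" "y = f i x"
      using bij by (metis C'.cocycles_iff bij_betw_imp_surj_on imageE)
    have "f (i + 1) (diff C i x) = f (i + 1) \<one>\<^bsub>grp C (i + 1)\<^esub>"
      using comm[OF x(1)] x(2) y(1) group_hom.hom_one[OF fh] by (simp add: C'.cocycles_iff)
    then have "diff C i x = \<one>\<^bsub>grp C (i + 1)\<^esub>"
      using group_hom.hom_closed[OF C.diff_group_hom x(1)] group.is_monoid[OF C.grp_group]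
      by (intro inj_onD[OF bij_betw_imp_inj_on[OF bij]]) (auto intro: monoid.one_closed)
    with x have xz: "x \<in> cocycles C i" by (simp add: C.cocycles_iff)
    then show ?thesis using cl(2)[OF xz] x y by (auto simp: C.cohom_carrier)
  qed
  show ?thesis
    using hom surj h.hom_closed inj by (auto intro!: isoI simp: bij_betw_def h.inj_on_one_iff)
qed

section \<open>Reduction modulo \<open>p\<close>\<close>

lemma (in comm_group) pow_group_hom: "group_hom G G (\<lambda>x. x [^] (p::nat))"
  by unfold_locales (auto simp: hom_def nat_pow_distrib)

locale cochain_mod = cochain C for C :: "'a cochain" +
  fixes p :: nat
begin

abbreviation "red \<equiv> reduce p C"

abbreviation "Cp \<equiv> mod_p p C"

lemma mult_image_subgroup: "subgroup (mult_image p C i) (grp C i)"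
  unfolding mult_image_def
  by (rule group_hom.img_is_subgroup[OF comm_group.pow_group_hom[OF grp_comm]])

lemma grp_mod_p: "grp Cp i = grp C i Mod mult_image p C i"
  by (simp add: mod_p_def)

lemma mod_p_comm: "comm_group (grp Cp i)"
  unfolding grp_mod_p by (rule comm_group.abelian_FactGroup[OF grp_comm mult_image_subgroup])

lemma mod_p_carrier: "carrier (grp Cp i) = red i ` carrier (grp C i)"
  using comm_group.carrier_Mod[OF grp_comm] by (simp add: grp_mod_p reduce_def[abs_def])

lemma reduce_mult:
  "\<lbrakk>x \<in> carrier (grp C i); y \<in> carrier (grp C i)\<rbrakk> \<Longrightarrow>
    red i (x \<otimes>\<^bsub>grp C i\<^esub> y) = red i x \<otimes>\<^bsub>grp Cp i\<^esub> red i y"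
  using comm_group.r_coset_mult[OF grp_comm mult_image_subgroup] by (simp add: grp_mod_p reduce_def)

lemma reduce_hom: "red i \<in> hom (grp C i) (grp Cp i)"
  by (auto simp: hom_def reduce_mult mod_p_carrier)

lemma reduce_one: "red i \<one>\<^bsub>grp C i\<^esub> = \<one>\<^bsub>grp Cp i\<^esub>"
  using comm_group.one_Mod[OF grp_comm mult_image_subgroup] by (simp add: grp_mod_p reduce_def)

lemma reduce_eq_iff:
  assumes "x \<in> carrier (grp C i)" "y \<in> carrier (grp C i)"
  shows "red i x = red i y \<longleftrightarrow> (\<exists>a\<in>carrier (grp C i). x = a [^]\<^bsub>grp C i\<^esub> p \<otimes>\<^bsub>grp C i\<^esub> y)"
  using comm_group.r_coset_eq_iff[OF grp_comm mult_image_subgroup] assms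
  by (simp add: reduce_def mult_image_def)

lemma reduce_eq_one_iff:
  assumes "x \<in> carrier (grp C i)"
  shows "red i x = \<one>\<^bsub>grp Cp i\<^esub> \<longleftrightarrow> (\<exists>a\<in>carrier (grp C i). x = a [^]\<^bsub>grp C i\<^esub> p)"
proof -
  interpret G: comm_group "grp C i" by (rule grp_comm)
  show ?thesis using assms by (simp add: reduce_one[symmetric] reduce_eq_iff)
qed

lemma mem_reduce:
  assumes "x \<in> carrier (grp C i)"
  shows "y \<in> red i x \<longleftrightarrow> y \<in> carrier (grp C i) \<and> red i y = red i x"
proof -
  interpret G: comm_group "grp C i" by (rule grp_comm)
  have "y \<in> carrier (grp C i)" if "y \<in> red i x"
    using that assms G.r_coset_subset_G[OF subgroup.subset[OF mult_image_subgroup]]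
    by (auto simp: reduce_def)
  moreover have "y \<in> red i x \<longleftrightarrow> red i y = red i x" if "y \<in> carrier (grp C i)"
    using that assms
    by (simp add: reduce_eq_iff) (auto simp: reduce_def r_coset_def mult_image_def)
  ultimately show ?thesis by blast
qed

lemma diff_pow:
  "x \<in> carrier (grp C i) \<Longrightarrow>
    diff C i (x [^]\<^bsub>grp C i\<^esub> (n::nat)) = diff C i x [^]\<^bsub>grp C (i + 1)\<^esub> n"
  by (rule group_hom.hom_nat_pow[OF diff_group_hom])

text \<open>The differential commutes with p-th powers, so changing the representative by one
  changes the value by one.\<close>

lemma diff_mod_p:
  assumes x: "x \<in> carrier (grp C i)"
  shows "diff Cp i (red i x) = red (i + 1) (diff C i x)"
proof -
  interpret G: comm_group "grp C i" by (rule grp_comm)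
  interpret d: group_hom "grp C i" "grp C (i + 1)" "diff C i" by (rule diff_group_hom)
  have "red (i + 1) (diff C i y) = red (i + 1) (diff C i x)" if y: "y \<in> red i x" for y
  proof -
    obtain a where "a \<in> carrier (grp C i)" "y = a [^]\<^bsub>grp C i\<^esub> p \<otimes>\<^bsub>grp C i\<^esub> x"
      using y x by (auto simp: mem_reduce reduce_eq_iff)
    then show ?thesis using x by (auto simp: reduce_eq_iff diff_pow)
  qed
  moreover have "x \<in> red i x" using x by (simp add: mem_reduce)
  ultimately have "the_elem ((\<lambda>y. red (i + 1) (diff C i y)) ` red i x) = red (i + 1) (diff C i x)"
    by (intro the_elem_image_unique) blast+
  then show ?thesis by (simp add: mod_p_def)
qed

lemma mod_p_cochain: "cochain Cp"
proof
  have "diff Cp i \<in> hom (grp Cp i) (grp Cp (i + 1))" for i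
  proof -
    interpret d: group_hom "grp C i" "grp C (i + 1)" "diff C i" by (rule diff_group_hom)
    show ?thesis
      by (rule homI) (auto simp: mod_p_carrier diff_mod_p reduce_mult[symmetric])
  qed
  moreover have "diff Cp (i + 1) (diff Cp i X) = \<one>\<^bsub>grp Cp (i + 2)\<^esub>"
    if "X \<in> carrier (grp Cp i)" for i X
  proof -
    have i2: "i + 2 = i + 1 + 1" by simp
    interpret d: group_hom "grp C i" "grp C (i + 1)" "diff C i" by (rule diff_group_hom)
    show ?thesis
      using that unfolding i2 by (auto simp: mod_p_carrier diff_mod_p diff_diff reduce_one simp del: add.assoc)
  qed
  ultimately show "cochain_complex Cp"
    by (simp add: cochain_complex_def mod_p_comm)
qed

sublocale Cp: cochain Cp by (rule mod_p_cochain)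

text \<open>An integral cochain whose reduction is a cocycle modulo p. Elements of E_1 are handled
  through such lifts, which avoids cosets of cosets.\<close>

definition lift_cocycle :: "int \<Rightarrow> 'a \<Rightarrow> bool" where
  "lift_cocycle i \<omega> \<longleftrightarrow> \<omega> \<in> carrier (grp C i) \<and>
     (\<exists>\<eta>\<in>carrier (grp C (i + 1)). diff C i \<omega> = \<eta> [^]\<^bsub>grp C (i + 1)\<^esub> p)"

abbreviation mclass :: "int \<Rightarrow> 'a \<Rightarrow> 'a set set" where
  "mclass i \<omega> \<equiv> cohom_class Cp i (red i \<omega>)"

lemma reduce_mem_cocycles_iff:
  assumes "\<omega> \<in> carrier (grp C i)"
  shows "red i \<omega> \<in> cocycles Cp i \<longleftrightarrow> lift_cocycle i \<omega>"
proof -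
  have "diff C i \<omega> \<in> carrier (grp C (i + 1))"
    by (rule group_hom.hom_closed[OF diff_group_hom assms])
  then show ?thesis
    using assms
    by (simp add: Cp.cocycles_iff diff_mod_p reduce_eq_one_iff mod_p_carrier lift_cocycle_def)
qed

lemma reduce_cocycle: "lift_cocycle i \<omega> \<Longrightarrow> red i \<omega> \<in> cocycles Cp i"
  by (simp add: reduce_mem_cocycles_iff lift_cocycle_def)

lemma lift_cocycle_cocycle: "z \<in> cocycles C i \<Longrightarrow> lift_cocycle i z"
  using comm_group.axioms(2)[OF grp_comm] group.is_monoid
  by (auto simp: cocycles_iff lift_cocycle_def intro!: bexI[of _ "\<one>\<^bsub>grp C (i + 1)\<^esub>"]
      intro: monoid.one_closed monoid.nat_pow_one[symmetric])

lemma mod_cohom_carrier: "carrier (cohom Cp i) = mclass i ` {\<omega>. lift_cocycle i \<omega>}"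
proof -
  have "cocycles Cp i = red i ` {\<omega>. lift_cocycle i \<omega>}"
  proof (intro equalityI subsetI)
    fix z assume z: "z \<in> cocycles Cp i"
    then obtain \<omega> where "\<omega> \<in> carrier (grp C i)" "z = red i \<omega>"
      by (auto simp: Cp.cocycles_iff mod_p_carrier)
    with z show "z \<in> red i ` {\<omega>. lift_cocycle i \<omega>}" by (auto simp: reduce_mem_cocycles_iff)
  qed (auto simp: reduce_cocycle)
  then show ?thesis by (simp add: Cp.cohom_carrier image_image)
qed

text \<open>Unfolds both quotients at once: the boundary modulo p contributes
  \<open>\<beta>\<close>, and the equality of reductions contributes
  \<open>\<alpha>\<close>.\<close>

lemma mclass_eq_iff:
  assumes "lift_cocycle i \<omega>" "lift_cocycle i \<omega>'"
  shows "mclass i \<omega> = mclass i \<omega>' \<longleftrightarrow>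
    (\<exists>\<alpha>\<in>carrier (grp C i). \<exists>\<beta>\<in>carrier (grp C (i - 1)).
      \<omega> = \<alpha> [^]\<^bsub>grp C i\<^esub> p \<otimes>\<^bsub>grp C i\<^esub> (diff C (i - 1) \<beta> \<otimes>\<^bsub>grp C i\<^esub> \<omega>'))"
proof -
  interpret G: comm_group "grp C i" by (rule grp_comm)
  interpret d: group_hom "grp C (i - 1)" "grp C i" "diff C (i - 1)" by (rule diff_pred_group_hom)
  have "mclass i \<omega> = mclass i \<omega>' \<longleftrightarrow>
      (\<exists>\<beta>\<in>carrier (grp C (i - 1)).
        red i \<omega> = red i (diff C (i - 1) \<beta>) \<otimes>\<^bsub>grp Cp i\<^esub> red i \<omega>')"
    using assms diff_mod_p[of _ "i - 1"]
    by (simp add: Cp.cohom_class_eq_iff reduce_cocycle mod_p_carrier)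
  also have "\<dots> \<longleftrightarrow> (\<exists>\<beta>\<in>carrier (grp C (i - 1)). red i \<omega> = red i (diff C (i - 1) \<beta> \<otimes>\<^bsub>grp C i\<^esub> \<omega>'))"
    using assms by (simp add: reduce_mult lift_cocycle_def)
  also have "\<dots> \<longleftrightarrow> (\<exists>\<beta>\<in>carrier (grp C (i - 1)). \<exists>\<alpha>\<in>carrier (grp C i).
      \<omega> = \<alpha> [^]\<^bsub>grp C i\<^esub> p \<otimes>\<^bsub>grp C i\<^esub> (diff C (i - 1) \<beta> \<otimes>\<^bsub>grp C i\<^esub> \<omega>'))"
    using assms by (simp add: reduce_eq_iff lift_cocycle_def)
  finally show ?thesis by blast
qed

lemma lift_cocycle_mult:
  assumes "lift_cocycle i x" "lift_cocycle i y"
  shows "lift_cocycle i (x \<otimes>\<^bsub>grp C i\<^esub> y)"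
    and "mclass i (x \<otimes>\<^bsub>grp C i\<^esub> y) = mclass i x \<otimes>\<^bsub>cohom Cp i\<^esub> mclass i y"
proof -
  have c: "x \<in> carrier (grp C i)" "y \<in> carrier (grp C i)" using assms by (auto simp: lift_cocycle_def)
  have "red i (x \<otimes>\<^bsub>grp C i\<^esub> y) \<in> cocycles Cp i"
    using assms c subgroup.m_closed[OF Cp.cocycles_subgroup] by (simp add: reduce_mult reduce_cocycle)
  then show "lift_cocycle i (x \<otimes>\<^bsub>grp C i\<^esub> y)"
    using c group.is_monoid[OF grp_group] by (simp add: reduce_mem_cocycles_iff monoid.m_closed)
  show "mclass i (x \<otimes>\<^bsub>grp C i\<^esub> y) = mclass i x \<otimes>\<^bsub>cohom Cp i\<^esub> mclass i y"
    using assms c by (simp add: reduce_mult Cp.cohom_class_mult reduce_cocycle)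
qed

end

section \<open>Exact couples\<close>

text \<open>The record \<open>couple\<close> carries no laws. Exactness is what makes the
  \<open>the_elem\<close> expressions in \<open>derived_couple\<close> independent of
  choices.\<close>

locale exact_couple =
  fixes X :: "('d, 'e) couple"
  assumes D_comm: "comm_group (Dgrp X n)"
    and E_comm: "comm_group (Egrp X n)"
    and i_hom: "imap X n \<in> hom (Dgrp X n) (Dgrp X n)"
    and j_hom: "jmap X n \<in> hom (Dgrp X n) (Egrp X n)"
    and k_hom: "kmap X n \<in> hom (Egrp X n) (Dgrp X (n + 1))"
    and exact_ij: "a \<in> carrier (Dgrp X n) \<Longrightarrow>
      jmap X n a = \<one>\<^bsub>Egrp X n\<^esub> \<longleftrightarrow> a \<in> imap X n ` carrier (Dgrp X n)"
    and exact_jk: "e \<in> carrier (Egrp X n) \<Longrightarrow>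
      kmap X n e = \<one>\<^bsub>Dgrp X (n + 1)\<^esub> \<longleftrightarrow> e \<in> jmap X n ` carrier (Dgrp X n)"
    and exact_ki: "b \<in> carrier (Dgrp X (n + 1)) \<Longrightarrow>
      imap X (n + 1) b = \<one>\<^bsub>Dgrp X (n + 1)\<^esub> \<longleftrightarrow> b \<in> kmap X n ` carrier (Egrp X n)"
begin

lemma i_group_hom: "group_hom (Dgrp X n) (Dgrp X n) (imap X n)"
  using i_hom D_comm by (simp add: group_hom_def group_hom_axioms_def comm_group.axioms(2))

lemma j_group_hom: "group_hom (Dgrp X n) (Egrp X n) (jmap X n)"
  using j_hom D_comm E_comm by (simp add: group_hom_def group_hom_axioms_def comm_group.axioms(2))

lemma k_group_hom: "group_hom (Egrp X n) (Dgrp X (n + 1)) (kmap X n)"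
  using k_hom D_comm E_comm by (simp add: group_hom_def group_hom_axioms_def comm_group.axioms(2))

lemmas i_closed [simp] = group_hom.hom_closed[OF i_group_hom]
  and j_closed [simp] = group_hom.hom_closed[OF j_group_hom]
  and k_closed [simp] = group_hom.hom_closed[OF k_group_hom]

lemma exact_ki': "b \<in> carrier (Dgrp X n) \<Longrightarrow>
    imap X n b = \<one>\<^bsub>Dgrp X n\<^esub> \<longleftrightarrow> b \<in> kmap X (n - 1) ` carrier (Egrp X (n - 1))"
  using exact_ki[of b "n - 1"] by simp

lemma k_closed' [simp]: "e \<in> carrier (Egrp X (n - 1)) \<Longrightarrow> kmap X (n - 1) e \<in> carrier (Dgrp X n)"
  using k_closed[of e "n - 1"] by simp

lemma k_j: "a \<in> carrier (Dgrp X n) \<Longrightarrow> kmap X n (jmap X n a) = \<one>\<^bsub>Dgrp X (n + 1)\<^esub>"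
  by (simp add: exact_jk)

lemma j_i: "a \<in> carrier (Dgrp X n) \<Longrightarrow> jmap X n (imap X n a) = \<one>\<^bsub>Egrp X n\<^esub>"
  by (simp add: exact_ij)

lemma i_k: "e \<in> carrier (Egrp X n) \<Longrightarrow> imap X (n + 1) (kmap X n e) = \<one>\<^bsub>Dgrp X (n + 1)\<^esub>"
  by (simp add: exact_ki)

abbreviation "E \<equiv> couple_complex X"

lemma grp_E [simp]: "grp E n = Egrp X n"
  and diff_E [simp]: "diff E n e = jmap X (n + 1) (kmap X n e)"
  by (simp_all add: couple_complex_def)

lemma couple_cochain: "cochain E"
proof
  have "diff E n \<in> hom (Egrp X n) (Egrp X (n + 1))" for n
    using group_hom.hom_mult[OF j_group_hom] group_hom.hom_mult[OF k_group_hom]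
    by (intro homI) simp_all
  moreover have "diff E (n + 1) (diff E n e) = \<one>\<^bsub>Egrp X (n + 2)\<^esub>"
    if "e \<in> carrier (Egrp X n)" for n e
  proof -
    have n2: "n + 2 = n + 1 + 1" by simp
    show ?thesis
      unfolding n2 using that group_hom.hom_one[OF j_group_hom] by (simp add: k_j del: add.assoc)
  qed
  ultimately show "cochain_complex E"
    by (simp add: cochain_complex_def E_comm)
qed

sublocale E: cochain E by (rule couple_cochain)

lemma j_cocycle: "a \<in> carrier (Dgrp X n) \<Longrightarrow> jmap X n a \<in> cocycles E n"
  using group_hom.hom_one[OF j_group_hom] by (simp add: E.cocycles_iff k_j)

text \<open>As d = jk, being a cocycle means that k takes values in the kernel of j, which is the
  image of i. Hence k maps cocycles into the group D of the derived couple.\<close>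

lemma cocycle_iff_k:
  "e \<in> cocycles E n \<longleftrightarrow>
    e \<in> carrier (Egrp X n) \<and> kmap X n e \<in> imap X (n + 1) ` carrier (Dgrp X (n + 1))"
  by (auto simp: E.cocycles_iff exact_ij)

end

section \<open>The derived couple\<close>

text \<open>The invariant behind representing a coset by its union: it makes the union injective on
  cohomology (\<open>Union_inj\<close>) and is inherited by the derived couple
  (\<open>derived_flat\<close>).\<close>

definition disjoint_carriers :: "'a set cochain \<Rightarrow> bool" where
  "disjoint_carriers K \<longleftrightarrow>
     (\<forall>n. \<forall>e\<in>carrier (grp K n). e \<noteq> {} \<and> (\<forall>e'\<in>carrier (grp K n). e \<inter> e' \<noteq> {} \<longrightarrow> e = e'))"

locale flat_cochain = cochain K for K :: "'a set cochain" +
  assumes disj: "disjoint_carriers K"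
begin

text \<open>A common point lies in one element of each class. Disjointness identifies these two
  elements, and classes sharing an element coincide.\<close>

lemma flat_class_overlap:
  assumes x: "x \<in> cocycles K n" and y: "y \<in> cocycles K n"
    and meet: "flat_class K n x \<inter> flat_class K n y \<noteq> {}"
  shows "cohom_class K n x = cohom_class K n y"
proof -
  from meet obtain s t where s: "s \<in> cohom_class K n x" and t: "t \<in> cohom_class K n y"
    and st: "s \<inter> t \<noteq> {}" by (auto simp: flat_class_def)
  then have "s \<in> cocycles K n" "t \<in> cocycles K n" using x y by (auto simp: mem_cohom_class)
  with st disj have "s = t" unfolding disjoint_carriers_def cocycles_iff by blast
  with s t x y show ?thesis by (simp add: mem_cohom_class)
qed

lemma flat_class_nonempty: "x \<in> cocycles K n \<Longrightarrow> flat_class K n x \<noteq> {}"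
proof -
  assume x: "x \<in> cocycles K n"
  then have "x \<in> cohom_class K n x" by (simp add: mem_cohom_class)
  moreover have "x \<noteq> {}" using x disj unfolding disjoint_carriers_def cocycles_iff by blast
  ultimately show ?thesis by (auto simp: flat_class_def)
qed

lemma flat_class_eq_iff:
  assumes "x \<in> cocycles K n" "y \<in> cocycles K n"
  shows "flat_class K n x = flat_class K n y \<longleftrightarrow> cohom_class K n x = cohom_class K n y"
  using flat_class_overlap[OF assms] flat_class_nonempty assms
  by (metis flat_class_def inf.idem)

lemma Union_inj: "inj_on Union (carrier (cohom K n))"
proof (rule inj_onI)
  fix c c' assume "c \<in> carrier (cohom K n)" "c' \<in> carrier (cohom K n)" and eq: "\<Union> c = \<Union> c'"
  then obtain x y where x: "x \<in> cocycles K n" "c = cohom_class K n x"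
    and y: "y \<in> cocycles K n" "c' = cohom_class K n y" by (auto simp: cohom_carrier)
  from x(2) y(2) eq have "flat_class K n x = flat_class K n y" by (simp add: flat_class_def)
  with x y show "c = c'" by (simp add: flat_class_eq_iff)
qed

lemma Union_iso: "Union \<in> iso (cohom K n) (flat_cohom K n)"
  using Union_inj[of n]
  by (auto intro!: isoI homI simp: flat_cohom_def image_group_def bij_betw_def)

lemma flat_cohom_comm: "comm_group (flat_cohom K n)"
proof -
  have "comm_group (flat_cohom K n\<lparr>one := \<Union> \<one>\<^bsub>cohom K n\<^esub>\<rparr>)"
    by (rule comm_group.iso_imp_img_comm_group[OF cohom_comm Union_iso])
  then show ?thesis by (simp add: flat_cohom_def image_group_def)
qed

lemma flat_cohom_carrier: "carrier (flat_cohom K n) = flat_class K n ` cocycles K n"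
  by (auto simp: flat_cohom_def image_group_def cohom_carrier flat_class_def)

lemma flat_class_hom: "flat_class K n \<in> hom (cocycle_grp n) (flat_cohom K n)"
  using hom_compose[OF cohom_class_hom iso_imp_homomorphism[OF Union_iso]]
  by (simp add: flat_class_def[abs_def] comp_def)

lemma flat_class_mult:
  "\<lbrakk>x \<in> cocycles K n; y \<in> cocycles K n\<rbrakk> \<Longrightarrow>
    flat_class K n (x \<otimes>\<^bsub>grp K n\<^esub> y) = flat_class K n x \<otimes>\<^bsub>flat_cohom K n\<^esub> flat_class K n y"
  using hom_mult[OF flat_class_hom] by simp

lemma flat_one: "\<one>\<^bsub>flat_cohom K n\<^esub> = flat_class K n \<one>\<^bsub>grp K n\<^esub>"
  by (simp add: flat_cohom_def image_group_def flat_class_def cohom_one)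

lemma flat_class_eq_one_iff:
  assumes "x \<in> cocycles K n"
  shows "flat_class K n x = \<one>\<^bsub>flat_cohom K n\<^esub> \<longleftrightarrow>
    (\<exists>w\<in>carrier (grp K (n - 1)). x = diff K (n - 1) w)"
  using assms subgroup.one_closed[OF cocycles_subgroup]
  by (simp add: flat_one flat_class_eq_iff cohom_class_eq_one_iff flip: cohom_one)

end

locale flat_couple = exact_couple X for X :: "('d, 'e set) couple" +
  assumes disj_E: "disjoint_carriers (couple_complex X)"
begin

sublocale E: flat_cochain E
  by unfold_locales (rule disj_E)

abbreviation "X' \<equiv> derived_couple X"

lemma derived_Dgrp: "Dgrp X' n = (Dgrp X n)\<lparr>carrier := imap X n ` carrier (Dgrp X n)\<rparr>"
  and derived_Egrp: "Egrp X' n = flat_cohom E n"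
  and derived_imap: "imap X' = imap X"
  by (simp_all add: derived_couple_def)

text \<open>Two representatives differ by some jk f, and kj is trivial.\<close>

lemma derived_k:
  assumes e: "e \<in> cocycles E n"
  shows "kmap X' n (flat_class E n e) = kmap X n e"
proof -
  have "kmap X n e' = kmap X n e"
    if e': "e' \<in> cocycles E n" "flat_class E n e' = flat_class E n e" for e'
  proof -
    obtain f where f: "f \<in> carrier (Egrp X (n - 1))"
      and eq: "e' = jmap X n (kmap X (n - 1) f) \<otimes>\<^bsub>Egrp X n\<^esub> e"
      using e' e by (auto simp: E.flat_class_eq_iff E.cohom_class_eq_iff)
    interpret D: comm_group "Dgrp X (n + 1)" by (rule D_comm)
    show ?thesis
      using e f by (simp add: eq group_hom.hom_mult[OF k_group_hom] k_j E.cocycles_iff)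
  qed
  then have "{kmap X n e' | e'. e' \<in> cocycles E n \<and> flat_class E n e' = flat_class E n e} = {kmap X n e}"
    using e by blast
  then show ?thesis by (simp add: derived_couple_def)
qed

text \<open>Two preimages under i differ by an element of the kernel of i, that is by some k f;
  applying j changes the result by jk f, a coboundary.\<close>

lemma derived_j:
  assumes a: "a \<in> carrier (Dgrp X n)"
  shows "jmap X' n (imap X n a) = flat_class E n (jmap X n a)"
proof -
  interpret D: comm_group "Dgrp X n" by (rule D_comm)
  interpret En: comm_group "Egrp X n" by (rule E_comm)
  interpret i: group_hom "Dgrp X n" "Dgrp X n" "imap X n" by (rule i_group_hom)
  interpret j: group_hom "Dgrp X n" "Egrp X n" "jmap X n" by (rule j_group_hom)
  have "flat_class E n (jmap X n a') = flat_class E n (jmap X n a)"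
    if a': "a' \<in> carrier (Dgrp X n)" "imap X n a' = imap X n a" for a'
  proof -
    have "imap X n (a' \<otimes>\<^bsub>Dgrp X n\<^esub> inv\<^bsub>Dgrp X n\<^esub> a) = \<one>\<^bsub>Dgrp X n\<^esub>"
      using a a' by simp
    then have "a' \<otimes>\<^bsub>Dgrp X n\<^esub> inv\<^bsub>Dgrp X n\<^esub> a \<in> kmap X (n - 1) ` carrier (Egrp X (n - 1))"
      using a a' by (subst exact_ki'[symmetric]) simp_all
    then obtain f where f: "f \<in> carrier (Egrp X (n - 1))"
      and eq: "a' \<otimes>\<^bsub>Dgrp X n\<^esub> inv\<^bsub>Dgrp X n\<^esub> a = kmap X (n - 1) f" by blast
    have "a' = kmap X (n - 1) f \<otimes>\<^bsub>Dgrp X n\<^esub> a"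
      using a a' f by (simp add: eq[symmetric] D.m_assoc)
    then have "jmap X n a' = jmap X n (kmap X (n - 1) f) \<otimes>\<^bsub>Egrp X n\<^esub> jmap X n a"
      using a f by simp
    then have "cohom_class E n (jmap X n a') = cohom_class E n (jmap X n a)"
      unfolding E.cohom_class_eq_iff[OF j_cocycle[OF a'(1)] j_cocycle[OF a]] using f by auto
    then show ?thesis
      using a a' by (simp add: E.flat_class_eq_iff j_cocycle)
  qed
  then have "{flat_class E n (jmap X n a') | a'. a' \<in> carrier (Dgrp X n) \<and> imap X n a' = imap X n a}
      = {flat_class E n (jmap X n a)}"
    using a by blast
  then show ?thesis by (simp add: derived_couple_def)
qed

text \<open>The classical theorem that the derived couple is exact, by chasing representatives with
  \<open>derived_j\<close> and \<open>derived_k\<close>.\<close>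

lemma derived_exact: "exact_couple X'"
proof (rule exact_couple.intro)
  fix n
  interpret D: comm_group "Dgrp X n" by (rule D_comm)
  interpret En: comm_group "Egrp X n" by (rule E_comm)
  interpret i: group_hom "Dgrp X n" "Dgrp X n" "imap X n" by (rule i_group_hom)
  interpret j: group_hom "Dgrp X n" "Egrp X n" "jmap X n" by (rule j_group_hom)
  interpret k: group_hom "Egrp X n" "Dgrp X (n + 1)" "kmap X n" by (rule k_group_hom)
  have iD: "subgroup (imap X n ` carrier (Dgrp X n)) (Dgrp X n)"
    by (rule i.img_is_subgroup)
  show "comm_group (Dgrp X' n)"
    unfolding derived_Dgrp
    by (rule group.group_comm_groupI[OF D.subgroup_imp_group[OF iD]]) (auto simp: D.m_comm)
  show "comm_group (Egrp X' n)"
    unfolding derived_Egrp by (rule E.flat_cohom_comm)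
  show "imap X' n \<in> hom (Dgrp X' n) (Dgrp X' n)"
    by (rule homI) (auto simp: derived_Dgrp derived_imap)
  show "jmap X' n \<in> hom (Dgrp X' n) (Egrp X' n)"
  proof (rule homI)
    fix y y' assume "y \<in> carrier (Dgrp X' n)" "y' \<in> carrier (Dgrp X' n)"
    then obtain a a' where "a \<in> carrier (Dgrp X n)" "y = imap X n a" "a' \<in> carrier (Dgrp X n)" "y' = imap X n a'"
      by (auto simp: derived_Dgrp)
    then show "jmap X' n (y \<otimes>\<^bsub>Dgrp X' n\<^esub> y') = jmap X' n y \<otimes>\<^bsub>Egrp X' n\<^esub> jmap X' n y'"
      using derived_j[of "a \<otimes>\<^bsub>Dgrp X n\<^esub> a'" n] E.flat_class_mult[of "jmap X n a" n "jmap X n a'"]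
      by (simp add: derived_Dgrp derived_Egrp derived_j j_cocycle)
  next
    fix y assume "y \<in> carrier (Dgrp X' n)"
    then obtain a where a: "a \<in> carrier (Dgrp X n)" "y = imap X n a" by (auto simp: derived_Dgrp)
    show "jmap X' n y \<in> carrier (Egrp X' n)"
      unfolding a(2) derived_j[OF a(1)] derived_Egrp E.flat_cohom_carrier
      by (rule imageI) (rule j_cocycle[OF a(1)])
  qed
  show "kmap X' n \<in> hom (Egrp X' n) (Dgrp X' (n + 1))"
  proof (rule homI)
    fix c c' assume "c \<in> carrier (Egrp X' n)" "c' \<in> carrier (Egrp X' n)"
    then obtain e e' where e: "e \<in> cocycles E n" "c = flat_class E n e"
      "e' \<in> cocycles E n" "c' = flat_class E n e'"
      by (auto simp: derived_Egrp E.flat_cohom_carrier)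
    moreover have "e \<otimes>\<^bsub>Egrp X n\<^esub> e' \<in> cocycles E n"
      using e subgroup.m_closed[OF E.cocycles_subgroup] by fastforce
    ultimately show "kmap X' n (c \<otimes>\<^bsub>Egrp X' n\<^esub> c') = kmap X' n c \<otimes>\<^bsub>Dgrp X' (n + 1)\<^esub> kmap X' n c'"
      using E.flat_class_mult[of e n e'] derived_k[of "e \<otimes>\<^bsub>Egrp X n\<^esub> e'" n]
      by (simp add: derived_Egrp derived_Dgrp derived_k E.cocycles_iff)
  next
    fix c assume "c \<in> carrier (Egrp X' n)"
    then obtain e where e: "e \<in> cocycles E n" "c = flat_class E n e"
      by (auto simp: derived_Egrp E.flat_cohom_carrier)
    then show "kmap X' n c \<in> carrier (Dgrp X' (n + 1))"
      using e(1)[unfolded cocycle_iff_k] by (simp add: derived_k derived_Dgrp)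
  qed
  show "jmap X' n y = \<one>\<^bsub>Egrp X' n\<^esub> \<longleftrightarrow> y \<in> imap X' n ` carrier (Dgrp X' n)"
    if y: "y \<in> carrier (Dgrp X' n)" for y
  proof -
    obtain a where a: "a \<in> carrier (Dgrp X n)" "y = imap X n a" using y by (auto simp: derived_Dgrp)
    have "jmap X' n y = \<one>\<^bsub>Egrp X' n\<^esub> \<longleftrightarrow>
        (\<exists>f\<in>carrier (Egrp X (n - 1)). jmap X n a = jmap X n (kmap X (n - 1) f))"
      using a by (simp add: derived_j derived_Egrp E.flat_class_eq_one_iff j_cocycle)
    also have "\<dots> \<longleftrightarrow> y \<in> imap X n ` imap X n ` carrier (Dgrp X n)" (is "?l \<longleftrightarrow> ?r")
    proof
      assume ?l
      then obtain f where f: "f \<in> carrier (Egrp X (n - 1))" "jmap X n a = jmap X n (kmap X (n - 1) f)" ..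
      have fD: "kmap X (n - 1) f \<in> carrier (Dgrp X n)" using f by simp
      \<comment> \<open>Subtracting k f moves \<open>a\<close> into the kernel of j, hence into the
        image of i, and leaves i \<open>a\<close> unchanged because ik is trivial.\<close>
      have "jmap X n (a \<otimes>\<^bsub>Dgrp X n\<^esub> inv\<^bsub>Dgrp X n\<^esub> kmap X (n - 1) f) = \<one>\<^bsub>Egrp X n\<^esub>"
        using f fD a by simp
      then have "a \<otimes>\<^bsub>Dgrp X n\<^esub> inv\<^bsub>Dgrp X n\<^esub> kmap X (n - 1) f \<in> imap X n ` carrier (Dgrp X n)"
        using a fD by (subst exact_ij[symmetric]) simp_all
      then obtain b where b: "b \<in> carrier (Dgrp X n)"
        "a \<otimes>\<^bsub>Dgrp X n\<^esub> inv\<^bsub>Dgrp X n\<^esub> kmap X (n - 1) f = imap X n b" by blast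
      have "imap X n (kmap X (n - 1) f) = \<one>\<^bsub>Dgrp X n\<^esub>" using i_k[OF f(1)] by simp
      then have "imap X n (a \<otimes>\<^bsub>Dgrp X n\<^esub> inv\<^bsub>Dgrp X n\<^esub> kmap X (n - 1) f) = imap X n a"
        using a fD by simp
      with a b show ?r by (metis imageI)
    next
      assume ?r
      then obtain b where b: "b \<in> carrier (Dgrp X n)" "imap X n a = imap X n (imap X n b)"
        using a by auto
      \<comment> \<open>The derived j is evaluated at the other preimage, \<open>imap X n b\<close>,
        on which j is trivial.\<close>
      then have "jmap X' n (imap X n a) = \<one>\<^bsub>Egrp X' n\<^esub>"
        by (simp add: derived_j j_i derived_Egrp E.flat_one)
      then show ?l
        using a by (simp add: derived_j derived_Egrp E.flat_class_eq_one_iff j_cocycle)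
    qed
    finally show ?thesis by (simp add: derived_Dgrp derived_imap)
  qed
  show "kmap X' n c = \<one>\<^bsub>Dgrp X' (n + 1)\<^esub> \<longleftrightarrow> c \<in> jmap X' n ` carrier (Dgrp X' n)"
    if c: "c \<in> carrier (Egrp X' n)" for c
  proof -
    obtain e where e: "e \<in> cocycles E n" "c = flat_class E n e"
      using c by (auto simp: derived_Egrp E.flat_cohom_carrier)
    \<comment> \<open>D is only restricted to a smaller carrier, so its unit is unchanged and
      exactness at \<open>e\<close> in the original couple applies.\<close>
    have "kmap X' n c = \<one>\<^bsub>Dgrp X' (n + 1)\<^esub> \<longleftrightarrow> e \<in> jmap X n ` carrier (Dgrp X n)"
    proof -
      have "e \<in> carrier (Egrp X n)" using e(1) by (simp add: E.cocycles_iff)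
      then show ?thesis unfolding e(2) derived_k[OF e(1)] derived_Dgrp by (simp add: exact_jk)
    qed
    moreover have "c \<in> jmap X' n ` carrier (Dgrp X' n)" if "e \<in> jmap X n ` carrier (Dgrp X n)"
    proof -
      from that obtain a where a: "e = jmap X n a" "a \<in> carrier (Dgrp X n)" by (rule imageE)
      have "imap X n a \<in> carrier (Dgrp X' n)" using a(2) by (simp add: derived_Dgrp)
      moreover have "c = jmap X' n (imap X n a)" unfolding e(2) a(1) derived_j[OF a(2)] ..
      ultimately show ?thesis by blast
    qed
    moreover have "kmap X' n c = \<one>\<^bsub>Dgrp X' (n + 1)\<^esub>"
      if "c \<in> jmap X' n ` carrier (Dgrp X' n)"
    proof -
      from that obtain a where a: "a \<in> carrier (Dgrp X n)" "c = jmap X' n (imap X n a)"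
        by (auto simp: derived_Dgrp)
      show ?thesis
        unfolding a(2) derived_j[OF a(1)] derived_k[OF j_cocycle[OF a(1)]] k_j[OF a(1)]
        by (simp add: derived_Dgrp)
    qed
    ultimately show ?thesis by blast
  qed
  show "imap X' (n + 1) y = \<one>\<^bsub>Dgrp X' (n + 1)\<^esub> \<longleftrightarrow> y \<in> kmap X' n ` carrier (Egrp X' n)"
    if y: "y \<in> carrier (Dgrp X' (n + 1))" for y
  proof
    assume 1: "imap X' (n + 1) y = \<one>\<^bsub>Dgrp X' (n + 1)\<^esub>"
    have "y \<in> carrier (Dgrp X (n + 1))" using y by (auto simp: derived_Dgrp)
    then obtain e where e: "e \<in> carrier (Egrp X n)" "y = kmap X n e"
      using 1 by (auto simp: derived_Dgrp derived_imap exact_ki)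
    \<comment> \<open>Since \<open>y\<close> lies in the image of i, \<open>cocycle_iff_k\<close>
      makes \<open>e\<close> a cocycle, so that it has a class in the derived E.\<close>
    then have "e \<in> cocycles E n" using y by (simp add: cocycle_iff_k derived_Dgrp)
    then have "flat_class E n e \<in> carrier (Egrp X' n)" "y = kmap X' n (flat_class E n e)"
      using e by (simp_all add: derived_Egrp E.flat_cohom_carrier derived_k)
    then show "y \<in> kmap X' n ` carrier (Egrp X' n)" by blast
  next
    assume "y \<in> kmap X' n ` carrier (Egrp X' n)"
    then obtain e where e: "e \<in> cocycles E n" "y = kmap X n e"
      by (auto simp: derived_Egrp E.flat_cohom_carrier derived_k)
    have "e \<in> carrier (Egrp X n)" using e(1) by (simp add: E.cocycles_iff)
    then show "imap X' (n + 1) y = \<one>\<^bsub>Dgrp X' (n + 1)\<^esub>"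
      by (simp add: e(2) derived_imap derived_Dgrp i_k)
  qed
qed

lemma derived_flat: "flat_couple X'"
proof -
  interpret X': exact_couple X' by (rule derived_exact)
  show ?thesis
  proof
    show "disjoint_carriers (couple_complex X')"
      unfolding disjoint_carriers_def X'.grp_E derived_Egrp E.flat_cohom_carrier
    proof (intro allI ballI conjI impI; elim imageE; hypsubst)
      fix n x y assume x: "x \<in> cocycles E n" and y: "y \<in> cocycles E n"
        and "flat_class E n x \<inter> flat_class E n y \<noteq> {}"
      then show "flat_class E n x = flat_class E n y"
        by (simp add: E.flat_class_eq_iff E.flat_class_overlap)
    qed (rule E.flat_class_nonempty)
  qed
qed

end

section \<open>The Bockstein couple of a complex without \<open>p\<close>-torsion\<close>

locale torsion_free_cochain = cochain_mod C p for C :: "'a cochain" and p :: nat +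
  assumes torsion_free:
    "\<lbrakk>x \<in> carrier (grp C i); x [^]\<^bsub>grp C i\<^esub> p = \<one>\<^bsub>grp C i\<^esub>\<rbrakk> \<Longrightarrow> x = \<one>\<^bsub>grp C i\<^esub>"
begin

lemma pow_cancel:
  assumes x: "x \<in> carrier (grp C i)" and y: "y \<in> carrier (grp C i)"
    and eq: "x [^]\<^bsub>grp C i\<^esub> p = y [^]\<^bsub>grp C i\<^esub> p"
  shows "x = y"
proof -
  interpret G: comm_group "grp C i" by (rule grp_comm)
  have "(x \<otimes>\<^bsub>grp C i\<^esub> inv\<^bsub>grp C i\<^esub> y) [^]\<^bsub>grp C i\<^esub> p = \<one>\<^bsub>grp C i\<^esub>"
    using x y by (simp add: G.nat_pow_distrib eq) (simp flip: G.nat_pow_distrib)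
  then have "x \<otimes>\<^bsub>grp C i\<^esub> inv\<^bsub>grp C i\<^esub> y = \<one>\<^bsub>grp C i\<^esub>"
    by (rule torsion_free[rotated]) (use x y in simp)
  then have "inv\<^bsub>grp C i\<^esub> (inv\<^bsub>grp C i\<^esub> y) = x"
    using x y by (intro G.inv_equality) simp_all
  then show ?thesis using y by simp
qed

abbreviation "BC \<equiv> bockstein_couple p C"

lemma BC_simps [simp]:
  "Dgrp BC = cohom C" "Egrp BC = cohom Cp" "imap BC n c = c [^]\<^bsub>cohom C n\<^esub> p"
  by (simp_all add: bockstein_couple_def)

lemma BC_j:
  assumes "z \<in> cocycles C n"
  shows "jmap BC n (cohom_class C n z) = mclass n z"
  using cohom_map_class(2)[OF cochain_axioms mod_p_cochain assms reduce_hom diff_mod_p[symmetric]]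
  by (simp add: bockstein_couple_def)

text \<open>From p d\<open>\<eta>\<close> = dd\<open>\<omega>\<close> = 0 and the absence of
  torsion.\<close>

lemma division_cocycle:
  assumes w: "\<omega> \<in> carrier (grp C n)" and e: "\<eta> \<in> carrier (grp C (n + 1))"
    and eq: "diff C n \<omega> = \<eta> [^]\<^bsub>grp C (n + 1)\<^esub> p"
  shows "\<eta> \<in> cocycles C (n + 1)"
proof -
  interpret d: group_hom "grp C (n + 1)" "grp C (n + 1 + 1)" "diff C (n + 1)" by (rule diff_group_hom)
  have "diff C (n + 1) \<eta> [^]\<^bsub>grp C (n + 1 + 1)\<^esub> p = \<one>\<^bsub>grp C (n + 1 + 1)\<^esub>"
    using diff_diff[OF w] diff_pow[OF e, of p] by (simp add: eq)
  then show ?thesis using torsion_free[OF d.hom_closed[OF e]] e by (simp add: cocycles_iff)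
qed

text \<open>The set in the definition of \<open>kmap\<close> runs over all lifts of all
  representatives. Another lift is p\<open>\<alpha>\<close> + d\<open>\<beta>\<close> +
  \<open>\<omega>\<close>, so the quotient by p changes by d\<open>\<alpha>\<close> and its class
  does not change.\<close>

lemma BC_k:
  assumes w: "\<omega> \<in> carrier (grp C n)" and e: "\<eta> \<in> carrier (grp C (n + 1))"
    and eq: "diff C n \<omega> = \<eta> [^]\<^bsub>grp C (n + 1)\<^esub> p"
  shows "kmap BC n (mclass n \<omega>) = cohom_class C (n + 1) \<eta>"
proof -
  interpret G: comm_group "grp C n" by (rule grp_comm)
  interpret H: comm_group "grp C (n + 1)" by (rule grp_comm)
  interpret d: group_hom "grp C n" "grp C (n + 1)" "diff C n" by (rule diff_group_hom)
  interpret d': group_hom "grp C (n - 1)" "grp C n" "diff C (n - 1)" by (rule diff_pred_group_hom)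
  have lw: "lift_cocycle n \<omega>" using w e eq by (auto simp: lift_cocycle_def)
  have unique: "cohom_class C (n + 1) \<eta>' = cohom_class C (n + 1) \<eta>"
    if z: "z \<in> mclass n \<omega>" "\<omega>' \<in> z" and e': "\<eta>' \<in> carrier (grp C (n + 1))"
      and eq': "diff C n \<omega>' = \<eta>' [^]\<^bsub>grp C (n + 1)\<^esub> p" for \<eta>' \<omega>' z
  proof -
    have zc: "z \<in> cocycles Cp n" "cohom_class Cp n z = mclass n \<omega>"
      using z(1) Cp.mem_cohom_class[OF reduce_cocycle[OF lw]] by auto
    then obtain x where x: "x \<in> carrier (grp C n)" "z = red n x"
      by (auto simp: Cp.cocycles_iff mod_p_carrier)
    have w': "\<omega>' \<in> carrier (grp C n)" "red n \<omega>' = z" using z(2) x by (auto simp: mem_reduce)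
    have "lift_cocycle n \<omega>'" using w'(1) e' eq' by (auto simp: lift_cocycle_def)
    moreover have "mclass n \<omega>' = mclass n \<omega>" using zc w' by simp
    ultimately obtain \<alpha> \<beta> where a: "\<alpha> \<in> carrier (grp C n)" and b: "\<beta> \<in> carrier (grp C (n - 1))"
      and weq: "\<omega>' = \<alpha> [^]\<^bsub>grp C n\<^esub> p \<otimes>\<^bsub>grp C n\<^esub> (diff C (n - 1) \<beta> \<otimes>\<^bsub>grp C n\<^esub> \<omega>)"
      using mclass_eq_iff[OF _ lw] by blast
    have "\<eta>' [^]\<^bsub>grp C (n + 1)\<^esub> p = (diff C n \<alpha> \<otimes>\<^bsub>grp C (n + 1)\<^esub> \<eta>) [^]\<^bsub>grp C (n + 1)\<^esub> p"
      using a b w e by (simp add: eq'[symmetric] weq diff_pow diff_pred_diff eq H.nat_pow_distrib)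
    \<comment> \<open>Cancelling p is the use of torsion-freeness.\<close>
    then have "\<eta>' = diff C n \<alpha> \<otimes>\<^bsub>grp C (n + 1)\<^esub> \<eta>"
      using pow_cancel[OF e' H.m_closed[OF d.hom_closed[OF a] e]] by blast
    then show ?thesis
      using cohom_class_eq_iff[OF division_cocycle[OF w'(1) e' eq'] division_cocycle[OF w e eq]] a by auto
  qed
  have "red n \<omega> \<in> mclass n \<omega>" "\<omega> \<in> red n \<omega>"
    using w by (simp_all add: Cp.mem_cohom_class reduce_cocycle[OF lw] mem_reduce)
  then have "{cohom_class C (n + 1) \<eta>' | \<eta>' \<omega>' z. z \<in> mclass n \<omega> \<and> \<omega>' \<in> z \<and>
      \<eta>' \<in> carrier (grp C (n + 1)) \<and> diff C n \<omega>' = \<eta>' [^]\<^bsub>grp C (n + 1)\<^esub> p} = {cohom_class C (n + 1) \<eta>}"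
    using unique e eq by blast
  then show ?thesis by (simp add: bockstein_couple_def)
qed

lemma one_pow_p: "\<one>\<^bsub>grp C i\<^esub> [^]\<^bsub>grp C i\<^esub> p = \<one>\<^bsub>grp C i\<^esub>"
  using group.is_monoid[OF grp_group] by (rule monoid.nat_pow_one)

text \<open>The long exact cohomology sequence. Through \<open>mclass_eq_iff\<close> and
  \<open>BC_k\<close> the exactness claims become computations with integral cochains.\<close>

lemma BC_exact: "exact_couple BC"
proof (rule exact_couple.intro)
  fix n
  interpret G: comm_group "grp C n" by (rule grp_comm)
  interpret H: comm_group "grp C (n + 1)" by (rule grp_comm)
  interpret d: group_hom "grp C n" "grp C (n + 1)" "diff C n" by (rule diff_group_hom)
  interpret d': group_hom "grp C (n - 1)" "grp C n" "diff C (n - 1)" by (rule diff_pred_group_hom)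
  interpret HC: comm_group "cohom C n" by (rule cohom_comm)
  show "comm_group (Dgrp BC n)" by (simp add: cohom_comm)
  show "comm_group (Egrp BC n)" by (simp add: Cp.cohom_comm)
  show "imap BC n \<in> hom (Dgrp BC n) (Dgrp BC n)"
    by (rule homI) (simp_all add: HC.nat_pow_distrib)
  show "jmap BC n \<in> hom (Dgrp BC n) (Egrp BC n)"
  proof (rule homI)
    fix c assume "c \<in> carrier (Dgrp BC n)"
    then obtain x where x: "x \<in> cocycles C n" "c = cohom_class C n x" by (auto simp: cohom_carrier)
    show "jmap BC n c \<in> carrier (Egrp BC n)"
      using lift_cocycle_cocycle[OF x(1)] by (auto simp: x(2) BC_j[OF x(1)] mod_cohom_carrier)
    fix c' assume "c' \<in> carrier (Dgrp BC n)"
    then obtain y where y: "y \<in> cocycles C n" "c' = cohom_class C n y" by (auto simp: cohom_carrier)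
    have xy: "x \<otimes>\<^bsub>grp C n\<^esub> y \<in> cocycles C n"
      by (rule subgroup.m_closed[OF cocycles_subgroup x(1) y(1)])
    show "jmap BC n (c \<otimes>\<^bsub>Dgrp BC n\<^esub> c') = jmap BC n c \<otimes>\<^bsub>Egrp BC n\<^esub> jmap BC n c'"
      using lift_cocycle_mult(2)[OF lift_cocycle_cocycle[OF x(1)] lift_cocycle_cocycle[OF y(1)]]
      by (simp add: x(2) y(2) cohom_class_mult[OF x(1) y(1), symmetric] BC_j x(1) y(1) xy)
  qed
  show "kmap BC n \<in> hom (Egrp BC n) (Dgrp BC (n + 1))"
  proof (rule homI)
    fix c assume "c \<in> carrier (Egrp BC n)"
    then obtain x \<eta> where x: "lift_cocycle n x" "c = mclass n x" "x \<in> carrier (grp C n)"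
      and \<eta>: "\<eta> \<in> carrier (grp C (n + 1))" "diff C n x = \<eta> [^]\<^bsub>grp C (n + 1)\<^esub> p"
      by (auto simp: mod_cohom_carrier lift_cocycle_def)
    note k = BC_k[OF x(3) \<eta>] and cyc = division_cocycle[OF x(3) \<eta>]
    show "kmap BC n c \<in> carrier (Dgrp BC (n + 1))"
      using cyc by (simp add: x(2) k cohom_carrier)
    fix c' assume "c' \<in> carrier (Egrp BC n)"
    then obtain y \<theta> where y: "lift_cocycle n y" "c' = mclass n y" "y \<in> carrier (grp C n)"
      and \<theta>: "\<theta> \<in> carrier (grp C (n + 1))" "diff C n y = \<theta> [^]\<^bsub>grp C (n + 1)\<^esub> p"
      by (auto simp: mod_cohom_carrier lift_cocycle_def)
    have "kmap BC n (mclass n (x \<otimes>\<^bsub>grp C n\<^esub> y)) = cohom_class C (n + 1) (\<eta> \<otimes>\<^bsub>grp C (n + 1)\<^esub> \<theta>)"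
      using x(3) y(3) \<eta> \<theta> by (intro BC_k) (simp_all add: H.nat_pow_distrib)
    then show "kmap BC n (c \<otimes>\<^bsub>Egrp BC n\<^esub> c') = kmap BC n c \<otimes>\<^bsub>Dgrp BC (n + 1)\<^esub> kmap BC n c'"
      using lift_cocycle_mult(2)[OF x(1) y(1)] cohom_class_mult[OF cyc division_cocycle[OF y(3) \<theta>]]
      by (simp add: x(2) y(2) k BC_k[OF y(3) \<theta>])
  qed
  show "jmap BC n a = \<one>\<^bsub>Egrp BC n\<^esub> \<longleftrightarrow> a \<in> imap BC n ` carrier (Dgrp BC n)"
    if "a \<in> carrier (Dgrp BC n)" for a
  proof -
    from that obtain z where z: "z \<in> cocycles C n" "a = cohom_class C n z" by (auto simp: cohom_carrier)
    show ?thesis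
    proof
      assume "jmap BC n a = \<one>\<^bsub>Egrp BC n\<^esub>"
      then have "mclass n z = mclass n \<one>\<^bsub>grp C n\<^esub>"
        by (simp add: z(2) BC_j[OF z(1)] Cp.cohom_one reduce_one)
      then obtain \<alpha> \<beta> where a: "\<alpha> \<in> carrier (grp C n)" and b: "\<beta> \<in> carrier (grp C (n - 1))"
        and zeq: "z = \<alpha> [^]\<^bsub>grp C n\<^esub> p \<otimes>\<^bsub>grp C n\<^esub> diff C (n - 1) \<beta>"
        using lift_cocycle_cocycle[OF z(1)]
          lift_cocycle_cocycle[OF subgroup.one_closed[OF cocycles_subgroup], of n]
        by (auto simp: mclass_eq_iff)
      \<comment> \<open>Both \<open>z\<close> and d\<open>\<beta>\<close> are cocycles, so p
        d\<open>\<alpha>\<close> = 0; without torsion \<open>\<alpha>\<close> is a cocycle, and the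
        class of \<open>z\<close> is p times its class.\<close>
      have "diff C n \<alpha> [^]\<^bsub>grp C (n + 1)\<^esub> p = \<one>\<^bsub>grp C (n + 1)\<^esub>"
        using z(1) a b by (simp add: zeq cocycles_iff diff_pow diff_pred_diff)
      then have ac: "\<alpha> \<in> cocycles C n"
        using a torsion_free[OF d.hom_closed[OF a]] by (simp add: cocycles_iff)
      have ap: "\<alpha> [^]\<^bsub>grp C n\<^esub> p \<in> cocycles C n"
        using ac by (simp add: cocycles_iff diff_pow one_pow_p)
      have "cohom_class C n z = cohom_class C n (\<alpha> [^]\<^bsub>grp C n\<^esub> p)"
        unfolding cohom_class_eq_iff[OF z(1) ap] using a b zeq
        by (intro bexI[of _ \<beta>]) (simp_all add: G.m_comm)
      then have "a = imap BC n (cohom_class C n \<alpha>)"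
        by (simp add: z(2) cohom_class_pow[OF ac])
      then show "a \<in> imap BC n ` carrier (Dgrp BC n)"
        using ac by (auto simp: cohom_carrier)
    next
      assume "a \<in> imap BC n ` carrier (Dgrp BC n)"
      then obtain y where y: "y \<in> cocycles C n" "a = cohom_class C n (y [^]\<^bsub>grp C n\<^esub> p)"
        by (auto simp: cohom_carrier cohom_class_pow)
      have yc: "y \<in> carrier (grp C n)" using y by (simp add: cocycles_iff)
      have yp: "y [^]\<^bsub>grp C n\<^esub> p \<in> cocycles C n"
        using y(1) by (simp add: cocycles_iff diff_pow one_pow_p)
      have "red n (y [^]\<^bsub>grp C n\<^esub> p) = \<one>\<^bsub>grp Cp n\<^esub>"
        using yc by (auto simp: reduce_eq_one_iff)
      then show "jmap BC n a = \<one>\<^bsub>Egrp BC n\<^esub>"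
        by (simp add: y(2) BC_j[OF yp] Cp.cohom_one)
    qed
  qed
  show "kmap BC n e = \<one>\<^bsub>Dgrp BC (n + 1)\<^esub> \<longleftrightarrow> e \<in> jmap BC n ` carrier (Dgrp BC n)"
    if "e \<in> carrier (Egrp BC n)" for e
  proof -
    from that obtain x \<eta> where x: "lift_cocycle n x" "e = mclass n x" "x \<in> carrier (grp C n)"
      and \<eta>: "\<eta> \<in> carrier (grp C (n + 1))" "diff C n x = \<eta> [^]\<^bsub>grp C (n + 1)\<^esub> p"
      by (auto simp: mod_cohom_carrier lift_cocycle_def)
    note k = BC_k[OF x(3) \<eta>] and cyc = division_cocycle[OF x(3) \<eta>]
    show ?thesis
    proof
      assume "kmap BC n e = \<one>\<^bsub>Dgrp BC (n + 1)\<^esub>"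
      then have "\<exists>w\<in>carrier (grp C n). \<eta> = diff C n w"
        using cohom_class_eq_one_iff[OF cyc] by (simp add: x(2) k)
      then obtain w where w: "w \<in> carrier (grp C n)" "\<eta> = diff C n w" by blast
      \<comment> \<open>Here d\<open>x\<close> = p\<open>\<eta>\<close> = p d\<open>w\<close>, so
        \<open>x\<close> - p\<open>w\<close> is an integral cocycle with the same reduction as
        \<open>x\<close>.\<close>
      define y where "y = inv\<^bsub>grp C n\<^esub> (w [^]\<^bsub>grp C n\<^esub> p) \<otimes>\<^bsub>grp C n\<^esub> x"
      have y: "y \<in> cocycles C n"
        using w x(3) \<eta> by (simp add: y_def cocycles_iff diff_pow H.l_inv)
      have "x = w [^]\<^bsub>grp C n\<^esub> p \<otimes>\<^bsub>grp C n\<^esub> y"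
        using w x(3) by (simp add: y_def G.m_assoc[symmetric])
      then have "red n x = red n y"
        using w x(3) y by (auto simp: reduce_eq_iff cocycles_iff)
      then have "e = jmap BC n (cohom_class C n y)" by (simp add: x(2) BC_j[OF y])
      then show "e \<in> jmap BC n ` carrier (Dgrp BC n)" using y by (auto simp: cohom_carrier)
    next
      assume "e \<in> jmap BC n ` carrier (Dgrp BC n)"
      then obtain y where y: "y \<in> cocycles C n" "e = mclass n y" by (auto simp: cohom_carrier BC_j)
      then have "kmap BC n e = cohom_class C (n + 1) \<one>\<^bsub>grp C (n + 1)\<^esub>"
        using BC_k[of y n "\<one>\<^bsub>grp C (n + 1)\<^esub>"] by (simp add: cocycles_iff one_pow_p)
      then show "kmap BC n e = \<one>\<^bsub>Dgrp BC (n + 1)\<^esub>" by (simp add: cohom_one)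
    qed
  qed
  show "imap BC (n + 1) b = \<one>\<^bsub>Dgrp BC (n + 1)\<^esub> \<longleftrightarrow> b \<in> kmap BC n ` carrier (Egrp BC n)"
    if "b \<in> carrier (Dgrp BC (n + 1))" for b
  proof -
    from that obtain z where z: "z \<in> cocycles C (n + 1)" "b = cohom_class C (n + 1) z"
      by (auto simp: cohom_carrier)
    have zc: "z \<in> carrier (grp C (n + 1))" using z by (simp add: cocycles_iff)
    have zp: "z [^]\<^bsub>grp C (n + 1)\<^esub> p \<in> cocycles C (n + 1)"
      using z(1) by (simp add: cocycles_iff diff_pow one_pow_p)
    have "imap BC (n + 1) b = cohom_class C (n + 1) (z [^]\<^bsub>grp C (n + 1)\<^esub> p)"
      by (simp add: z(2) cohom_class_pow[OF z(1)])
    then have iff: "imap BC (n + 1) b = \<one>\<^bsub>Dgrp BC (n + 1)\<^esub> \<longleftrightarrow>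
        (\<exists>w\<in>carrier (grp C n). z [^]\<^bsub>grp C (n + 1)\<^esub> p = diff C n w)"
      using cohom_class_eq_one_iff[OF zp] by simp
    show ?thesis
    proof
      assume "imap BC (n + 1) b = \<one>\<^bsub>Dgrp BC (n + 1)\<^esub>"
      with iff obtain w where w: "w \<in> carrier (grp C n)" "diff C n w = z [^]\<^bsub>grp C (n + 1)\<^esub> p"
        by metis
      then have "b = kmap BC n (mclass n w)" using BC_k[OF w(1) zc w(2)] by (simp add: z(2))
      moreover have "lift_cocycle n w" using w zc by (auto simp: lift_cocycle_def)
      ultimately show "b \<in> kmap BC n ` carrier (Egrp BC n)" by (auto simp: mod_cohom_carrier)
    next
      assume "b \<in> kmap BC n ` carrier (Egrp BC n)"
      then obtain x \<eta> where x: "x \<in> carrier (grp C n)" "b = kmap BC n (mclass n x)"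
        and \<eta>: "\<eta> \<in> carrier (grp C (n + 1))" "diff C n x = \<eta> [^]\<^bsub>grp C (n + 1)\<^esub> p"
        by (auto simp: mod_cohom_carrier lift_cocycle_def)
      have cyc: "\<eta> \<in> cocycles C (n + 1)" by (rule division_cocycle[OF x(1) \<eta>])
      have cyc': "diff C n x \<in> cocycles C (n + 1)" using diff_in_cocycles[of x "n + 1"] x(1) by simp
      have "imap BC (n + 1) b = cohom_class C (n + 1) (diff C n x)"
        by (simp add: x(2) BC_k[OF x(1) \<eta>] cohom_class_pow[OF cyc] \<eta>(2))
      also have "\<dots> = \<one>\<^bsub>cohom C (n + 1)\<^esub>"
        using cohom_class_eq_one_iff[OF cyc'] x(1) by auto
      finally show "imap BC (n + 1) b = \<one>\<^bsub>Dgrp BC (n + 1)\<^esub>" by simp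
    qed
  qed
qed

text \<open>Base case of the representation by unions: elements of E_1 are nonempty classes, and two
  classes with a common element agree.\<close>

lemma BC_flat: "flat_couple BC"
proof -
  interpret X: exact_couple BC by (rule BC_exact)
  have "c = c'" if "x \<in> cocycles Cp n" "c = cohom_class Cp n x" "y \<in> cocycles Cp n"
      "c' = cohom_class Cp n y" "c \<inter> c' \<noteq> {}" for n x y c c'
  proof -
    from that(5) obtain s where "s \<in> c" "s \<in> c'" by blast
    with that(1-4) show ?thesis by (metis Cp.mem_cohom_class)
  qed
  moreover have "cohom_class Cp n x \<noteq> {}" if "x \<in> cocycles Cp n" for n x
    using Cp.mem_cohom_class[OF that, of x] that by blast
  ultimately have "disjoint_carriers (couple_complex BC)"
    unfolding disjoint_carriers_def X.grp_E BC_simps(2) Cp.cohom_carrier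
    by (intro allI ballI conjI impI; elim imageE; hypsubst) blast+
  then show ?thesis by unfold_locales
qed

abbreviation "BCs s \<equiv> (derived_couple ^^ s) BC"

lemma BCs_flat: "flat_couple (BCs s)"
  by (induction s) (simp_all add: BC_flat flat_couple.derived_flat)

text \<open>Deriving replaces the carrier of D but keeps i, so on every page i is multiplication by
  p computed in the cohomology of \<open>C\<close>.\<close>

lemma BCs_imap: "imap (BCs s) n c = c [^]\<^bsub>cohom C n\<^esub> p"
  by (induction s) (simp_all add: derived_couple_def)

end

section \<open>Stationarity of the Bockstein spectral sequence\<close>

text \<open>The last two assumptions say that \<open>F\<close> induces an isomorphism from \<open>C/p\<close> to \<open>H(C/p)\<close>.\<close>

locale frobenius_cochain = torsion_free_cochain C p for C :: "'a cochain" and p :: nat +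
  fixes F :: "int \<Rightarrow> 'a \<Rightarrow> 'a"
  assumes F_hom: "F i \<in> hom (grp C i) (grp C i)"
    and diff_F: "x \<in> carrier (grp C i) \<Longrightarrow>
      diff C i (F i x) = F (i + 1) (diff C i x) [^]\<^bsub>grp C (i + 1)\<^esub> p"
    and cartier_inj: "\<lbrakk>x \<in> carrier (grp C i); \<alpha> \<in> carrier (grp C i); \<beta> \<in> carrier (grp C (i - 1));
      F i x = \<alpha> [^]\<^bsub>grp C i\<^esub> p \<otimes>\<^bsub>grp C i\<^esub> diff C (i - 1) \<beta>\<rbrakk> \<Longrightarrow>
      \<exists>y\<in>carrier (grp C i). x = y [^]\<^bsub>grp C i\<^esub> p"
    and cartier_surj: "\<lbrakk>\<omega> \<in> carrier (grp C i); \<eta> \<in> carrier (grp C (i + 1));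
      diff C i \<omega> = \<eta> [^]\<^bsub>grp C (i + 1)\<^esub> p\<rbrakk> \<Longrightarrow>
      \<exists>x\<in>carrier (grp C i). \<exists>\<alpha>\<in>carrier (grp C i). \<exists>\<beta>\<in>carrier (grp C (i - 1)).
        \<omega> = \<alpha> [^]\<^bsub>grp C i\<^esub> p \<otimes>\<^bsub>grp C i\<^esub> (diff C (i - 1) \<beta> \<otimes>\<^bsub>grp C i\<^esub> F i x)"
begin

lemma F_group_hom: "group_hom (grp C i) (grp C i) (F i)"
  using F_hom grp_group by (simp add: group_hom_def group_hom_axioms_def)

lemmas F_closed [simp] = group_hom.hom_closed[OF F_group_hom]

lemma diff_closed [simp]: "x \<in> carrier (grp C i) \<Longrightarrow> diff C i x \<in> carrier (grp C (i + 1))"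
  by (rule group_hom.hom_closed[OF diff_group_hom])

text \<open>By dF = pFd every cochain, closed or not, is sent to a cocycle modulo p.\<close>

lemma lift_cocycle_F:
  assumes "x \<in> carrier (grp C i)"
  shows "lift_cocycle i (F i x)"
  using assms diff_F[OF assms] by (auto simp: lift_cocycle_def)

lemma cocycle_F:
  assumes "z \<in> cocycles C i"
  shows "F i z \<in> cocycles C i"
  using assms diff_F[of z i] group_hom.hom_one[OF F_group_hom] by (simp add: cocycles_iff one_pow_p)

text \<open>The inverse Cartier map for an abstract \<open>F\<close>; for the de Rham complex it
  becomes \<open>cartier_inv\<close>.\<close>

definition cart :: "int \<Rightarrow> 'a set \<Rightarrow> 'a set set" where
  "cart i X = the_elem ((\<lambda>\<omega>. mclass i (F i \<omega>)) ` X)"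

lemma cart_red:
  assumes x: "x \<in> carrier (grp C i)"
  shows "cart i (red i x) = mclass i (F i x)"
proof -
  interpret G: comm_group "grp C i" by (rule grp_comm)
  interpret f: group_hom "grp C i" "grp C i" "F i" by (rule F_group_hom)
  have "mclass i (F i y) = mclass i (F i x)" if y: "y \<in> red i x" for y
  proof -
    obtain a where a: "a \<in> carrier (grp C i)" "y = a [^]\<^bsub>grp C i\<^esub> p \<otimes>\<^bsub>grp C i\<^esub> x"
      using y x by (auto simp: mem_reduce reduce_eq_iff)
    have "F i y = F i a [^]\<^bsub>grp C i\<^esub> p \<otimes>\<^bsub>grp C i\<^esub> F i x"
      using x a(1) by (simp add: a(2) f.hom_nat_pow)
    then have "red i (F i y) = red i (F i x)"
      using x a by (subst reduce_eq_iff) auto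
    then show ?thesis by simp
  qed
  moreover have "x \<in> red i x" using x by (simp add: mem_reduce)
  ultimately show ?thesis unfolding cart_def by (intro the_elem_image_unique) blast+
qed

lemma cart_iso: "cart i \<in> iso (grp Cp i) (cohom Cp i)"
proof -
  interpret G: comm_group "grp C i" by (rule grp_comm)
  interpret f: group_hom "grp C i" "grp C i" "F i" by (rule F_group_hom)
  have hom: "cart i \<in> hom (grp Cp i) (cohom Cp i)"
  proof (rule homI)
    fix X assume "X \<in> carrier (grp Cp i)"
    then obtain x where x: "x \<in> carrier (grp C i)" "X = red i x" by (auto simp: mod_p_carrier)
    show "cart i X \<in> carrier (cohom Cp i)"
      using lift_cocycle_F[OF x(1)] by (auto simp: x(2) cart_red[OF x(1)] mod_cohom_carrier)
    fix Y assume "Y \<in> carrier (grp Cp i)"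
    then obtain y where y: "y \<in> carrier (grp C i)" "Y = red i y" by (auto simp: mod_p_carrier)
    show "cart i (X \<otimes>\<^bsub>grp Cp i\<^esub> Y) = cart i X \<otimes>\<^bsub>cohom Cp i\<^esub> cart i Y"
      using lift_cocycle_mult(2)[OF lift_cocycle_F[OF x(1)] lift_cocycle_F[OF y(1)]] x(1) y(1)
      by (simp add: x(2) y(2) reduce_mult[symmetric] cart_red)
  qed
  interpret h: group_hom "grp Cp i" "cohom Cp i" "cart i"
    using hom mod_p_comm Cp.cohom_comm
    by (simp add: group_hom_def group_hom_axioms_def comm_group.axioms(2))
  have inj: "X = \<one>\<^bsub>grp Cp i\<^esub>" if "X \<in> carrier (grp Cp i)" "cart i X = \<one>\<^bsub>cohom Cp i\<^esub>" for X
  proof -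
    from that(1) obtain x where x: "x \<in> carrier (grp C i)" "X = red i x" by (auto simp: mod_p_carrier)
    have "mclass i (F i x) = mclass i \<one>\<^bsub>grp C i\<^esub>"
      using that(2) by (simp add: x(2) cart_red[OF x(1)] Cp.cohom_one reduce_one)
    then obtain \<alpha> \<beta> where "\<alpha> \<in> carrier (grp C i)" and b: "\<beta> \<in> carrier (grp C (i - 1))"
      and "F i x = \<alpha> [^]\<^bsub>grp C i\<^esub> p \<otimes>\<^bsub>grp C i\<^esub> (diff C (i - 1) \<beta> \<otimes>\<^bsub>grp C i\<^esub> \<one>\<^bsub>grp C i\<^esub>)"
      using mclass_eq_iff[OF lift_cocycle_F[OF x(1)]
          lift_cocycle_cocycle[OF subgroup.one_closed[OF cocycles_subgroup]]] by blast
    moreover have "diff C (i - 1) \<beta> \<in> carrier (grp C i)" using diff_closed[OF b] by simp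
    ultimately have "\<exists>y\<in>carrier (grp C i). x = y [^]\<^bsub>grp C i\<^esub> p"
      using cartier_inj[OF x(1)] b by simp
    then show ?thesis using x by (simp add: reduce_eq_one_iff)
  qed
  have surj: "c \<in> cart i ` carrier (grp Cp i)" if "c \<in> carrier (cohom Cp i)" for c
  proof -
    from that obtain \<omega> where w: "lift_cocycle i \<omega>" "c = mclass i \<omega>" by (auto simp: mod_cohom_carrier)
    then obtain x \<alpha> \<beta> where x: "x \<in> carrier (grp C i)"
      and "\<alpha> \<in> carrier (grp C i)" "\<beta> \<in> carrier (grp C (i - 1))"
      and "\<omega> = \<alpha> [^]\<^bsub>grp C i\<^esub> p \<otimes>\<^bsub>grp C i\<^esub> (diff C (i - 1) \<beta> \<otimes>\<^bsub>grp C i\<^esub> F i x)"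
      using cartier_surj unfolding lift_cocycle_def by metis
    then have "mclass i \<omega> = mclass i (F i x)"
      unfolding mclass_eq_iff[OF w(1) lift_cocycle_F[OF x]] by blast
    then have "c = cart i (red i x)" using w(2) by (simp add: cart_red[OF x])
    then show ?thesis using x by (simp add: mod_p_carrier)
  qed
  show ?thesis
    using hom surj h.hom_closed inj by (auto intro!: isoI simp: bij_betw_def h.inj_on_one_iff)
qed

lemma F_iter_closed: "x \<in> carrier (grp C i) \<Longrightarrow> (F i ^^ s) x \<in> carrier (grp C i)"
  by (induction s) simp_all

lemma F_iter_cocycle: "z \<in> cocycles C i \<Longrightarrow> (F i ^^ s) z \<in> cocycles C i"
  by (induction s) (simp_all add: cocycle_F)

lemma F_iter_pow:
  "x \<in> carrier (grp C i) \<Longrightarrow>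
    (F i ^^ s) (x [^]\<^bsub>grp C i\<^esub> (n::nat)) = (F i ^^ s) x [^]\<^bsub>grp C i\<^esub> n"
  by (induction s) (simp_all add: F_iter_closed group_hom.hom_nat_pow[OF F_group_hom])

text \<open>The statement is proved together with the two identities
  \<open>j\<^sub>r(p\<^sup>r\<^sup>-\<^sup>1[F\<^sup>r\<eta>]) = \<phi>\<^sub>r(\<eta>)\<close> for cocycles \<open>\<eta>\<close> and \<open>k\<^sub>r(\<phi>\<^sub>r(\<omega>)) = p\<^sup>r\<^sup>-\<^sup>1[F\<^sup>rd\<omega>]\<close>;
  here \<open>r = s + 1\<close>, and integer multiples are powers.\<close>

lemma stationary_aux:
  fixes \<Phi> :: "nat \<Rightarrow> int \<Rightarrow> 'a set \<Rightarrow> 'a set set"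
  assumes \<Phi>_1: "\<Phi> 0 = cart"
    and \<Phi>_Suc: "\<And>s i X. \<Phi> (Suc s) i X = \<Union> (cohom_map (couple_complex (BCs s)) (\<Phi> s) i (cart i X))"
  shows "cochain_iso Cp (couple_complex (BCs s)) (\<Phi> s) \<and>
    (\<forall>n. \<forall>\<eta>\<in>cocycles C n.
      cohom_class C n ((F n ^^ Suc s) \<eta>) [^]\<^bsub>cohom C n\<^esub> (p ^ s) \<in> carrier (Dgrp (BCs s) n) \<and>
      jmap (BCs s) n (cohom_class C n ((F n ^^ Suc s) \<eta>) [^]\<^bsub>cohom C n\<^esub> (p ^ s)) = \<Phi> s n (red n \<eta>)) \<and>
    (\<forall>n. \<forall>\<omega>\<in>carrier (grp C n).
      kmap (BCs s) n (\<Phi> s n (red n \<omega>)) =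
        cohom_class C (n + 1) ((F (n + 1) ^^ Suc s) (diff C n \<omega>)) [^]\<^bsub>cohom C (n + 1)\<^esub> (p ^ s))"
    (is "?iso s \<and> ?j s \<and> ?k s")
proof (induction s)
  \<comment> \<open>Compatibility with the differentials is a consequence of the two identities: d_r
    is jk, the second identity evaluates k at \<open>\<omega>\<close>, and the first, applied to the
    cocycle d\<open>\<omega>\<close>, evaluates j on the result.\<close>
  have iso: "?iso s" if iso: "\<And>n. \<Phi> s n \<in> iso (grp Cp n) (Egrp (BCs s) n)" and j: "?j s" and k: "?k s" for s
  proof -
    interpret X: flat_couple "BCs s" by (rule BCs_flat)
    have "\<Phi> s (n + 1) (diff Cp n Y) = diff X.E n (\<Phi> s n Y)" if "Y \<in> carrier (grp Cp n)" for n Y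
    proof -
      from that obtain \<omega> where w: "\<omega> \<in> carrier (grp C n)" "Y = red n \<omega>" by (auto simp: mod_p_carrier)
      have "diff C n \<omega> \<in> cocycles C (n + 1)" using diff_in_cocycles[of \<omega> "n + 1"] w(1) by simp
      then show ?thesis using w j k by (simp add: diff_mod_p)
    qed
    then show ?thesis
      using iso Cp.complex X.E.complex by (simp add: cochain_iso_def)
  qed
  {
    case 0
    have j: "?j 0"
    proof (intro allI ballI)
      fix n \<eta> assume e: "\<eta> \<in> cocycles C n"
      interpret HC: comm_group "cohom C n" by (rule cohom_comm)
      have ec: "\<eta> \<in> carrier (grp C n)" using e by (simp add: cocycles_iff)
      have cl: "cohom_class C n (F n \<eta>) \<in> carrier (cohom C n)"
        using cocycle_F[OF e] by (simp add: cohom_carrier)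
      then show "cohom_class C n ((F n ^^ Suc 0) \<eta>) [^]\<^bsub>cohom C n\<^esub> (p ^ 0) \<in> carrier (Dgrp (BCs 0) n) \<and>
          jmap (BCs 0) n (cohom_class C n ((F n ^^ Suc 0) \<eta>) [^]\<^bsub>cohom C n\<^esub> (p ^ 0)) = \<Phi> 0 n (red n \<eta>)"
        by (simp add: BC_j[OF cocycle_F[OF e]] \<Phi>_1 cart_red[OF ec])
    qed
    have k: "?k 0"
    proof (intro allI ballI)
      fix n \<omega> assume w: "\<omega> \<in> carrier (grp C n)"
      interpret HC: comm_group "cohom C (n + 1)" by (rule cohom_comm)
      have "diff C n \<omega> \<in> cocycles C (n + 1)" using diff_in_cocycles[of \<omega> "n + 1"] w by simp
      then have "cohom_class C (n + 1) (F (n + 1) (diff C n \<omega>)) \<in> carrier (cohom C (n + 1))"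
        by (simp add: cohom_carrier cocycle_F)
      then show "kmap (BCs 0) n (\<Phi> 0 n (red n \<omega>)) =
          cohom_class C (n + 1) ((F (n + 1) ^^ Suc 0) (diff C n \<omega>)) [^]\<^bsub>cohom C (n + 1)\<^esub> (p ^ 0)"
        using BC_k[OF F_closed[OF w] F_closed[OF diff_closed[OF w]] diff_F[OF w]]
        by (simp add: \<Phi>_1 cart_red[OF w])
    qed
    show ?case using iso[OF _ j k] j k by (simp add: \<Phi>_1 cart_iso)
  next
    case (Suc s)
    then have IH: "?iso s" "?j s" "?k s" by auto
    interpret X: flat_couple "BCs s" by (rule BCs_flat)
    have \<Phi>_iso: "\<Phi> s n \<in> iso (grp Cp n) (grp X.E n)" for n using IH(1) by (simp add: cochain_iso_def)
    \<comment> \<open>The inverse Cartier map sends the reduction of \<open>\<omega>\<close> to the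
      class of the reduction of F\<open>\<omega>\<close>. Applying the map induced by
      \<open>\<Phi> s\<close> gives a representative on which the derived j and k can be
      computed.\<close>
    have val: "\<Phi> s n (red n (F n \<omega>)) \<in> cocycles X.E n"
      "\<Phi> (Suc s) n (red n \<omega>) = flat_class X.E n (\<Phi> s n (red n (F n \<omega>)))"
      if w: "\<omega> \<in> carrier (grp C n)" for n \<omega>
    proof -
      have "\<And>i x. x \<in> carrier (grp Cp i) \<Longrightarrow> \<Phi> s (i + 1) (diff Cp i x) = diff X.E i (\<Phi> s i x)"
        using IH(1) by (simp add: cochain_iso_def)
      note m = cohom_map_class[OF mod_p_cochain X.E.cochain_axioms
          reduce_cocycle[OF lift_cocycle_F[OF w]] iso_imp_homomorphism[OF \<Phi>_iso] this]
      show "\<Phi> s n (red n (F n \<omega>)) \<in> cocycles X.E n" by (rule m(1))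
      show "\<Phi> (Suc s) n (red n \<omega>) = flat_class X.E n (\<Phi> s n (red n (F n \<omega>)))"
        by (simp add: \<Phi>_Suc cart_red[OF w] m(2) flat_class_def)
    qed
    have s': "BCs (Suc s) = derived_couple (BCs s)" by simp
    have j: "?j (Suc s)"
    proof (intro allI ballI)
      fix n \<eta> assume e: "\<eta> \<in> cocycles C n"
      interpret HC: comm_group "cohom C n" by (rule cohom_comm)
      have ec: "\<eta> \<in> carrier (grp C n)" using e by (simp add: cocycles_iff)
      define c where "c = cohom_class C n ((F n ^^ Suc s) (F n \<eta>))"
      have cc: "c \<in> carrier (cohom C n)"
        unfolding c_def cohom_carrier using F_iter_cocycle[OF cocycle_F[OF e]] by blast
      have y: "c [^]\<^bsub>cohom C n\<^esub> (p ^ s) \<in> carrier (Dgrp (BCs s) n)"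
        "jmap (BCs s) n (c [^]\<^bsub>cohom C n\<^esub> (p ^ s)) = \<Phi> s n (red n (F n \<eta>))"
        using IH(2) cocycle_F[OF e] unfolding c_def by blast+
      have c_eq: "cohom_class C n ((F n ^^ Suc (Suc s)) \<eta>) = c"
        by (simp add: c_def funpow_swap1)
      \<comment> \<open>The multiple by p^(s+1) is i of the multiple by p^s, and this preimage is
        the one fed to \<open>derived_j\<close>; the induction hypothesis is used at the cocycle
        F\<open>\<eta>\<close>.\<close>
      have pow: "c [^]\<^bsub>cohom C n\<^esub> (p ^ Suc s) = imap (BCs s) n (c [^]\<^bsub>cohom C n\<^esub> (p ^ s))"
        using cc by (simp add: BCs_imap HC.nat_pow_pow mult.commute)
      show "cohom_class C n ((F n ^^ Suc (Suc s)) \<eta>) [^]\<^bsub>cohom C n\<^esub> (p ^ Suc s) \<in> carrier (Dgrp (BCs (Suc s)) n) \<and>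
          jmap (BCs (Suc s)) n (cohom_class C n ((F n ^^ Suc (Suc s)) \<eta>) [^]\<^bsub>cohom C n\<^esub> (p ^ Suc s)) =
          \<Phi> (Suc s) n (red n \<eta>)"
        unfolding c_eq pow s' X.derived_j[OF y(1)] y(2) val(2)[OF ec] X.derived_Dgrp
        using y(1) by simp
    qed
    have k: "?k (Suc s)"
    proof (intro allI ballI)
      fix n \<omega> assume w: "\<omega> \<in> carrier (grp C n)"
      interpret HC: comm_group "cohom C (n + 1)" by (rule cohom_comm)
      let ?z = "F (n + 1) (diff C n \<omega>)"
      have "diff C n \<omega> \<in> cocycles C (n + 1)" using diff_in_cocycles[of \<omega> "n + 1"] w by simp
      then have z: "(F (n + 1) ^^ Suc s) ?z \<in> cocycles C (n + 1)" by (intro F_iter_cocycle cocycle_F)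
      have zc: "?z \<in> carrier (grp C (n + 1))" using w by simp
      have cc: "cohom_class C (n + 1) ((F (n + 1) ^^ Suc s) ?z) \<in> carrier (cohom C (n + 1))"
        using z by (simp add: cohom_carrier)
      \<comment> \<open>The induction hypothesis is applied to F\<open>\<omega>\<close>. Rewriting
        dF as pFd then produces both the additional factor p and the additional iterate of
        \<open>F\<close>.\<close>
      have "kmap (BCs (Suc s)) n (\<Phi> (Suc s) n (red n \<omega>)) = kmap (BCs s) n (\<Phi> s n (red n (F n \<omega>)))"
        unfolding s' val(2)[OF w] by (rule X.derived_k[OF val(1)[OF w]])
      also have "\<dots> = cohom_class C (n + 1) ((F (n + 1) ^^ Suc s) (diff C n (F n \<omega>))) [^]\<^bsub>cohom C (n + 1)\<^esub> (p ^ s)"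
        using IH(3) F_closed[OF w] by blast
      also have "diff C n (F n \<omega>) = ?z [^]\<^bsub>grp C (n + 1)\<^esub> p" by (rule diff_F[OF w])
      also have "cohom_class C (n + 1) ((F (n + 1) ^^ Suc s) (?z [^]\<^bsub>grp C (n + 1)\<^esub> p)) =
          cohom_class C (n + 1) ((F (n + 1) ^^ Suc s) ?z) [^]\<^bsub>cohom C (n + 1)\<^esub> p"
        unfolding F_iter_pow[OF zc] by (rule cohom_class_pow[OF z])
      also have "\<dots> [^]\<^bsub>cohom C (n + 1)\<^esub> (p ^ s) =
          cohom_class C (n + 1) ((F (n + 1) ^^ Suc s) ?z) [^]\<^bsub>cohom C (n + 1)\<^esub> (p ^ Suc s)"
        using cc by (simp add: HC.nat_pow_pow)
      also have "(F (n + 1) ^^ Suc s) ?z = (F (n + 1) ^^ Suc (Suc s)) (diff C n \<omega>)"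
        by (simp add: funpow_swap1)
      finally show "kmap (BCs (Suc s)) n (\<Phi> (Suc s) n (red n \<omega>)) =
          cohom_class C (n + 1) ((F (n + 1) ^^ Suc (Suc s)) (diff C n \<omega>)) [^]\<^bsub>cohom C (n + 1)\<^esub> (p ^ Suc s)" .
    qed
    have "\<Phi> (Suc s) n \<in> iso (grp Cp n) (Egrp (BCs (Suc s)) n)" for n
    proof -
      have "Union \<circ> (cohom_map X.E (\<Phi> s) n \<circ> cart n) \<in> iso (grp Cp n) (flat_cohom X.E n)"
        by (intro iso_set_trans[OF iso_set_trans[OF cart_iso cohom_map_iso[OF IH(1)]] X.E.Union_iso])
      moreover have "\<Phi> (Suc s) n = Union \<circ> (cohom_map X.E (\<Phi> s) n \<circ> cart n)"
        by (simp add: fun_eq_iff \<Phi>_Suc)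
      ultimately show ?thesis unfolding s' X.derived_Egrp by simp
    qed
    from iso[OF this j k] j k show ?case by blast
  }
qed

text \<open>Translates from the number \<open>s\<close> of derivations to the page number r = s +
  1.\<close>

lemma stationary:
  fixes \<Phi> :: "nat \<Rightarrow> int \<Rightarrow> 'a set \<Rightarrow> 'a set set"
  assumes "\<Phi> 1 = cart"
    and "\<And>r i X. r \<ge> 1 \<Longrightarrow>
      \<Phi> (Suc r) i X = \<Union> (cohom_map (bockstein_page p C r) (\<Phi> r) i (cart i X))"
    and "r \<ge> 1"
  shows "cochain_iso Cp (bockstein_page p C r) (\<Phi> r)"
  using stationary_aux[of "\<lambda>s. \<Phi> (Suc s)" "r - 1"] assms by (simp add: bockstein_page_def)

end

section \<open>Differential forms\<close>

lemma additive_int_scale: "additive f \<Longrightarrow> f (int_scale k x) = int_scale k (f x)"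
  by (simp add: int_scale_def additive.diff additive.sum)

text \<open>Additivity alone suffices, because additive maps commute with
  \<open>int_scale\<close>.\<close>

lemma span_additive_image:
  assumes "w \<in> int_mod.span G" "additive f" "\<And>g. g \<in> G \<Longrightarrow> f g \<in> S" "int_mod.subspace S"
  shows "f w \<in> S"
  using assms(1)
proof (induction rule: int_mod.span_induct_alt)
  case base
  then show ?case using additive.zero[OF assms(2)] int_mod.subspace_0[OF assms(4)] by simp
next
  case (step c x y)
  then show ?case
    using assms additive.add[OF assms(2)] additive_int_scale[OF assms(2)]
    by (simp add: int_mod.subspace_add int_mod.subspace_scale)
qed

lemma span_additive_eq:
  assumes "w \<in> int_mod.span G" "additive f" "additive g" "\<And>x. x \<in> G \<Longrightarrow> f x = g x"
  shows "f w = g w"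
proof -
  have "additive (\<lambda>w. f w - g w)"
    using assms(2,3) by (simp add: additive_def)
  from span_additive_image[OF assms(1) this, of "{0}"] assms(4) show ?thesis by simp
qed

lemma additive_mult_left: "additive (\<lambda>x. a * x)" for a :: "'a::ring_1"
  by (simp add: additive_def algebra_simps)

lemma additive_comp: "additive f \<Longrightarrow> additive g \<Longrightarrow> additive (\<lambda>x. f (g x))"
  by (simp add: additive_def)

lemma additive_plus: "additive f \<Longrightarrow> additive g \<Longrightarrow> additive (\<lambda>x. f x + g x)"
  by (simp add: additive_def)

lemma additive_minus: "additive f \<Longrightarrow> additive g \<Longrightarrow> additive (\<lambda>x. f x - g x)"
  by (simp add: additive_def)

lemma additive_ext_d: "additive ext_d"
  and additive_grade_inv: "additive grade_inv"
  by unfold_locales simp_all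

lemma additive_xf: "additive xf" and additive_dxf: "additive dxf"
  by unfold_locales (rule xf_add, rule dxf_add)

lemma forms_induct [case_names zero one neg add mult xf dxf]:
  assumes "P 0" "P 1" "\<And>a. P a \<Longrightarrow> P (- a)" "\<And>a b. P a \<Longrightarrow> P b \<Longrightarrow> P (a + b)"
    "\<And>a b. P a \<Longrightarrow> P b \<Longrightarrow> P (a * b)" "\<And>l. P (xf l)" "\<And>l. P (dxf l)"
  shows "P a"
proof (induction a rule: forms.abs_induct)
  case (1 e)
  show ?case by (induction e) (simp_all add: abs_forms_simps assms)
qed

lemma xf_central: "xf l * a = a * xf l"
proof (induction a rule: forms_induct)
  case (mult a b)
  then show ?case by (metis mult.assoc)
qed (simp_all add: algebra_simps xf_xf xf_dxf)

lemma xf_pow_central: "xf l ^ n * a = a * xf l ^ n"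
  by (induction n) (simp_all add: xf_central mult.assoc flip: mult.assoc, metis mult.assoc xf_central)

lemma grade_inv_grade_inv [simp]: "grade_inv (grade_inv a) = a"
  by (induction a rule: forms_induct) simp_all

lemma ext_d_grade_inv: "ext_d (grade_inv a) = - grade_inv (ext_d a)"
  by (induction a rule: forms_induct) (simp_all add: algebra_simps)

text \<open>A new dx_l has to pass the factors x to reach the ordered shape of the spanning
  elements; these factors are central.\<close>

lemma Omega_hom_mult:
  fixes w :: "'l::ab_group_add forms"
  assumes "w \<in> Omega_hom i n"
  shows "xf l * w \<in> Omega_hom i (Suc n)" and "dxf l * w \<in> Omega_hom (i + 1) (Suc n)"
proof -
  have "xf l * prod_list (map xf ls) * a = prod_list (map xf (l # ls)) * a" for ls and a :: "'l forms"
    by simp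
  then have gx: "xf l * (prod_list (map xf ls) * prod_list (map dxf ms)) \<in> Omega_hom i (Suc n)"
    if "int (length ls) = int n - i" "int (length ms) = i" for ls ms
    unfolding Omega_hom_def using that
    by (intro int_mod.span_base CollectI exI[of _ "l # ls"] exI[of _ ms]) (simp add: mult.assoc)
  show "xf l * w \<in> Omega_hom i (Suc n)"
  proof (rule span_additive_image[OF assms[unfolded Omega_hom_def] additive_mult_left])
    show "int_mod.subspace (Omega_hom i (Suc n) :: 'l forms set)" by (simp add: Omega_hom_def)
  qed (use gx in blast)
  have xs: "prod_list (map xf ls) * a = a * prod_list (map xf ls)" for ls and a :: "'l forms"
    by (induction ls) (simp_all add: mult.assoc, metis mult.assoc xf_central)
  have gd: "dxf l * (prod_list (map xf ls) * prod_list (map dxf ms)) \<in> Omega_hom (i + 1) (Suc n)"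
    if "int (length ls) = int n - i" "int (length ms) = i" for ls ms
  proof -
    have "dxf l * (prod_list (map xf ls) * prod_list (map dxf ms)) =
        prod_list (map xf ls) * prod_list (map dxf (l # ms))"
      using xs[of ls "dxf l"] by (simp flip: mult.assoc)
    then show ?thesis
      unfolding Omega_hom_def using that
      by (intro int_mod.span_base CollectI exI[of _ ls] exI[of _ "l # ms"]) simp
  qed
  show "dxf l * w \<in> Omega_hom (i + 1) (Suc n)"
  proof (rule span_additive_image[OF assms[unfolded Omega_hom_def] additive_mult_left])
    show "int_mod.subspace (Omega_hom (i + 1) (Suc n) :: 'l forms set)" by (simp add: Omega_hom_def)
  qed (use gd in blast)
qed

lemma Omega_subspace: "int_mod.subspace (Omega i)"
  by (simp add: Omega_def)

lemmas Omega_0 = int_mod.subspace_0[OF Omega_subspace]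
  and Omega_add = int_mod.subspace_add[OF Omega_subspace]
  and Omega_neg = int_mod.subspace_neg[OF Omega_subspace]
  and Omega_diff = int_mod.subspace_diff[OF Omega_subspace]

lemma Omega_scale: "w \<in> Omega i \<Longrightarrow> of_int k * w \<in> Omega i"
  using int_mod.subspace_scale[OF Omega_subspace, of w i k] by (simp add: int_scale_eq_of_int_mult)

lemma Omega_1: "1 \<in> Omega 0"
proof -
  have "1 \<in> Omega_hom 0 0" unfolding Omega_hom_def by (rule int_mod.span_base) auto
  then show ?thesis unfolding Omega_def by (intro int_mod.span_base) auto
qed

lemma Omega_xf_mult:
  fixes w :: "'l::ab_group_add forms"
  assumes "w \<in> Omega i"
  shows "xf l * w \<in> Omega i"
proof (rule span_additive_image[OF assms[unfolded Omega_def] additive_mult_left _ Omega_subspace])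
  fix g :: "'l forms" assume "g \<in> (\<Union>n. Omega_hom i n)"
  then obtain n where "g \<in> Omega_hom i n" by blast
  from Omega_hom_mult(1)[OF this] show "xf l * g \<in> Omega i"
    unfolding Omega_def by (intro int_mod.span_base) blast
qed

lemma Omega_dxf_mult:
  fixes w :: "'l::ab_group_add forms"
  assumes "w \<in> Omega i"
  shows "dxf l * w \<in> Omega (i + 1)"
proof (rule span_additive_image[OF assms[unfolded Omega_def] additive_mult_left _ Omega_subspace])
  fix g :: "'l forms" assume "g \<in> (\<Union>n. Omega_hom i n)"
  then obtain n where "g \<in> Omega_hom i n" by blast
  from Omega_hom_mult(2)[OF this] show "dxf l * g \<in> Omega (i + 1)"
    unfolding Omega_def by (intro int_mod.span_base) blast
qed

text \<open>Spanning elements are words x...x dx...dx, built from 1 by left multiplication with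
  generators. A graded claim about an additive map therefore needs to be checked only along these
  multiplications.\<close>

lemma Omega_additive_image:
  fixes w :: "'l::ab_group_add forms"
  assumes f: "additive f" and S: "\<And>i. int_mod.subspace (S i)"
    and one: "f 1 \<in> S 0"
    and x: "\<And>i l w. w \<in> Omega i \<Longrightarrow> f w \<in> S i \<Longrightarrow> f (xf l * w) \<in> S i"
    and dx: "\<And>i l w. w \<in> Omega i \<Longrightarrow> f w \<in> S i \<Longrightarrow> f (dxf l * w) \<in> S (i + 1)"
    and w: "w \<in> Omega i"
  shows "f w \<in> S i"
proof (rule span_additive_image[OF w[unfolded Omega_def] f _ S])
  fix g :: "'l forms" assume "g \<in> (\<Union>n. Omega_hom i n)"
  then obtain n where g: "g \<in> Omega_hom i n" by blast
  have D: "prod_list (map dxf ms) \<in> Omega (int (length ms)) \<and> f (prod_list (map dxf ms)) \<in> S (int (length ms))" for ms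
  proof (induction ms)
    case (Cons m ms)
    then show ?case
      using Omega_dxf_mult[of "prod_list (map dxf ms)" "int (length ms)" m] dx[of "prod_list (map dxf ms)" "int (length ms)" m]
      by (simp add: add.commute)
  qed (simp add: Omega_1 one)
  have "prod_list (map xf ls) * prod_list (map dxf ms) \<in> Omega (int (length ms)) \<and>
      f (prod_list (map xf ls) * prod_list (map dxf ms)) \<in> S (int (length ms))" for ls ms
    by (induction ls) (simp_all add: D mult.assoc Omega_xf_mult x)
  then show "f g \<in> S i"
    by (intro span_additive_image[OF g[unfolded Omega_hom_def] f _ S]) auto
qed

lemma Omega_mult:
  assumes a: "a \<in> Omega i" and b: "b \<in> Omega j"
  shows "a * b \<in> Omega (i + j)"
proof (rule Omega_additive_image[where f = "\<lambda>a. a * b" and S = "\<lambda>i. Omega (i + j)", OF _ _ _ _ _ a])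
  show "additive (\<lambda>a. a * b)" by (simp add: additive_def algebra_simps)
  show "\<And>i l w. w * b \<in> Omega (i + j) \<Longrightarrow> dxf l * w * b \<in> Omega (i + 1 + j)"
    using Omega_dxf_mult by (fastforce simp: mult.assoc add.commute add.left_commute)
qed (simp_all add: b Omega_subspace Omega_xf_mult mult.assoc)

lemma Omega_ext_d: "w \<in> Omega i \<Longrightarrow> ext_d w \<in> Omega (i + 1)"
proof (rule Omega_additive_image[where f = ext_d and S = "\<lambda>i. Omega (i + 1)"])
  fix i l and w :: "'a forms" assume w: "w \<in> Omega i" "ext_d w \<in> Omega (i + 1)"
  then show "ext_d (xf l * w) \<in> Omega (i + 1)"
    by (simp add: Omega_add Omega_dxf_mult Omega_xf_mult)
  show "ext_d (dxf l * w) \<in> Omega (i + 1 + 1)"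
    using Omega_neg[OF Omega_dxf_mult[OF w(2), of l]] by simp
qed (simp_all add: additive_ext_d Omega_subspace Omega_0)

lemma xf_in_Omega: "xf l \<in> Omega 0" and dxf_in_Omega: "dxf l \<in> Omega 1"
  using Omega_xf_mult[OF Omega_1] Omega_dxf_mult[OF Omega_1] by simp_all

lemma Omega_pow: "w \<in> Omega 0 \<Longrightarrow> w ^ n \<in> Omega 0"
proof (induction n)
  case (Suc n)
  then show ?case using Omega_mult[of w 0 "w ^ n" 0] by simp
qed (simp add: Omega_1)

subsection \<open>Contractions\<close>

primrec expr_contr :: "('l::ab_group_add \<Rightarrow> 'l forms) \<Rightarrow> 'l expr \<Rightarrow> 'l forms" where
  "expr_contr g EZero = 0"
| "expr_contr g EOne = 0"
| "expr_contr g (ENeg a) = - expr_contr g a"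
| "expr_contr g (EAdd a b) = expr_contr g a + expr_contr g b"
| "expr_contr g (EMul a b) =
     expr_contr g a * abs_forms b + grade_inv (abs_forms a) * expr_contr g b"
| "expr_contr g (EVar l) = 0"
| "expr_contr g (EDiff l) = g l"

text \<open>The antiderivation of degree -1 that kills x_l and sends dx_l to \<open>g l\<close>. It
  uses a chosen representative because compatibility with \<open>form_eq\<close> depends on
  \<open>g\<close>: contracting dx_l dx_l gives \<open>g l\<close> dx_l - dx_l \<open>g l\<close>,
  which vanishes for central values.\<close>

definition contr :: "('l::ab_group_add \<Rightarrow> 'l forms) \<Rightarrow> 'l forms \<Rightarrow> 'l forms" where
  "contr g w = expr_contr g (rep_forms w)"

locale contraction =
  fixes g :: "'l::ab_group_add \<Rightarrow> 'l forms"
  assumes g_add: "g (l + m) = g l + g m" and g_central: "g l * a = a * g l"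
    and g_even: "grade_inv (g l) = g l"
begin

lemma contr_abs: "contr g (abs_forms e) = expr_contr g e"
proof -
  have "form_eq (rep_forms (abs_forms e)) e"
    using Quotient3_abs_rep[OF Quotient3_forms] by (simp flip: forms.abs_eq_iff)
  then have "expr_contr g (rep_forms (abs_forms e)) = expr_contr g e"
  proof induction
    case (mul_cong a b a' b')
    then have "abs_forms a = abs_forms b" "abs_forms a' = abs_forms b'"
      by (simp_all add: forms.abs_eq_iff)
    with mul_cong show ?case by simp
  next
    case (X_D l m)
    then show ?case by (simp add: abs_forms_simps g_central)
  next
    case (D_D l)
    then show ?case by (simp add: abs_forms_simps g_central)
  qed (simp_all add: abs_forms_simps g_add algebra_simps)
  then show ?thesis by (simp add: contr_def)
qed

lemma contr_simps [simp]:
  "contr g 0 = 0" "contr g 1 = 0" "contr g (- a) = - contr g a" "contr g (a + b) = contr g a + contr g b"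
  "contr g (a * b) = contr g a * b + grade_inv a * contr g b" "contr g (xf l) = 0" "contr g (dxf l) = g l"
proof -
  note ev = contr_abs
  show "contr g 0 = 0" "contr g 1 = 0" "contr g (xf l) = 0" "contr g (dxf l) = g l"
    using ev[of EZero] ev[of EOne] ev[of "EVar l"] ev[of "EDiff l"] by (simp_all add: abs_forms_simps)
  show "contr g (- a) = - contr g a"
    by (induct a rule: forms.abs_induct) (simp add: ev flip: abs_forms_simps)
  show "contr g (a + b) = contr g a + contr g b"
    by (induct a rule: forms.abs_induct, induct b rule: forms.abs_induct)
      (simp add: ev flip: abs_forms_simps)
  show "contr g (a * b) = contr g a * b + grade_inv a * contr g b"
    by (induct a rule: forms.abs_induct, induct b rule: forms.abs_induct)
      (simp add: ev abs_forms_simps(5)[symmetric])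
qed

lemma additive_contr: "additive (contr g)"
  by unfold_locales simp

text \<open>Cartan's formula: the Lie derivative along the vector field with x_l sent to
  \<open>g l\<close>.\<close>

definition lie :: "'l forms \<Rightarrow> 'l forms" where
  "lie w = ext_d (contr g w) + contr g (ext_d w)"

lemma contr_grade_inv: "contr g (grade_inv a) = - grade_inv (contr g a)"
  by (induction a rule: forms_induct) (simp_all add: algebra_simps g_even)

text \<open>Both d and the contraction are antiderivations anticommuting with the grading
  automorphism, so the mixed terms cancel and an ordinary derivation remains.\<close>

lemma lie_mult: "lie (a * b) = lie a * b + a * lie b"
  by (simp add: lie_def ext_d_grade_inv contr_grade_inv algebra_simps)

lemma lie_xf: "lie (xf l) = g l" and lie_dxf: "lie (dxf l) = ext_d (g l)"
  by (simp_all add: lie_def)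

lemma contr_Omega:
  assumes g: "\<And>l. g l \<in> Omega 0" and w: "w \<in> Omega i"
  shows "contr g w \<in> Omega (i - 1)"
proof (rule Omega_additive_image[OF additive_contr _ _ _ _ w])
  fix i l and w :: "'l forms" assume w: "w \<in> Omega i" "contr g w \<in> Omega (i - 1)"
  then show "contr g (xf l * w) \<in> Omega (i - 1)" by (simp add: Omega_xf_mult)
  show "contr g (dxf l * w) \<in> Omega (i + 1 - 1)"
    using Omega_mult[OF g w(1)] Omega_dxf_mult[OF w(2), of l] by (simp add: Omega_add Omega_neg Omega_diff)
qed (simp_all add: Omega_subspace Omega_0)

end

section \<open>The monomial basis\<close>

text \<open>The basis is a list because its order fixes the order of factors in a monomial and the
  resulting signs.\<close>

locale based_lattice =
  fixes bs :: "'l::ab_group_add list"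
  assumes distinct: "distinct bs"
    and indep: "int_mod.independent (set bs)"
    and span: "int_mod.span (set bs) = UNIV"
begin

definition coef :: "'l \<Rightarrow> 'l \<Rightarrow> int" where
  "coef l b = int_mod.representation (set bs) l b"

lemma coef_add: "coef (l + m) b = coef l b + coef m b"
  by (simp add: coef_def int_mod.representation_add[OF indep] span)

lemma coef_basis: "b \<in> set bs \<Longrightarrow> coef b c = (if c = b then 1 else 0)"
  by (simp add: coef_def int_mod.representation_basis[OF indep])

lemma basis_expansion: "(\<Sum>b\<in>set bs. int_scale (coef l b) b) = l"
  unfolding coef_def by (rule int_mod.sum_representation_eq[OF indep]) (simp_all add: span)

lemma additive_expansion: "additive f \<Longrightarrow> f l = (\<Sum>b\<in>set bs. int_scale (coef l b) (f b))"
  using arg_cong[OF basis_expansion[of l], of f] additive.sum[of f "\<lambda>b. int_scale (coef l b) b" "set bs"]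
  by (simp add: additive_int_scale)

text \<open>General x_l and dx_l are integer combinations of those at basis elements, and
  \<open>int_scale\<close> is built from sums and negatives, so the ring closure conditions reach
  them.\<close>

lemma forms_basis_induct [case_names zero one neg add mult xf dxf]:
  assumes P: "P 0" "P 1" "\<And>a. P a \<Longrightarrow> P (- a)" "\<And>a b. P a \<Longrightarrow> P b \<Longrightarrow> P (a + b)"
    "\<And>a b. P a \<Longrightarrow> P b \<Longrightarrow> P (a * b)" "\<And>b. b \<in> set bs \<Longrightarrow> P (xf b)" "\<And>b. b \<in> set bs \<Longrightarrow> P (dxf b)"
  shows "P (a :: 'l forms)"
proof -
  have nat: "P (\<Sum>_<n. x)" if x: "P x" for n :: nat and x
  proof (induction n)
    case (Suc n)
    then show ?case using P(4)[OF _ x] by (simp only: sum.lessThan_Suc)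
  qed (simp add: P(1))
  have scale: "P (int_scale k x)" if "P x" for k x
    using P(4)[OF nat[OF that] P(3)[OF nat[OF that]]] by (simp add: int_scale_def)
  have "P (\<Sum>b\<in>A. int_scale (k b) (f b))" if "finite A" "\<And>b. b \<in> A \<Longrightarrow> P (f b)" for A :: "'l set" and k f
    using that P(1,4) scale by (induction A) simp_all
  then have lin: "P (f l)" if "additive f" "\<And>b. b \<in> set bs \<Longrightarrow> P (f b)" for f l
    using that by (subst additive_expansion) simp_all
  show ?thesis
    by (induction a rule: forms_induct) (use P lin[OF additive_xf] lin[OF additive_dxf] in auto)
qed

subsection \<open>An action on coefficient functions\<close>

text \<open>A form acts on the coefficient functions of monomials \<open>(m, S)\<close> as it multiplies monomials;
  \<open>sg b S\<close> is the sign that moves \<open>dx\<^sub>b\<close> past the earlier factors of \<open>dx\<^sub>S\<close>.  Acting on the monomial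
  \<open>1\<close> yields the coordinates of a form.\<close>

definition rank :: "'l \<Rightarrow> nat" where
  "rank b = length (takeWhile (\<lambda>x. x \<noteq> b) bs)"

lemma rank_less:
  assumes "bs = as @ b # cs" "c \<in> set cs"
  shows "rank b < rank c"
proof -
  have "b \<notin> set as" "c \<notin> set as" "c \<noteq> b" using assms distinct by auto
  then have "takeWhile (\<lambda>x. x \<noteq> b) bs = as" "takeWhile (\<lambda>x. x \<noteq> c) bs = as @ b # takeWhile (\<lambda>x. x \<noteq> c) cs"
    unfolding assms(1) by (subst takeWhile_append2; force)+
  then show ?thesis by (simp add: rank_def)
qed

lemma nth_rank:
  assumes "b \<in> set bs"
  shows "bs ! rank b = b"
proof -
  obtain as cs where bs: "bs = as @ b # cs" using split_list[OF assms] by blast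
  then have "b \<notin> set as" using distinct by auto
  then have "takeWhile (\<lambda>x. x \<noteq> b) bs = as" unfolding bs by (subst takeWhile_append2) force+
  then have "rank b = length as" by (simp add: rank_def)
  then show ?thesis using bs by simp
qed

lemma rank_inj: "b \<in> set bs \<Longrightarrow> c \<in> set bs \<Longrightarrow> rank b = rank c \<Longrightarrow> b = c"
  by (metis nth_rank)

definition sg :: "'l \<Rightarrow> 'l set \<Rightarrow> int" where
  "sg b S = (\<Prod>c | c \<in> set bs \<and> rank c < rank b. if c \<in> S then - 1 else 1)"

text \<open>The removed element contributes a factor -1 exactly when it precedes \<open>b\<close>.
  This asymmetry is the source of anticommutation in \<open>opD_opD\<close>.\<close>

lemma sg_remove:
  assumes "c \<in> set bs" "c \<in> S"
  shows "sg b (S - {c}) = (if rank c < rank b then - sg b S else sg b S)"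
proof (cases "rank c < rank b")
  case True
  let ?A = "{d \<in> set bs. rank d < rank b}"
  have "c \<in> ?A" using assms True by simp
  moreover have "(\<Prod>d\<in>?A - {c}. if d \<in> S - {c} then - 1 else 1 :: int) = (\<Prod>d\<in>?A - {c}. if d \<in> S then - 1 else 1)"
    by (rule prod.cong) auto
  ultimately show ?thesis
    using True assms
      prod.remove[of ?A c "\<lambda>d. if d \<in> S - {c} then - 1 else 1 :: int"]
      prod.remove[of ?A c "\<lambda>d. if d \<in> S then - 1 else 1 :: int"]
    by (simp add: sg_def)
next
  case False
  then have "sg b (S - {c}) = sg b S" unfolding sg_def by (intro prod.cong) auto
  with False show ?thesis by simp
qed

type_synonym 'b idx = "('b \<Rightarrow> nat) \<times> 'b set"

text \<open>The coefficient at \<open>(m, S)\<close> after multiplication by x_b is read at exponent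
  \<open>m b - 1\<close>. The test keeps that index admissible: for \<open>b \<in> S\<close> it asks
  for \<open>m b\<close> to be at least 2.\<close>

definition opX :: "'l \<Rightarrow> ('l idx \<Rightarrow> int) \<Rightarrow> 'l idx \<Rightarrow> int" where
  "opX b f q = (let (m, S) = q in
     if m b > (if b \<in> S then 1 else 0) then f (m(b := m b - 1), S) else 0)"

text \<open>As dx_b = x_b dlog x_b, multiplication raises the exponent of \<open>b\<close> and adds
  \<open>b\<close> to the set; both changes are undone to read the old coefficient.\<close>

definition opD :: "'l \<Rightarrow> ('l idx \<Rightarrow> int) \<Rightarrow> 'l idx \<Rightarrow> int" where
  "opD b f q = (let (m, S) = q in
     if b \<in> S \<and> m b > 0 then sg b S * f (m(b := m b - 1), S - {b}) else 0)"

lemma opX_apply: "opX b f (m, S) = (if m b > (if b \<in> S then 1 else 0) then f (m(b := m b - 1), S) else 0)"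
  and opD_apply: "opD b f (m, S) = (if b \<in> S \<and> m b > 0 then sg b S * f (m(b := m b - 1), S - {b}) else 0)"
  by (simp_all add: opX_def opD_def)

lemma opX_opX: "opX b (opX c f) q = opX c (opX b f) q"
proof (cases "b = c"; cases q)
  fix m S assume F: "b \<noteq> c" and q: "q = (m, S)"
  show ?thesis
    unfolding q opX_apply fun_upd_twist[OF F] by (simp add: F F[symmetric])
qed simp_all

lemma opX_opD: "opX b (opD c f) q = opD c (opX b f) q"
proof (cases "b = c"; cases q)
  fix m S assume F: "b \<noteq> c" and q: "q = (m, S)"
  show ?thesis
    unfolding q opX_apply opD_apply fun_upd_twist[OF F] by (simp add: F F[symmetric])
next
  fix m S assume F: "b = c" and q: "q = (m, S)"
  show ?thesis
    unfolding q F opX_apply opD_apply by (cases "c \<in> S") simp_all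
qed

text \<open>For distinct \<open>b\<close> and \<open>c\<close> exactly one of them precedes the
  other, so the two orders of removal differ by one sign. For \<open>b = c\<close> both sides
  vanish.\<close>

lemma opD_opD:
  assumes "b \<in> set bs" "c \<in> set bs"
  shows "opD b (opD c f) q = - opD c (opD b f) q"
proof (cases "b = c")
  case True
  then show ?thesis by (cases q) (simp add: opD_apply)
next
  case False
  then have "rank b < rank c \<or> rank c < rank b" using assms rank_inj by (meson linorder_neqE_nat)
  moreover obtain m S where q: "q = (m, S)" by (cases q)
  ultimately show ?thesis
    unfolding q opD_apply fun_upd_twist[OF False]
    using False False[symmetric] assms by (auto simp: sg_remove Diff_insert2[symmetric] insert_commute)
qed

lemma op_sum:
  "opX b (\<lambda>q. \<Sum>c\<in>A. k c * g c q) q = (\<Sum>c\<in>A. k c * opX b (g c) q)"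
  "opD b (\<lambda>q. \<Sum>c\<in>A. k c * g c q) q = (\<Sum>c\<in>A. k c * opD b (g c) q)"
proof -
  obtain m S where q: "q = (m, S)" by (cases q)
  show "opX b (\<lambda>q. \<Sum>c\<in>A. k c * g c q) q = (\<Sum>c\<in>A. k c * opX b (g c) q)"
    unfolding q opX_apply by simp
  show "opD b (\<lambda>q. \<Sum>c\<in>A. k c * g c q) q = (\<Sum>c\<in>A. k c * opD b (g c) q)"
  proof (cases "b \<in> S \<and> m b > 0")
    case True
    show ?thesis
      unfolding q opD_apply if_P[OF True] by (simp add: sum_distrib_left mult.left_commute)
  next
    case False
    show ?thesis unfolding q opD_apply if_not_P[OF False] by simp
  qed
qed

lemma op_add:
  "opX b (\<lambda>q. f q + g q) q = opX b f q + opX b g q"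
  "opD b (\<lambda>q. f q + g q) q = opD b f q + opD b g q"
proof -
  obtain m S where q: "q = (m, S)" by (cases q)
  show "opX b (\<lambda>q. f q + g q) q = opX b f q + opX b g q"
    unfolding q opX_apply by simp
  show "opD b (\<lambda>q. f q + g q) q = opD b f q + opD b g q"
    unfolding q opD_apply by (simp add: ring_distribs)
qed

primrec expr_act :: "'l expr \<Rightarrow> ('l idx \<Rightarrow> int) \<Rightarrow> 'l idx \<Rightarrow> int" where
  "expr_act EZero f = (\<lambda>q. 0)"
| "expr_act EOne f = f"
| "expr_act (ENeg a) f = (\<lambda>q. - expr_act a f q)"
| "expr_act (EAdd a b) f = (\<lambda>q. expr_act a f q + expr_act b f q)"
| "expr_act (EMul a b) f = expr_act a (expr_act b f)"
| "expr_act (EVar l) f = (\<lambda>q. \<Sum>b\<in>set bs. coef l b * opX b f q)"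
| "expr_act (EDiff l) f = (\<lambda>q. \<Sum>b\<in>set bs. coef l b * opD b f q)"

lemma expr_act_add: "expr_act a (\<lambda>q. f q + g q) = (\<lambda>q. expr_act a f q + expr_act a g q)"
proof (induction a arbitrary: f g)
  case (EAdd a b)
  then show ?case by (simp add: add_ac)
next
  case (EMul a b)
  then show ?case by simp
qed (simp_all add: op_add ring_distribs sum.distrib)

lemma expr_act_cong: "form_eq a b \<Longrightarrow> expr_act a = expr_act b"
proof (induction rule: form_eq.induct)
  case (X_X l m)
  have "(\<Sum>b\<in>set bs. \<Sum>c\<in>set bs. coef l b * (coef m c * opX b (opX c f) q)) =
      (\<Sum>b\<in>set bs. \<Sum>c\<in>set bs. coef m b * (coef l c * opX b (opX c f) q))" for f q
    by (subst sum.swap) (simp add: opX_opX mult.left_commute)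
  then show ?case by (simp add: fun_eq_iff op_sum sum_distrib_left)
next
  case (X_D l m)
  have "(\<Sum>b\<in>set bs. \<Sum>c\<in>set bs. coef l b * (coef m c * opX b (opD c f) q)) =
      (\<Sum>b\<in>set bs. \<Sum>c\<in>set bs. coef m b * (coef l c * opD b (opX c f) q))" for f q
    by (subst sum.swap) (simp add: opX_opD mult.left_commute)
  then show ?case by (simp add: fun_eq_iff op_sum sum_distrib_left)
next
  case (mul_cong a b a' b')
  then show ?case by (simp add: fun_eq_iff[of "expr_act (EMul _ _)"])
next
  case (D_D l)
  have "(\<Sum>b\<in>set bs. \<Sum>c\<in>set bs. coef l b * (coef l c * opD b (opD c f) q)) = 0" (is "?s = 0") for f q
  proof -
    have sw: "coef l c * (coef l b * opD c (opD b f) q) = - (coef l b * (coef l c * opD b (opD c f) q))"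
      if "b \<in> set bs" "c \<in> set bs" for b c
      using opD_opD[OF that, of f q] by (simp add: mult.left_commute)
    \<comment> \<open>Exchanging the summation variables shows that the integer \<open>?s\<close>
      equals its own negative; no division of off-diagonal terms into pairs is required.\<close>
    have "?s = (\<Sum>b\<in>set bs. \<Sum>c\<in>set bs. - (coef l b * (coef l c * opD b (opD c f) q)))"
      by (subst sum.swap) (rule sum.cong[OF HOL.refl], rule sum.cong[OF HOL.refl], rule sw)
    also have "\<dots> = - ?s" by (simp add: sum_negf)
    finally show ?thesis by simp
  qed
  then show ?case by (simp add: fun_eq_iff op_sum sum_distrib_left)
qed (auto simp: fun_eq_iff expr_act_add coef_add ring_distribs sum.distrib)

definition act :: "'l forms \<Rightarrow> ('l idx \<Rightarrow> int) \<Rightarrow> 'l idx \<Rightarrow> int" where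
  "act w = expr_act (rep_forms w)"

lemma act_abs: "act (abs_forms e) = expr_act e"
  unfolding act_def
  by (rule expr_act_cong) (simp add: Quotient3_abs_rep[OF Quotient3_forms] flip: forms.abs_eq_iff)

lemma act_simps:
  "act 1 f = f" "act (v + w) f q = act v f q + act w f q" "act (v * w) f = act v (act w f)"
  "b \<in> set bs \<Longrightarrow> act (xf b) f = opX b f" "b \<in> set bs \<Longrightarrow> act (dxf b) f = opD b f"
proof -
  note ev = act_abs
  show "act 1 f = f" using ev[of EOne] by (simp add: abs_forms_simps)
  show "act (v + w) f q = act v f q + act w f q"
    by (induct v rule: forms.abs_induct, induct w rule: forms.abs_induct)
      (simp add: ev flip: abs_forms_simps)
  show "act (v * w) f = act v (act w f)"
    by (induct v rule: forms.abs_induct, induct w rule: forms.abs_induct)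
      (simp add: ev flip: abs_forms_simps)
  show "act (xf b) f = opX b f" "act (dxf b) f = opD b f" if "b \<in> set bs"
    using that ev[of "EVar b"] ev[of "EDiff b"]
    by (simp_all add: abs_forms_simps fun_eq_iff coef_basis if_distrib[of "\<lambda>k. k * _"] cong: if_cong)
qed

subsection \<open>Monomials\<close>

text \<open>The monomial with exponents \<open>m\<close> and \<open>S \<subseteq> supp m\<close> is \<open>x\<^sup>m\<close> times the product of the
  \<open>d log x\<^sub>b\<close>, \<open>b \<in> S\<close>.  In this indexing \<open>d\<close> preserves \<open>m\<close> and the lift of the inverse Cartier
  map multiplies \<open>m\<close> by \<open>p\<close>.\<close>

definition u :: "'l \<Rightarrow> nat \<Rightarrow> bool \<Rightarrow> 'l forms" where
  "u b n s = (if s then xf b ^ (n - 1) * dxf b else xf b ^ n)"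

text \<open>Formed over an arbitrary list so that inductions can run over suffixes of
  \<open>bs\<close>.\<close>

definition mon :: "'l list \<Rightarrow> 'l idx \<Rightarrow> 'l forms" where
  "mon cs q = prod_list (map (\<lambda>b. u b (fst q b) (b \<in> snd q)) cs)"

abbreviation "e \<equiv> mon bs"

text \<open>The first inclusion makes the exponent \<open>n - 1\<close> in \<open>u\<close> a
  genuine subtraction; the second lets the product over \<open>bs\<close> see every nonzero
  exponent.\<close>

definition V :: "'l idx set" where
  "V = {(m, S). S \<subseteq> {b. m b > 0} \<and> {b. m b > 0} \<subseteq> set bs}"

definition coord :: "'l forms \<Rightarrow> 'l idx \<Rightarrow> int" where
  "coord w = act w (\<lambda>q. if q = (\<lambda>_. 0, {}) then 1 else 0)"

lemma mon_Nil [simp]: "mon [] q = 1"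
  and mon_Cons [simp]: "mon (c # cs) (m, S) = u c (m c) (c \<in> S) * mon cs (m, S)"
  by (simp_all add: mon_def)

lemma mon_cong:
  "(\<And>b. b \<in> set cs \<Longrightarrow> m b = m' b \<and> (b \<in> S \<longleftrightarrow> b \<in> S')) \<Longrightarrow> mon cs (m, S) = mon cs (m', S')"
  by (induction cs) simp_all

abbreviation delta :: "'l idx \<Rightarrow> 'l idx \<Rightarrow> int" where
  "delta q0 q \<equiv> if q = q0 then 1 else 0"

lemma decr_eq_iff:
  fixes m m' :: "'l \<Rightarrow> nat"
  assumes "m' b > 0"
  shows "m'(b := m' b - 1) = m \<longleftrightarrow> m' = m(b := Suc (m b))"
proof
  assume "m'(b := m' b - 1) = m"
  then show "m' = m(b := Suc (m b))" using assms by (simp flip: \<open>_ = m\<close>)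
next
  assume "m' = m(b := Suc (m b))"
  then show "m'(b := m' b - 1) = m" by simp
qed

lemma opX_delta:
  assumes "b \<in> S \<Longrightarrow> m b > 0"
  shows "opX b (delta (m, S)) = delta (m(b := Suc (m b)), S)"
proof (rule ext)
  fix q :: "'l idx" obtain m' S' where q: "q = (m', S')" by (cases q)
  show "opX b (delta (m, S)) q = delta (m(b := Suc (m b)), S) q"
  proof (cases "m' = m(b := Suc (m b)) \<and> S' = S")
    case True
    then show ?thesis using assms by (simp add: q opX_apply)
  next
    case False
    have "\<not> (m'(b := m' b - 1) = m \<and> S' = S)" if "m' b > (if b \<in> S' then 1 else 0)"
    proof -
      have "m' b > 0" using that by (simp split: if_splits)
      then show ?thesis using decr_eq_iff[of m' b m] False by blast
    qed
    with False show ?thesis unfolding q opX_apply by auto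
  qed
qed

text \<open>There is no sign because \<open>b\<close> precedes all of \<open>S\<close>, so dx_b is
  already in place.\<close>

lemma opD_delta:
  assumes "b \<notin> S" "\<And>c. c \<in> S \<Longrightarrow> rank b < rank c"
  shows "opD b (delta (m, S)) = delta (m(b := Suc (m b)), insert b S)"
proof (rule ext)
  fix q :: "'l idx" obtain m' S' where q: "q = (m', S')" by (cases q)
  have sg: "sg b (insert b S) = 1"
    unfolding sg_def by (rule prod.neutral) (use assms(2) in \<open>auto dest: less_asym\<close>)
  show "opD b (delta (m, S)) q = delta (m(b := Suc (m b)), insert b S) q"
  proof (cases "m' = m(b := Suc (m b)) \<and> S' = insert b S")
    case True
    then show ?thesis using assms(1) sg by (simp add: q opD_apply)
  next
    case False
    have "\<not> (m'(b := m' b - 1) = m \<and> S' - {b} = S)" if "m' b > 0" "b \<in> S'"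
      using decr_eq_iff[of m' b m] that False by blast
    with False show ?thesis unfolding q opD_apply by auto
  qed
qed

lemma opX_pow_delta:
  assumes "c \<in> set bs" "c \<in> S \<Longrightarrow> m c > 0"
  shows "act (xf c ^ k) (delta (m, S)) = delta (m(c := m c + k), S)"
proof (induction k)
  case (Suc k)
  have "act (xf c ^ Suc k) (delta (m, S)) = opX c (delta (m(c := m c + k), S))"
    by (simp only: power_Suc act_simps Suc assms(1))
  also have "\<dots> = delta ((m(c := m c + k))(c := Suc ((m(c := m c + k)) c)), S)"
    using assms(2) by (intro opX_delta) simp
  also have "(m(c := m c + k))(c := Suc ((m(c := m c + k)) c)) = m(c := m c + Suc k)" by simp
  finally show ?case .
qed (simp add: act_simps)

text \<open>Factors act from the right end of \<open>bs\<close>, so each new one precedes those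
  already treated and \<open>opD_delta\<close> applies without sign.\<close>

lemma act_mon:
  assumes "bs = as @ cs" and S: "\<And>b. b \<in> S \<Longrightarrow> m b > 0"
  shows "act (mon cs (m, S)) (delta (\<lambda>_. 0, {})) =
    delta (\<lambda>b. if b \<in> set cs then m b else 0, S \<inter> set cs)"
  using assms(1)
proof (induction cs arbitrary: as)
  case (Cons c cs)
  let ?m = "\<lambda>b. if b \<in> set cs then m b else 0"
  have c: "c \<in> set bs" "c \<notin> set cs" using Cons.prems distinct by auto
  have lt: "rank c < rank b" if "b \<in> S \<inter> set cs" for b using rank_less[OF Cons.prems] that by blast
  have IH: "act (mon cs (m, S)) (delta (\<lambda>_. 0, {})) = delta (?m, S \<inter> set cs)"
    using Cons.prems by (intro Cons.IH[of "as @ [c]"]) simp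
  show ?case
  proof (cases "c \<in> S")
    case True
    have "opD c (delta (?m, S \<inter> set cs)) = delta (?m(c := Suc (?m c)), insert c (S \<inter> set cs))"
      using c lt by (intro opD_delta) auto
    then have "act (u c (m c) True) (delta (?m, S \<inter> set cs)) =
        act (xf c ^ (m c - 1)) (delta (?m(c := Suc (?m c)), insert c (S \<inter> set cs)))"
      using c(1) by (simp only: u_def act_simps if_True)
    \<comment> \<open>dx_c has raised the exponent of \<open>c\<close> from 0 to 1; the power
      contributes the remaining \<open>m c - 1\<close>, and \<open>m c > 0\<close> makes the total
      \<open>m c\<close>.\<close>
    also have "\<dots> = delta ((?m(c := Suc (?m c)))(c := (?m(c := Suc (?m c))) c + (m c - 1)), insert c (S \<inter> set cs))"
      using c by (intro opX_pow_delta) simp_all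
    also have "(?m(c := Suc (?m c)))(c := (?m(c := Suc (?m c))) c + (m c - 1)) =
        (\<lambda>b. if b \<in> set (c # cs) then m b else 0)"
      using S[OF True] c by auto
    also have "insert c (S \<inter> set cs) = S \<inter> set (c # cs)" using True by auto
    finally show ?thesis using True by (simp add: act_simps IH)
  next
    case False
    have "act (u c (m c) False) (delta (?m, S \<inter> set cs)) = delta (?m(c := ?m c + m c), S \<inter> set cs)"
      using c opX_pow_delta[of c "S \<inter> set cs" ?m "m c"] by (simp add: u_def)
    also have "?m(c := ?m c + m c) = (\<lambda>b. if b \<in> set (c # cs) then m b else 0)" using c by auto
    also have "S \<inter> set cs = S \<inter> set (c # cs)" using False by auto
    finally show ?thesis using False by (simp add: act_simps IH)
  qed
qed (simp add: act_simps)

text \<open>This is the linear independence of the monomials in the presented ring.\<close>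

lemma coord_e:
  assumes "q \<in> V"
  shows "coord (e q) = delta q"
proof -
  obtain m S where q: "q = (m, S)" by (cases q)
  with assms have m: "S \<subseteq> {b. m b > 0}" "{b. m b > 0} \<subseteq> set bs" by (auto simp: V_def)
  then have "(\<lambda>b. if b \<in> set bs then m b else 0) = m" by (auto simp: fun_eq_iff)
  moreover have "S \<inter> set bs = S" using m by blast
  ultimately show ?thesis using act_mon[of "[]" bs S m] m by (auto simp: coord_def q)
qed

lemma additive_coord: "additive (\<lambda>w. coord w q)"
  by unfold_locales (simp add: coord_def act_simps)

section \<open>Products of generators with monomials\<close>

lemma xf_u: "(s \<Longrightarrow> n > 0) \<Longrightarrow> xf c * u c n s = u c (Suc n) s"
  by (cases n) (auto simp: u_def mult.assoc)

lemma xf_mon: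
  assumes "b \<in> set cs" "distinct cs" "b \<in> S \<Longrightarrow> m b > 0"
  shows "xf b * mon cs (m, S) = mon cs (m(b := Suc (m b)), S)"
  using assms
proof (induction cs)
  case (Cons c cs)
  let ?m = "m(b := Suc (m b))"
  show ?case
  proof (cases "b = c")
    case True
    have eq: "mon cs (?m, S) = mon cs (m, S)"
      using Cons.prems True by (intro mon_cong) auto
    have "xf b * mon (c # cs) (m, S) = xf b * u b (m b) (b \<in> S) * mon cs (m, S)"
      using True by (simp add: mult.assoc)
    also have "xf b * u b (m b) (b \<in> S) = u b (Suc (m b)) (b \<in> S)"
      by (rule xf_u) (rule Cons.prems(3))
    also have "\<dots> * mon cs (m, S) = mon (c # cs) (?m, S)"
      unfolding mon_Cons eq using True by simp
    finally show ?thesis .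
  next
    case False
    then have IH: "xf b * mon cs (m, S) = mon cs (?m, S)"
      using Cons.prems by (intro Cons.IH) auto
    have "xf b * mon (c # cs) (m, S) = u c (m c) (c \<in> S) * (xf b * mon cs (m, S))"
      using xf_central[of b "u c (m c) (c \<in> S)"] by (simp flip: mult.assoc)
    also have "\<dots> = mon (c # cs) (?m, S)" unfolding mon_Cons IH using False by simp
    finally show ?thesis .
  qed
qed simp

lemma dxf_u:
  "dxf b * u c n s = (if s then - (u c n s * dxf b) else u c n s * dxf b)"
proof (cases s)
  case True
  have "dxf b * (xf c ^ (n - 1) * dxf c) = xf c ^ (n - 1) * (dxf b * dxf c)"
    by (simp flip: mult.assoc xf_pow_central)
  then show ?thesis using True dxf_anticomm[of b c] by (simp add: u_def mult.assoc)
qed (simp add: u_def xf_pow_central)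

text \<open>Only spanning is at stake, so the sign is hidden in \<open>k\<close>;
  \<open>k = 0\<close> for \<open>b \<in> S\<close> records that dx_b squares to zero.\<close>

lemma dxf_mon:
  assumes "b \<in> set cs" "distinct cs"
  shows "\<exists>k::int. dxf b * mon cs (m, S) = of_int k * mon cs (m(b := Suc (m b)), insert b S) \<and> (b \<in> S \<longrightarrow> k = 0)"
  using assms
proof (induction cs)
  case (Cons c cs)
  show ?case
  proof (cases "b = c")
    case True
    have eq: "mon cs (m(b := Suc (m b)), insert b S) = mon cs (m, S)"
      using Cons.prems True by (intro mon_cong) auto
    show ?thesis
    proof (cases "c \<in> S")
      case c: True
      have "dxf c * u c (m c) True = 0"
        by (simp add: dxf_u) (simp add: u_def mult.assoc dxf_sq)
      then have "dxf b * mon (c # cs) (m, S) = 0" using True c by (simp flip: mult.assoc)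
      then show ?thesis by (intro exI[of _ 0]) simp
    next
      case c: False
      have "dxf c * u c (m c) False = u c (Suc (m c)) True"
        using xf_pow_central[of c "m c" "dxf c"] by (simp add: u_def)
      then have "dxf b * mon (c # cs) (m, S) = u c (Suc (m c)) True * mon cs (m, S)"
        using True c by (simp flip: mult.assoc)
      also have "\<dots> = mon (c # cs) (m(b := Suc (m b)), insert b S)"
        unfolding mon_Cons eq using True by simp
      finally have "dxf b * mon (c # cs) (m, S) = of_int 1 * mon (c # cs) (m(b := Suc (m b)), insert b S)"
        by (simp only: of_int_1 mult_1_left)
      moreover have "b \<in> S \<longrightarrow> (1::int) = 0" using True c by simp
      ultimately show ?thesis by blast
    qed
  next
    case False
    then have "b \<in> set cs" "distinct cs" using Cons.prems by auto
    from Cons.IH[OF this] obtain k :: int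
      where k: "dxf b * mon cs (m, S) = of_int k * mon cs (m(b := Suc (m b)), insert b S)"
        "b \<in> S \<longrightarrow> k = 0" by blast
    have "dxf b * mon (c # cs) (m, S) = dxf b * u c (m c) (c \<in> S) * mon cs (m, S)"
      by (simp add: mult.assoc)
    also have "\<dots> = of_int (if c \<in> S then - 1 else 1) * u c (m c) (c \<in> S) * (dxf b * mon cs (m, S))"
      by (simp add: dxf_u mult.assoc)
    also have "\<dots> = of_int (if c \<in> S then - k else k) * (u c (m c) (c \<in> S) *
        mon cs (m(b := Suc (m b)), insert b S))"
      unfolding k(1)
      by (cases "c \<in> S") (simp_all add: mult_of_int_commute[of k "u c _ _"] flip: mult.assoc)
    also have "u c (m c) (c \<in> S) * mon cs (m(b := Suc (m b)), insert b S) =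
        mon (c # cs) (m(b := Suc (m b)), insert b S)"
      unfolding mon_Cons using False by simp
    finally have "dxf b * mon (c # cs) (m, S) =
        of_int (if c \<in> S then - k else k) * mon (c # cs) (m(b := Suc (m b)), insert b S)" .
    moreover have "b \<in> S \<longrightarrow> (if c \<in> S then - k else k) = 0" using k(2) by simp
    ultimately show ?thesis by blast
  qed
qed simp

section \<open>The monomials span each degree\<close>

abbreviation "E i \<equiv> e ` {q \<in> V. int (card (snd q)) = i}"

lemma xf_basis_E:
  assumes "b \<in> set bs" "w \<in> E i"
  shows "xf b * w \<in> E i"
proof -
  obtain m S where q: "(m, S) \<in> V" "int (card S) = i" "w = e (m, S)" using assms by auto
  then have "xf b * w = e (m(b := Suc (m b)), S)"
    using assms distinct by (auto simp: V_def intro!: xf_mon)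
  moreover have "(m(b := Suc (m b)), S) \<in> V" using q(1) assms(1) by (auto simp: V_def)
  ultimately show ?thesis using q(2) by (intro image_eqI[of _ _ "(m(b := Suc (m b)), S)"]) simp_all
qed

lemma dxf_basis_E:
  assumes "b \<in> set bs" "w \<in> E i"
  shows "\<exists>k w'. dxf b * w = of_int k * w' \<and> w' \<in> insert 0 (E (i + 1))"
proof -
  obtain m S where q: "(m, S) \<in> V" "int (card S) = i" "w = e (m, S)" using assms by auto
  obtain k :: int where k: "dxf b * w = of_int k * e (m(b := Suc (m b)), insert b S)" "b \<in> S \<longrightarrow> k = 0"
    using dxf_mon[OF assms(1) distinct] q(3) by blast
  have q': "(m(b := Suc (m b)), insert b S) \<in> V" using q(1) assms(1) by (auto simp: V_def)
  have "finite S" using q(1) by (auto simp: V_def intro: finite_subset[OF _ finite_set])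
  show ?thesis
  proof (cases "b \<in> S")
    case True
    then show ?thesis using k by (intro exI[of _ 0]) auto
  next
    case False
    then have "int (card (insert b S)) = i + 1" using \<open>finite S\<close> q(2) by simp
    with q' have "e (m(b := Suc (m b)), insert b S) \<in> E (i + 1)"
      by (intro imageI) simp
    with k(1) show ?thesis by blast
  qed
qed

abbreviation "W i \<equiv> int_mod.span (E i)"

lemma xf_basis_W:
  assumes "b \<in> set bs" "w \<in> W i"
  shows "xf b * w \<in> W i"
proof (rule span_additive_image[OF assms(2) additive_mult_left])
  fix g assume "g \<in> E i"
  then show "xf b * g \<in> W i" by (intro int_mod.span_base xf_basis_E[OF assms(1)])
qed simp

lemma dxf_basis_W:
  assumes "b \<in> set bs" "w \<in> W i"
  shows "dxf b * w \<in> W (i + 1)"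
proof (rule span_additive_image[OF assms(2) additive_mult_left])
  fix g assume "g \<in> E i"
  from dxf_basis_E[OF assms(1) this] obtain k w'
    where w': "dxf b * g = of_int k * w'" "w' \<in> insert 0 (E (i + 1))" by blast
  from w'(2) have "w' \<in> W (i + 1)" by (elim insertE) (simp_all add: int_mod.span_zero int_mod.span_base)
  with w'(1) show "dxf b * g \<in> W (i + 1)"
    using int_mod.span_scale[of w' _ k] by (simp add: int_scale_eq_of_int_mult)
qed simp

lemma linear_W:
  assumes "w \<in> W i"
  shows "xf l * w \<in> W i" and "dxf l * w \<in> W (i + 1)"
proof -
  have "additive (\<lambda>l. xf l * w)" "additive (\<lambda>l. dxf l * w)"
    by (simp_all add: additive_def xf_add dxf_add algebra_simps)
  note this[THEN additive_expansion, of l]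
  moreover have "(\<Sum>b\<in>set bs. int_scale (coef l b) (xf b * w)) \<in> W i"
    by (intro int_mod.span_sum int_mod.span_scale xf_basis_W assms)
  moreover have "(\<Sum>b\<in>set bs. int_scale (coef l b) (dxf b * w)) \<in> W (i + 1)"
    by (intro int_mod.span_sum int_mod.span_scale dxf_basis_W assms)
  ultimately show "xf l * w \<in> W i" "dxf l * w \<in> W (i + 1)" by simp_all
qed

lemma one_W: "1 \<in> W 0"
proof -
  have "mon cs (\<lambda>_. 0, {}) = 1" for cs by (induction cs) (simp_all add: u_def)
  moreover have "e (\<lambda>_. 0, {}) \<in> E 0" by (intro imageI) (simp add: V_def)
  ultimately have "1 \<in> E 0" by simp
  then show ?thesis by (rule int_mod.span_base)
qed

lemma u_Omega: "u b n s \<in> Omega (if s then 1 else 0)"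
  using Omega_mult[OF Omega_pow[OF xf_in_Omega] dxf_in_Omega] Omega_pow[OF xf_in_Omega]
  by (auto simp: u_def)

lemma mon_Omega: "distinct cs \<Longrightarrow> mon cs (m, S) \<in> Omega (int (card (S \<inter> set cs)))"
proof (induction cs)
  case (Cons c cs)
  then have "u c (m c) (c \<in> S) * mon cs (m, S) \<in> Omega ((if c \<in> S then 1 else 0) + int (card (S \<inter> set cs)))"
    by (intro Omega_mult u_Omega) simp
  then show ?case using Cons.prems by (cases "c \<in> S") (simp_all add: Int_insert_right)
qed (simp add: Omega_1)

text \<open>Links the basis-free grading to monomials: the monomial span contains 1 and absorbs
  generators with the correct shift of degree, and conversely each monomial is homogeneous.\<close>

lemma Omega_eq_W: "Omega i = W i"
proof
  show "Omega i \<subseteq> W i"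
  proof
    fix w :: "'l forms" assume "w \<in> Omega i"
    then show "w \<in> W i"
      by (rule Omega_additive_image[where f = "\<lambda>w. w" and S = W, rotated -1])
        (rule one_W linear_W int_mod.subspace_span | assumption | simp add: additive_def)+
  qed
  have "e q \<in> Omega (int (card (snd q)))" if "q \<in> V" for q
  proof -
    obtain m S where q: "q = (m, S)" by (cases q)
    then have "S \<inter> set bs = S" using that by (auto simp: V_def)
    then show ?thesis using mon_Omega[OF distinct, of m S] q by simp
  qed
  then show "W i \<subseteq> Omega i"
    by (intro int_mod.span_minimal Omega_subspace) auto
qed

abbreviation "WV \<equiv> int_mod.span (e ` V)"

lemma W_subset: "W i \<subseteq> WV"
  by (rule int_mod.span_mono) auto

lemma e_W: "q \<in> V \<Longrightarrow> e q \<in> W (int (card (snd q)))"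
  by (intro int_mod.span_base imageI) simp

text \<open>Makes the span a left ideal; as it contains 1, it is the whole ring
  (\<open>WV_UNIV\<close>).\<close>

lemma mult_WV: "w \<in> WV \<Longrightarrow> a * w \<in> WV"
proof (induction a arbitrary: w rule: forms_basis_induct)
  case (xf b)
  have "xf b * e q \<in> WV" if "q \<in> V" for q
    using xf_basis_W[OF xf(1) e_W[OF that]] by (rule subsetD[OF W_subset])
  then show ?case
    by (intro span_additive_image[OF xf(2) additive_mult_left]) auto
next
  case (dxf b)
  have "dxf b * e q \<in> WV" if "q \<in> V" for q
    using dxf_basis_W[OF dxf(1) e_W[OF that]] by (rule subsetD[OF W_subset])
  then show ?case
    by (intro span_additive_image[OF dxf(2) additive_mult_left]) auto
next
  case (mult a b)
  then show ?case by (simp add: mult.assoc)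
qed (auto simp: algebra_simps int_mod.span_zero int_mod.span_neg intro: int_mod.span_add)

lemma WV_UNIV: "w \<in> WV"
  using mult_WV[OF subsetD[OF W_subset one_W], of w] by simp

lemma additive_eqI:
  "additive f \<Longrightarrow> additive g \<Longrightarrow> (\<And>q. q \<in> V \<Longrightarrow> f (e q) = g (e q)) \<Longrightarrow> f w = g w"
  by (rule span_additive_eq[OF WV_UNIV]) auto

lemma Omega_additive:
  assumes "w \<in> Omega i" "additive f" "int_mod.subspace S"
    "\<And>q. q \<in> V \<Longrightarrow> int (card (snd q)) = i \<Longrightarrow> f (e q) \<in> S"
  shows "f w \<in> S"
  using assms by (intro span_additive_image[of w "E i" f S]) (auto simp: Omega_eq_W)

lemma e_Omega: "q \<in> V \<Longrightarrow> e q \<in> Omega (int (card (snd q)))"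
  unfolding Omega_eq_W by (rule e_W)

subsection \<open>Coordinates and linear extension\<close>

lemma coord_finite: "finite {q. coord w q \<noteq> 0}"
  using WV_UNIV[of w]
proof (induction rule: int_mod.span_induct_alt)
  case base
  then show ?case by (simp add: additive.zero[OF additive_coord])
next
  case (step c x y)
  then obtain q where "q \<in> V" "x = e q" by auto
  then have "{q'. coord (int_scale c x + y) q' \<noteq> 0} \<subseteq> insert q {q. coord y q \<noteq> 0}"
    by (auto simp: additive.add[OF additive_coord] additive_int_scale[OF additive_coord] coord_e)
  then show ?case using step finite_subset by blast
qed

text \<open>Serves for \<open>psi\<close> and \<open>htpy\<close>, which are prescribed on monomials
  and not by rules on ring expressions.\<close>

definition lin :: "('l idx \<Rightarrow> 'l forms) \<Rightarrow> 'l forms \<Rightarrow> 'l forms" where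
  "lin T w = (\<Sum>q | coord w q \<noteq> 0. of_int (coord w q) * T q)"

lemma lin_superset:
  assumes "finite A" "{q. coord w q \<noteq> 0} \<subseteq> A"
  shows "lin T w = (\<Sum>q\<in>A. of_int (coord w q) * T q)"
  unfolding lin_def using assms by (intro sum.mono_neutral_left) auto

lemma additive_lin: "additive (lin T)"
proof
  fix v w
  let ?A = "{q. coord v q \<noteq> 0} \<union> {q. coord w q \<noteq> 0}"
  have "lin T (v + w) = (\<Sum>q\<in>?A. of_int (coord (v + w) q) * T q)"
    by (rule lin_superset) (auto simp: coord_finite additive.add[OF additive_coord])
  also have "\<dots> = (\<Sum>q\<in>?A. of_int (coord v q) * T q) + (\<Sum>q\<in>?A. of_int (coord w q) * T q)"
    by (simp add: additive.add[OF additive_coord] ring_distribs sum.distrib)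
  also have "\<dots> = lin T v + lin T w"
    using lin_superset[of ?A v T] lin_superset[of ?A w T] by (simp add: coord_finite)
  finally show "lin T (v + w) = lin T v + lin T w" .
qed

lemma lin_e: "q \<in> V \<Longrightarrow> lin T (e q) = T q"
  by (simp add: lin_def coord_e)

text \<open>Coordinates are integers, hence torsion-free, and \<open>lin e\<close> recovers a form
  from its coordinates.\<close>

lemma forms_torsion_free:
  fixes w :: "'l forms"
  assumes "of_nat n * w = 0" "n > 0"
  shows "w = 0"
proof -
  have "int_scale (int n) w = 0" using assms(1) by (simp add: int_scale_eq_of_int_mult)
  then have "int n * coord w q = 0" for q
    using additive_int_scale[OF additive_coord[of q], of "int n" w]
    by (simp add: int_scale_eq_of_int_mult additive.zero[OF additive_coord])
  then have "lin e w = 0" using assms(2) by (simp add: lin_def)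
  moreover have "lin e w = w"
    by (rule additive_eqI[OF additive_lin]) (simp_all add: additive_def lin_e)
  ultimately show ?thesis by simp
qed

end

section \<open>The lift of the inverse Cartier map\<close>

text \<open>Needed for the relation that dx_l squares to zero, since \<open>frob\<close> sends dx_l
  to a sum over the basis.\<close>

lemma sum_anticommuting_sq:
  fixes Y :: "'b \<Rightarrow> 'a::ring_1"
  assumes "finite A" "\<And>b c. b \<in> A \<Longrightarrow> c \<in> A \<Longrightarrow> Y b * Y c = - (Y c * Y b)" "\<And>b. b \<in> A \<Longrightarrow> Y b * Y b = 0"
  shows "(\<Sum>b\<in>A. Y b) * (\<Sum>b\<in>A. Y b) = 0"
  using assms
proof (induction A rule: finite_induct)
  case (insert a A)
  let ?r = "\<Sum>b\<in>A. Y b"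
  have "Y a * ?r = (\<Sum>b\<in>A. - (Y b * Y a))"
    unfolding sum_distrib_left by (rule sum.cong[OF HOL.refl]) (use insert.prems(1) in blast)
  also have "\<dots> = - (?r * Y a)" by (simp add: sum_negf sum_distrib_right)
  finally have "Y a * ?r = - (?r * Y a)" .
  moreover have "?r * ?r = 0" by (rule insert.IH) (use insert.prems in blast)+
  moreover have "Y a * Y a = 0" by (rule insert.prems(2)) simp
  ultimately show ?case
    unfolding sum.insert[OF insert.hyps] by (simp only: ring_distribs) simp
qed simp

lemma of_nat_left_commute: "x * (of_nat n * y) = of_nat n * (x * y)" for x y :: "'a::ring_1"
  by (metis mult.assoc mult_of_nat_commute)

lemma xf_pow_left_commute: "a * (xf l ^ n * b) = xf l ^ n * (a * b)"
proof -
  have "a * (xf l ^ n * b) = a * xf l ^ n * b" by (rule mult.assoc[symmetric])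
  also have "a * xf l ^ n = xf l ^ n * a" by (rule xf_pow_central[symmetric])
  also have "\<dots> * b = xf l ^ n * (a * b)" by (rule mult.assoc)
  finally show ?thesis .
qed

locale cartier = based_lattice bs for bs :: "'l::ab_group_add list" +
  fixes p :: nat
  assumes prime: "prime p"
begin

lemma p_pos: "p > 0"
  using prime by (rule prime_gt_0_nat)

text \<open>The integral form d(x_b^p)/p.\<close>

definition dxp :: "'l \<Rightarrow> 'l forms" where
  "dxp b = xf b ^ (p - 1) * dxf b"

text \<open>For general \<open>l\<close> the image of x_l is the combination of the x_b^p with the
  coordinates of \<open>l\<close>, which keeps the map additive in \<open>l\<close>; it is not
  x_l^p.\<close>

definition frob :: "'l forms \<Rightarrow> 'l forms" where
  "frob w = expr_eval (\<lambda>l. \<Sum>b\<in>set bs. of_int (coef l b) * xf b ^ p)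
     (\<lambda>l. \<Sum>b\<in>set bs. of_int (coef l b) * dxp b) (rep_forms w)"

lemma dxp_mult: "dxp b * dxp c = xf b ^ (p - 1) * (xf c ^ (p - 1) * (dxf b * dxf c))"
  unfolding dxp_def by (simp only: mult.assoc xf_pow_left_commute[of "dxf b"])

lemma dxp_dxp: "dxp b * dxp c = - (dxp c * dxp b)"
  unfolding dxp_mult xf_pow_left_commute[of "xf b ^ (p - 1)" c] dxf_anticomm[of b c] by simp

lemma dxp_sq: "dxp b * dxp b = 0"
  by (simp add: dxp_mult dxf_sq)

lemma frob_abs:
  "frob (abs_forms t) = expr_eval (\<lambda>l. \<Sum>b\<in>set bs. of_int (coef l b) * xf b ^ p)
     (\<lambda>l. \<Sum>b\<in>set bs. of_int (coef l b) * dxp b) t"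
proof -
  have central: "(\<Sum>b\<in>set bs. of_int (coef l b) * xf b ^ p) * a =
      a * (\<Sum>b\<in>set bs. of_int (coef l b) * xf b ^ p)" for l a
  proof -
    have "of_int k * xf b ^ p * a = a * (of_int k * xf b ^ p)" for k b
      using xf_pow_central[of b p a] mult_of_int_commute[of k a] by (metis mult.assoc)
    then show ?thesis by (simp add: sum_distrib_left sum_distrib_right)
  qed
  have anti: "of_int k * dxp b * (of_int k' * dxp c) = of_int (k * k') * (dxp b * dxp c)" for k k' b c
    using mult_of_int_commute[of k' "dxp b"] by (simp add: mult.assoc) (metis mult.assoc)
  have anticomm: "of_int k * dxp b * (of_int k' * dxp c) = - (of_int k' * dxp c * (of_int k * dxp b))" for k k' b c
    unfolding anti using dxp_dxp[of b c] by (simp add: mult.commute)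
  have sq: "(\<Sum>b\<in>set bs. of_int (coef l b) * dxp b) * (\<Sum>b\<in>set bs. of_int (coef l b) * dxp b) = 0" for l
    by (rule sum_anticommuting_sq[OF finite_set anticomm]) (simp add: anti dxp_sq)
  have "form_eq (rep_forms (abs_forms t)) t"
    using Quotient3_abs_rep[OF Quotient3_forms] by (simp flip: forms.abs_eq_iff)
  then show ?thesis
    unfolding frob_def
    by (rule form_eq_eval[OF _ _ _ central central sq])
      (simp_all add: coef_add ring_distribs sum.distrib)
qed

lemma frob_simps:
  "frob 0 = 0" "frob 1 = 1" "frob (- v) = - frob v" "frob (v + w) = frob v + frob w"
  "frob (v * w) = frob v * frob w"
  "b \<in> set bs \<Longrightarrow> frob (xf b) = xf b ^ p" "b \<in> set bs \<Longrightarrow> frob (dxf b) = dxp b"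
proof -
  note ev = frob_abs
  show "frob 0 = 0" "frob 1 = 1"
    using ev[of EZero] ev[of EOne] by (simp_all add: abs_forms_simps)
  show "frob (- v) = - frob v"
    by (induct v rule: forms.abs_induct) (simp add: ev flip: abs_forms_simps)
  show "frob (v + w) = frob v + frob w"
    by (induct v rule: forms.abs_induct, induct w rule: forms.abs_induct)
      (simp add: ev flip: abs_forms_simps)
  show "frob (v * w) = frob v * frob w"
    by (induct v rule: forms.abs_induct, induct w rule: forms.abs_induct)
      (simp add: ev flip: abs_forms_simps)
  have delta: "(\<Sum>c\<in>set bs. of_int (coef b c) * Y c) = Y b" if "b \<in> set bs" for b and Y :: "'l \<Rightarrow> 'l forms"
  proof -
    have "(\<Sum>c\<in>set bs. of_int (coef b c) * Y c) = (\<Sum>c\<in>set bs. if c = b then Y c else 0)"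
      by (rule sum.cong[OF HOL.refl]) (simp add: coef_basis[OF that])
    then show ?thesis using that by simp
  qed
  show "frob (xf b) = xf b ^ p" "frob (dxf b) = dxp b" if "b \<in> set bs"
    using ev[of "EVar b"] ev[of "EDiff b"] delta[OF that] by (simp_all add: abs_forms_simps)
qed

lemma additive_frob: "additive frob"
  by unfold_locales (rule frob_simps)

lemma frob_pow: "frob (w ^ n) = frob w ^ n"
  by (induction n) (simp_all add: frob_simps)

text \<open>\<open>frob\<close> shows existence for the definite description, and induction over
  ring operations and basis generators shows uniqueness.\<close>

lemma frob_lift_eq: "frob_lift p (set bs) = frob"
  unfolding frob_lift_def
proof (rule the_equality)
  fix F :: "'l forms \<Rightarrow> 'l forms"
  assume F: "F 1 = 1 \<and> (\<forall>a b. F (a + b) = F a + F b) \<and> (\<forall>a b. F (a * b) = F a * F b) \<and>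
     (\<forall>b\<in>set bs. F (xf b) = xf b ^ p \<and> F (dxf b) = xf b ^ (p - 1) * dxf b)"
  have add: "additive F" using F by (simp add: additive_def)
  show "F = frob"
  proof
    fix w show "F w = frob w"
      by (induction w rule: forms_basis_induct)
        (use F in \<open>simp_all add: frob_simps dxp_def additive.zero[OF add] additive.minus[OF add]\<close>)
  qed
qed (simp add: frob_simps dxp_def)

lemma grade_inv_pow: "grade_inv (w ^ n) = grade_inv w ^ n"
  by (induction n) simp_all

lemma ext_d_xf_pow: "ext_d (xf l ^ n) = of_nat n * (xf l ^ (n - 1) * dxf l)"
proof (induction n)
  case (Suc n)
  have "dxf l * xf l ^ n = xf l ^ n * dxf l" by (simp add: xf_pow_central)
  moreover have "xf l * (of_nat n * (xf l ^ (n - 1) * dxf l)) = of_nat n * (xf l ^ n * dxf l)"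
    unfolding of_nat_left_commute by (cases n) (simp_all add: mult.assoc del: of_nat_Suc)
  ultimately show ?case by (simp add: Suc ring_distribs)
qed simp

lemma grade_inv_frob: "grade_inv (frob w) = frob (grade_inv w)"
  by (induction w rule: forms_basis_induct) (simp_all add: frob_simps grade_inv_pow dxp_def)

text \<open>On generators this is d(x_b^p) = p x_b^(p-1) dx_b and d(x_b^(p-1) dx_b) = 0; the Leibniz
  rule carries it to products, because \<open>frob\<close> respects the grading
  automorphism.\<close>

lemma ext_d_frob: "ext_d (frob w) = of_nat p * frob (ext_d w)"
proof (induction w rule: forms_basis_induct)
  case (mult a b)
  have "grade_inv (frob a) * (of_nat p * frob (ext_d b)) = of_nat p * (frob (grade_inv a) * frob (ext_d b))"
    by (simp add: grade_inv_frob mult_of_nat_commute[of p "frob (grade_inv a)"] flip: mult.assoc)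
  with mult show ?case by (simp add: frob_simps ring_distribs mult.assoc)
next
  case (xf b)
  then show ?case by (simp add: frob_simps ext_d_xf_pow dxp_def)
next
  case (dxf b)
  have "ext_d (dxp b) = 0"
    by (simp add: dxp_def ext_d_xf_pow mult.assoc dxf_sq)
  with dxf show ?case by (simp add: frob_simps)
qed (simp_all add: frob_simps ring_distribs)

lemma frob_u:
  assumes "b \<in> set bs" "s \<Longrightarrow> n > 0"
  shows "frob (u b n s) = u b (p * n) s"
proof (cases s)
  case True
  then obtain k where n: "n = Suc k" using assms(2) by (cases n) auto
  have "(xf b ^ p) ^ k * (xf b ^ (p - 1) * dxf b) = xf b ^ (p * n - 1) * dxf b"
  proof -
    have "p * n - 1 = p * k + (p - 1)" using p_pos by (simp add: n)
    then show ?thesis by (simp add: power_add power_mult mult.assoc)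
  qed
  then show ?thesis using True assms(1) by (simp add: u_def frob_simps frob_pow dxp_def n)
qed (use assms in \<open>simp add: u_def frob_pow frob_simps power_mult\<close>)

lemma frob_mon:
  assumes "set cs \<subseteq> set bs" "\<And>b. b \<in> S \<Longrightarrow> m b > 0"
  shows "frob (mon cs (m, S)) = mon cs (\<lambda>b. p * m b, S)"
  using assms(1) by (induction cs) (simp_all add: frob_simps frob_u assms(2))

lemma frob_e:
  assumes "(m, S) \<in> V"
  shows "frob (e (m, S)) = e (\<lambda>b. p * m b, S)" and "(\<lambda>b. p * m b, S) \<in> V"
  using assms p_pos by (auto simp: V_def intro!: frob_mon)

lemma frob_Omega:
  assumes "w \<in> Omega i"
  shows "frob w \<in> Omega i"
proof (rule Omega_additive[OF assms additive_frob Omega_subspace])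
  fix q assume q: "q \<in> V" "int (card (snd q)) = i"
  obtain m S where "q = (m, S)" by (cases q)
  with q frob_e[of m S] e_Omega[of "(\<lambda>b. p * m b, S)"] show "frob (e q) \<in> Omega i" by simp
qed

section \<open>Multidegrees and the homotopy\<close>

text \<open>The piece of multidegree \<open>m\<close>, with all form degrees together.\<close>

definition Wm :: "('l \<Rightarrow> nat) \<Rightarrow> 'l forms set" where
  "Wm m = int_mod.span {e (m, S) | S. (m, S) \<in> V}"

lemma ext_d_u: "\<exists>k::int. ext_d (u c n s) = of_int k * u c n True \<and> (n = 0 \<or> s \<longrightarrow> k = 0)"
proof (cases s)
  case True
  then have "ext_d (u c n s) = 0"
    by (simp add: u_def ext_d_xf_pow mult.assoc dxf_sq)
  then show ?thesis by (intro exI[of _ 0]) simp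
next
  case False
  then show ?thesis by (intro exI[of _ "int n"]) (simp add: u_def ext_d_xf_pow)
qed

lemma grade_inv_u: "grade_inv (u c n s) = (if s then - u c n s else u c n s)"
  by (simp add: u_def grade_inv_pow)

text \<open>Differentiating a factor replaces x_c^n by n x_c^n dlog x_c and keeps the exponent.
  Signs and coefficients are left inside the span.\<close>

lemma ext_d_mon:
  assumes "distinct cs" "\<And>b. b \<in> S \<Longrightarrow> m b > 0"
  shows "ext_d (mon cs (m, S)) \<in> int_mod.span {mon cs (m, S') | S'. \<forall>b\<in>S'. m b > 0}"
  using assms(1)
proof (induction cs)
  case (Cons c cs)
  let ?D = "int_mod.span {mon (c # cs) (m, S') | S'. \<forall>b\<in>S'. m b > 0}"
  have "ext_d (u c (m c) (c \<in> S)) * mon cs (m, S) \<in> ?D"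
  proof -
    obtain k :: int where k: "ext_d (u c (m c) (c \<in> S)) = of_int k * u c (m c) True"
      "m c = 0 \<or> c \<in> S \<longrightarrow> k = 0" using ext_d_u by blast
    show ?thesis
    proof (cases "k = 0")
      case False
      have "mon cs (m, S) = mon cs (m, insert c S)"
        using Cons.prems by (intro mon_cong) auto
      then have eq: "ext_d (u c (m c) (c \<in> S)) * mon cs (m, S) = int_scale k (mon (c # cs) (m, insert c S))"
        by (simp add: k(1) int_scale_eq_of_int_mult mult.assoc)
      have "\<forall>b\<in>insert c S. m b > 0" using False k(2) assms(2) by auto
      then show ?thesis
        unfolding eq by (intro int_mod.span_scale int_mod.span_base) blast
    qed (simp add: k(1) int_mod.span_zero)
  qed
  moreover have "grade_inv (u c (m c) (c \<in> S)) * ext_d (mon cs (m, S)) \<in> ?D"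
  proof (rule span_additive_image[OF _ additive_mult_left])
    show "ext_d (mon cs (m, S)) \<in> int_mod.span {mon cs (m, S') | S'. \<forall>b\<in>S'. m b > 0}"
      using Cons by simp
    fix g assume "g \<in> {mon cs (m, S') | S'. \<forall>b\<in>S'. m b > 0}"
    then obtain S' where S': "g = mon cs (m, S')" "\<forall>b\<in>S'. m b > 0" by blast
    \<comment> \<open>\<open>c\<close> does not occur in \<open>cs\<close>, so its membership can be
      adjusted to agree with \<open>S\<close> without changing \<open>g\<close>.\<close>
    define S'' where "S'' = (if c \<in> S then insert c S' else S' - {c})"
    have "g = mon cs (m, S'')"
      unfolding S'(1) using Cons.prems by (intro mon_cong) (auto simp: S''_def)
    then have "u c (m c) (c \<in> S) * g = mon (c # cs) (m, S'')"
      by (simp add: S''_def)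
    moreover have "\<forall>b\<in>S''. m b > 0" using S'(2) assms(2) by (auto simp: S''_def)
    ultimately have D: "u c (m c) (c \<in> S) * g \<in> ?D" by (intro int_mod.span_base) blast
    then show "grade_inv (u c (m c) (c \<in> S)) * g \<in> ?D"
      using int_mod.span_neg[OF D] unfolding grade_inv_u by (cases "c \<in> S") simp_all
  qed simp
  ultimately show ?case by (simp add: int_mod.span_add)
qed (simp add: int_mod.span_zero)

lemma ext_d_e:
  assumes "(m, S) \<in> V"
  shows "ext_d (e (m, S)) \<in> Wm m"
proof -
  have "{e (m, S') | S'. \<forall>b\<in>S'. m b > 0} \<subseteq> {e (m, S) | S. (m, S) \<in> V}"
    using assms by (auto simp: V_def)
  then have "int_mod.span {e (m, S') | S'. \<forall>b\<in>S'. m b > 0} \<subseteq> Wm m"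
    unfolding Wm_def by (rule int_mod.span_mono)
  moreover have "ext_d (e (m, S)) \<in> int_mod.span {e (m, S') | S'. \<forall>b\<in>S'. m b > 0}"
    using assms by (intro ext_d_mon distinct) (auto simp: V_def)
  ultimately show ?thesis by blast
qed

text \<open>Contraction with the Euler field \<open>x\<^sub>b \<partial>/\<partial>x\<^sub>b\<close>.\<close>

definition euler :: "'l \<Rightarrow> 'l forms \<Rightarrow> 'l forms" where
  "euler b = contr (\<lambda>l. of_int (coef l b) * xf b)"

lemma euler_contraction: "contraction (\<lambda>l. of_int (coef l b) * xf b)"
proof
  fix l m and a :: "'l forms"
  show "of_int (coef (l + m) b) * xf b = of_int (coef l b) * xf b + of_int (coef m b) * xf b"
    by (simp add: coef_add ring_distribs)
  show "of_int (coef l b) * xf b * a = a * (of_int (coef l b) * xf b)"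
    using xf_central[of b a] mult_of_int_commute[of "coef l b" a] by (metis mult.assoc)
  have "grade_inv (of_int k :: 'l forms) = of_int k" for k
  proof -
    have "grade_inv (int_scale k 1 :: 'l forms) = int_scale k (grade_inv 1)"
      by (rule additive_int_scale[OF additive_grade_inv])
    then show ?thesis by (simp add: int_scale_eq_of_int_mult)
  qed
  then show "grade_inv (of_int (coef l b) * xf b) = of_int (coef l b) * xf b" by simp
qed

lemma additive_euler: "additive (euler b)"
  unfolding euler_def by (rule contraction.additive_contr[OF euler_contraction])

lemma euler_Omega: "w \<in> Omega i \<Longrightarrow> euler b w \<in> Omega (i - 1)"
  unfolding euler_def
  by (rule contraction.contr_Omega[OF euler_contraction]) (simp add: Omega_scale xf_in_Omega)

text \<open>The Lie derivative along the Euler field fixes x_b and dx_b and kills the other basis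
  generators; as a derivation it counts the exponent of \<open>b\<close>. The case distinction on
  \<open>b\<close> lets the induction run over partial lists.\<close>

lemma lie_mon:
  assumes "b \<in> set bs" "distinct cs" "set cs \<subseteq> set bs" "\<And>c. c \<in> S \<Longrightarrow> m c > 0"
  shows "ext_d (euler b (mon cs (m, S))) + euler b (ext_d (mon cs (m, S))) =
    of_nat (if b \<in> set cs then m b else 0) * mon cs (m, S)"
proof -
  interpret contraction "\<lambda>l. of_int (coef l b) * xf b" by (rule euler_contraction)
  have lie_b: "lie (xf c) = (if c = b then xf c else 0)" "lie (dxf c) = (if c = b then dxf c else 0)"
    if "c \<in> set bs" for c
    using coef_basis[OF that, of b] by (auto simp: lie_xf lie_dxf)
  have pow: "lie (xf c ^ n) = (if c = b then of_nat n * xf c ^ n else 0)" if "c \<in> set bs" for c n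
  proof (induction n)
    case (Suc n)
    have "xf c * (of_nat n * xf c ^ n) = of_nat n * (xf c * xf c ^ n)"
      using mult_of_nat_commute[of n "xf c"] by (metis mult.assoc)
    with Suc show ?case by (auto simp: lie_mult lie_b[OF that] ring_distribs)
  qed (simp add: lie_def)
  have lie_u: "lie (u c n s) = (if c = b then of_nat n * u c n s else 0)"
    if c: "c \<in> set bs" and pos: "s \<Longrightarrow> n > 0" for c n s
  proof (cases s)
    case True
    with pos obtain k where n: "n = Suc k" by (cases n) auto
    show ?thesis
    proof (cases "c = b")
      case cb: True
      have "lie (xf c ^ k * dxf c) = of_nat (Suc k) * (xf c ^ k * dxf c)"
        using cb by (simp add: lie_mult lie_b[OF assms(1)] pow[OF assms(1)] ring_distribs mult.assoc)
      then show ?thesis using True cb by (simp add: u_def n)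
    next
      case False
      then show ?thesis using True by (simp add: u_def n lie_mult lie_b[OF c] pow[OF c])
    qed
  qed (use pow[OF c] in \<open>simp add: u_def\<close>)
  have "lie (mon cs (m, S)) = of_nat (if b \<in> set cs then m b else 0) * mon cs (m, S)"
    using assms(2,3)
  proof (induction cs)
    case (Cons c cs)
    have c: "c \<in> set bs" "c \<notin> set cs" using Cons.prems by auto
    have IH: "lie (mon cs (m, S)) = of_nat (if b \<in> set cs then m b else 0) * mon cs (m, S)"
      using Cons by simp
    show ?case
    proof (cases "c = b")
      case True
      then show ?thesis
        using c assms(4) by (simp add: lie_mult lie_u[OF assms(1)] IH mult.assoc)
    next
      case False
      have "lie (mon (c # cs) (m, S)) = u c (m c) (c \<in> S) * (of_nat (if b \<in> set cs then m b else 0) * mon cs (m, S))"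
        using False assms(4) by (simp only: mon_Cons lie_mult IH) (simp add: lie_u[OF c(1)])
      also have "\<dots> = of_nat (if b \<in> set cs then m b else 0) * mon (c # cs) (m, S)"
        unfolding mon_Cons by (rule of_nat_left_commute)
      finally show ?thesis using False by simp
    qed
  qed (simp add: lie_def)
  then show ?thesis by (simp add: lie_def euler_def)
qed

text \<open>The choice depends on \<open>m\<close> and not on \<open>S\<close>, so a single
  contraction serves a whole multidegree; this is what lets the homotopy interact with d.\<close>

definition nondiv :: "('l \<Rightarrow> nat) \<Rightarrow> 'l" where
  "nondiv m = (SOME b. \<not> p dvd m b)"

text \<open>An inverse modulo p of the chosen exponent, available by Bezout.\<close>

definition nondiv_inv :: "('l \<Rightarrow> nat) \<Rightarrow> int" where
  "nondiv_inv m = (SOME k. \<exists>j. k * int (m (nondiv m)) = 1 + int p * j)"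

lemma nondiv:
  assumes "\<not> (\<forall>b. p dvd m b)"
  shows "\<not> p dvd m (nondiv m)" and "\<exists>j. nondiv_inv m * int (m (nondiv m)) = 1 + int p * j"
proof -
  show *: "\<not> p dvd m (nondiv m)"
    unfolding nondiv_def using assms by (intro someI_ex[of "\<lambda>b. \<not> p dvd m b"]) blast
  have "coprime (int p) (int (m (nondiv m)))"
    using prime_imp_coprime[OF prime *] by simp
  then obtain x y where "x * int p + y * int (m (nondiv m)) = 1"
    using bezout_int[of "int p" "int (m (nondiv m))"] by (metis coprime_iff_gcd_eq_1)
  then have "y * int (m (nondiv m)) = 1 + int p * (- x)" by (simp add: algebra_simps)
  then have "\<exists>k j. k * int (m (nondiv m)) = 1 + int p * j" by blast
  then show "\<exists>j. nondiv_inv m * int (m (nondiv m)) = 1 + int p * j"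
    unfolding nondiv_inv_def by (rule someI_ex)
qed

text \<open>\<open>psi\<close> inverts the lift of the inverse Cartier map and kills the other multidegrees;
  \<open>htpy\<close> contracts the multidegrees that are not divisible by \<open>p\<close>.\<close>

definition psi :: "'l forms \<Rightarrow> 'l forms" where
  "psi = lin (\<lambda>(m, S). if \<forall>b. p dvd m b then e (\<lambda>b. m b div p, S) else 0)"

definition htpy :: "'l forms \<Rightarrow> 'l forms" where
  "htpy = lin (\<lambda>(m, S). if \<forall>b. p dvd m b then 0
     else of_int (nondiv_inv m) * euler (nondiv m) (e (m, S)))"

lemma additive_psi: "additive psi" and additive_htpy: "additive htpy"
  by (simp_all add: psi_def htpy_def additive_lin)

lemma psi_e:
  "(m, S) \<in> V \<Longrightarrow> psi (e (m, S)) = (if \<forall>b. p dvd m b then e (\<lambda>b. m b div p, S) else 0)"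
  by (simp add: psi_def lin_e)

lemma htpy_e:
  "(m, S) \<in> V \<Longrightarrow> htpy (e (m, S)) =
    (if \<forall>b. p dvd m b then 0 else of_int (nondiv_inv m) * euler (nondiv m) (e (m, S)))"
  by (simp add: htpy_def lin_e)

lemma div_V:
  assumes "(m, S) \<in> V" "\<forall>b. p dvd m b"
  shows "(\<lambda>b. m b div p, S) \<in> V" and "frob (e (\<lambda>b. m b div p, S)) = e (m, S)"
proof -
  have pos: "m b div p > 0 \<longleftrightarrow> m b > 0" for b
    using assms(2) p_pos by (metis dvd_div_eq_0_iff gr0I not_less_zero)
  then show 1: "(\<lambda>b. m b div p, S) \<in> V" using assms(1) by (simp add: V_def)
  have "(\<lambda>b. p * (m b div p)) = m" using assms(2) by simp
  then show "frob (e (\<lambda>b. m b div p, S)) = e (m, S)" using frob_e(1)[OF 1] by simp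
qed

lemma psi_frob: "psi (frob w) = w"
proof (rule additive_eqI)
  show "additive (\<lambda>w. psi (frob w))" by (rule additive_comp[OF additive_psi additive_frob])
  fix q assume q: "q \<in> V"
  obtain m S where [simp]: "q = (m, S)" by (cases q)
  show "psi (frob (e q)) = e q"
    using q p_pos frob_e[of m S] by (simp add: psi_e)
qed (simp add: additive_def)

lemma psi_Omega:
  assumes "w \<in> Omega i"
  shows "psi w \<in> Omega i"
proof (rule Omega_additive[OF assms additive_psi Omega_subspace])
  fix q assume q: "q \<in> V" "int (card (snd q)) = i"
  obtain m S where [simp]: "q = (m, S)" by (cases q)
  show "psi (e q) \<in> Omega i"
    using q div_V(1)[of m S] e_Omega[of "(\<lambda>b. m b div p, S)"] by (simp add: psi_e Omega_0)
qed

lemma htpy_Omega: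
  assumes "w \<in> Omega i"
  shows "htpy w \<in> Omega (i - 1)"
proof (rule Omega_additive[OF assms additive_htpy Omega_subspace])
  fix q assume q: "q \<in> V" "int (card (snd q)) = i"
  obtain m S where [simp]: "q = (m, S)" by (cases q)
  have "euler (nondiv m) (e q) \<in> Omega (i - 1)"
    using euler_Omega[OF e_Omega[OF q(1)]] q(2) by simp
  then show "htpy (e q) \<in> Omega (i - 1)"
    using q by (simp add: htpy_e Omega_0 Omega_scale)
qed

lemma psi_Wm:
  assumes "\<not> (\<forall>b. p dvd m b)" "w \<in> Wm m"
  shows "psi w = 0"
proof (rule span_additive_eq[OF assms(2)[unfolded Wm_def] additive_psi])
  fix x assume "x \<in> {e (m, S) | S. (m, S) \<in> V}"
  then obtain S where S: "(m, S) \<in> V" "x = e (m, S)" by blast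
  show "psi x = 0" unfolding S(2) psi_e[OF S(1)] by (rule if_not_P[OF assms(1)])
qed (simp add: additive_def)

text \<open>Extends the rule from monomials to the whole multidegree, as required for evaluating
  \<open>htpy\<close> on the differential of a monomial.\<close>

lemma htpy_Wm:
  assumes "w \<in> Wm m"
  shows "(\<forall>b. p dvd m b) \<Longrightarrow> htpy w = 0"
    and "\<not> (\<forall>b. p dvd m b) \<Longrightarrow> htpy w = of_int (nondiv_inv m) * euler (nondiv m) w"
proof -
  assume m: "\<forall>b. p dvd m b"
  show "htpy w = 0"
  proof (rule span_additive_eq[OF assms[unfolded Wm_def] additive_htpy])
    fix x assume "x \<in> {e (m, S) | S. (m, S) \<in> V}"
    then obtain S where S: "(m, S) \<in> V" "x = e (m, S)" by blast
    show "htpy x = 0" unfolding S(2) htpy_e[OF S(1)] by (rule if_P[OF m])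
  qed (simp add: additive_def)
next
  assume m: "\<not> (\<forall>b. p dvd m b)"
  show "htpy w = of_int (nondiv_inv m) * euler (nondiv m) w"
  proof (rule span_additive_eq[OF assms[unfolded Wm_def] additive_htpy])
    show "additive (\<lambda>w. of_int (nondiv_inv m) * euler (nondiv m) w)"
      by (rule additive_comp[OF additive_mult_left additive_euler])
    fix x assume "x \<in> {e (m, S) | S. (m, S) \<in> V}"
    then obtain S where S: "(m, S) \<in> V" "x = e (m, S)" by blast
    show "htpy x = of_int (nondiv_inv m) * euler (nondiv m) x"
      unfolding S(2) htpy_e[OF S(1)] by (rule if_not_P[OF m])
  qed
qed

text \<open>If p divides the exponents, the monomial is \<open>frob\<close> of another one and
  \<open>ext_d_frob\<close> applies. Otherwise both sides vanish, because d preserves the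
  multidegree.\<close>

lemma psi_ext_d: "psi (ext_d w) = of_nat p * ext_d (psi w)"
proof (rule additive_eqI[where f = "\<lambda>w. psi (ext_d w)" and g = "\<lambda>w. of_nat p * ext_d (psi w)"])
  show "additive (\<lambda>w. psi (ext_d w))" by (rule additive_comp[OF additive_psi additive_ext_d])
  show "additive (\<lambda>w. of_nat p * ext_d (psi w))"
    by (rule additive_comp[OF additive_mult_left additive_comp[OF additive_ext_d additive_psi]])
  fix q assume q: "q \<in> V"
  obtain m S where [simp]: "q = (m, S)" by (cases q)
  show "psi (ext_d (e q)) = of_nat p * ext_d (psi (e q))"
  proof (cases "\<forall>b. p dvd m b")
    case True
    let ?e = "e (\<lambda>b. m b div p, S)"
    have "ext_d (e q) = of_nat p * frob (ext_d ?e)"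
      using div_V(2)[of m S] q True ext_d_frob[of ?e] by simp
    also have "psi \<dots> = of_nat p * ext_d ?e"
      using additive_int_scale[OF additive_psi, of "int p" "frob (ext_d ?e)"]
      by (simp add: psi_frob int_scale_eq_of_int_mult)
    also have "?e = psi (e q)" using q True by (simp add: psi_e)
    finally show ?thesis .
  next
    case False
    have "psi (e q) = 0" using q unfolding \<open>q = (m, S)\<close> by (subst psi_e) (simp_all only: if_not_P[OF False])
    moreover have "psi (ext_d (e q)) = 0" using q by (intro psi_Wm[OF False]) (simp add: ext_d_e)
    ultimately show ?thesis by simp
  qed
qed

text \<open>The congruence modulo p in integral form. The error is kept in degree \<open>i\<close>,
  since it becomes part of the witness \<open>\<alpha>\<close> for surjectivity.\<close>

lemma homotopy:
  assumes "w \<in> Omega i"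
  shows "\<exists>y\<in>Omega i. w = of_nat p * y + ext_d (htpy w) + htpy (ext_d w) + frob (psi w)"
proof -
  define R where "R w = w - (ext_d (htpy w) + htpy (ext_d w) + frob (psi w))" for w
  have "additive R"
    unfolding R_def
    by (intro additive_minus additive_plus additive_comp[OF additive_ext_d additive_htpy]
        additive_comp[OF additive_htpy additive_ext_d] additive_comp[OF additive_frob additive_psi])
      (simp add: additive_def)
  have S: "int_mod.subspace {of_nat p * y | y. y \<in> Omega i}" for i
  proof -
    have eq: "{of_nat p * y | y. y \<in> Omega i} = (\<lambda>y. of_nat p * y) ` Omega i" by blast
    show ?thesis
      unfolding eq
    proof (rule int_mod.subspaceI)
      show "0 \<in> (\<lambda>y. of_nat p * y) ` Omega i" using Omega_0[of i] by force
      show "x + y \<in> (\<lambda>y. of_nat p * y) ` Omega i"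
        if "x \<in> (\<lambda>y. of_nat p * y) ` Omega i" "y \<in> (\<lambda>y. of_nat p * y) ` Omega i" for x y
        using that by (auto simp: ring_distribs(1)[symmetric] Omega_add)
      show "int_scale c x \<in> (\<lambda>y. of_nat p * y) ` Omega i" if "x \<in> (\<lambda>y. of_nat p * y) ` Omega i" for c x
      proof -
        from that obtain y where y: "y \<in> Omega i" "x = of_nat p * y" by blast
        have "int_scale c x = of_nat p * (of_int c * y)"
          by (simp only: y(2) int_scale_eq_of_int_mult of_nat_left_commute)
        then show ?thesis using Omega_scale[OF y(1)] by blast
      qed
    qed
  qed
  \<comment> \<open>\<open>R\<close> is additive and the p-multiples of forms of degree
    \<open>i\<close> are a subgroup, so monomials suffice.\<close>
  have "R w \<in> {of_nat p * y | y. y \<in> Omega i}"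
  proof (rule Omega_additive[OF assms \<open>additive R\<close> S])
    fix q assume q: "q \<in> V" "int (card (snd q)) = i"
    obtain m S where mS [simp]: "q = (m, S)" by (cases q)
    have dW: "ext_d (e (m, S)) \<in> Wm m" using q by (intro ext_d_e) simp
    show "R (e q) \<in> {of_nat p * y | y. y \<in> Omega i}"
    proof (cases "\<forall>b. p dvd m b")
      case True
      \<comment> \<open>In a multidegree divisible by p both homotopy terms vanish and
        \<open>frob\<close> after \<open>psi\<close> is the identity on the monomial.\<close>
      then have "R (e q) = of_nat p * 0"
        using q htpy_Wm(1)[OF dW True] div_V(2)[of m S] by (simp add: R_def htpy_e psi_e)
      then show ?thesis using Omega_0 by blast
    next
      case False
      let ?b = "nondiv m" and ?k = "nondiv_inv m"
      obtain j where j: "?k * int (m ?b) = 1 + int p * j" using nondiv(2)[OF False] by blast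
      have "m ?b > 0" using nondiv(1)[OF False] by (cases "m ?b") auto
      then have b: "?b \<in> set bs" using q by (auto simp: V_def)
      have d: "ext_d (of_int ?k * euler ?b (e q)) = of_int ?k * ext_d (euler ?b (e q))"
        using additive_int_scale[OF additive_ext_d, of ?k "euler ?b (e q)"] by (simp add: int_scale_eq_of_int_mult)
      have h: "htpy (e q) = of_int ?k * euler ?b (e q)"
        unfolding mS htpy_e[OF q(1)[unfolded mS]] by (rule if_not_P[OF False])
      have hd: "htpy (ext_d (e q)) = of_int ?k * euler ?b (ext_d (e q))"
        unfolding mS by (rule htpy_Wm(2)[OF dW False])
      have pos: "m c > 0" if "c \<in> S" for c using that q by (auto simp: V_def)
      \<comment> \<open>Cartan's formula gives \<open>m ?b\<close> times the monomial; the factor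
        \<open>?k\<close> turns this into the monomial plus p\<open>j\<close> times itself, so the
        error witness is -\<open>j\<close> times the monomial.\<close>
      have "ext_d (htpy (e q)) + htpy (ext_d (e q)) =
          of_int ?k * (ext_d (euler ?b (e q)) + euler ?b (ext_d (e q)))"
        unfolding h hd d by (simp only: ring_distribs)
      also have "\<dots> = of_int ?k * (of_nat (m ?b) * e q)"
        using lie_mon[OF b distinct order_refl pos] b by simp
      also have "\<dots> = of_int (?k * int (m ?b)) * e q" by (simp add: mult.assoc)
      also have "\<dots> = e q + of_nat p * (of_int j * e q)"
        unfolding j by (simp add: ring_distribs mult.assoc)
      finally have "ext_d (htpy (e q)) + htpy (ext_d (e q)) = e q + of_nat p * (of_int j * e q)" .
      moreover have "psi (e q) = 0" unfolding mS psi_e[OF q(1)[unfolded mS]] by (rule if_not_P[OF False])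
      ultimately have "R (e q) = of_nat p * (of_int (- j) * e q)"
        unfolding R_def by (simp add: frob_simps)
      moreover have "of_int (- j) * e q \<in> Omega i"
        using e_Omega[OF q(1)] q(2) by (intro Omega_scale) simp
      ultimately show ?thesis by blast
    qed
  qed
  then show ?thesis by (auto simp: R_def algebra_simps)
qed

end

section \<open>The Bockstein spectral sequence of the de Rham complex\<close>

lemma deRham_simps [simp]:
  "carrier (grp deRham i) = Omega i" "x \<otimes>\<^bsub>grp deRham i\<^esub> y = x + y" "\<one>\<^bsub>grp deRham i\<^esub> = 0"
  "diff deRham i = ext_d"
  by (simp_all add: deRham_def)

lemma deRham_pow [simp]: "x [^]\<^bsub>grp deRham i\<^esub> (n::nat) = of_nat n * x"
proof (induction n)
  case 0
  have "x [^]\<^bsub>grp deRham i\<^esub> (0::nat) = \<one>\<^bsub>grp deRham i\<^esub>" by (simp add: nat_pow_def)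
  then show ?case by simp
next
  case (Suc n)
  have "x [^]\<^bsub>grp deRham i\<^esub> Suc n = x [^]\<^bsub>grp deRham i\<^esub> n \<otimes>\<^bsub>grp deRham i\<^esub> x"
    by (simp add: nat_pow_def)
  then show ?case by (simp add: Suc ring_distribs add.commute)
qed

lemma cochain_deRham: "cochain_complex (deRham :: 'l::ab_group_add forms cochain)"
proof -
  have "comm_group (grp (deRham :: 'l forms cochain) i)" for i
  proof (rule comm_groupI)
    fix x :: "'l forms" assume "x \<in> carrier (grp deRham i)"
    then show "\<exists>y\<in>carrier (grp deRham i). y \<otimes>\<^bsub>grp deRham i\<^esub> x = \<one>\<^bsub>grp deRham i\<^esub>"
      by (intro bexI[of _ "- x"]) (simp_all add: Omega_neg)
  qed (simp_all add: Omega_add Omega_0 add_ac)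
  then show ?thesis
    by (auto simp: cochain_complex_def hom_def Omega_ext_d ext_d_ext_d)
qed

context cartier
begin

lemma frobenius_deRham: "frobenius_cochain (deRham :: 'l forms cochain) p (\<lambda>i. frob)"
proof
  show "cochain_complex (deRham :: 'l forms cochain)" by (rule cochain_deRham)
next
  fix x :: "'l forms" and i
  assume "x [^]\<^bsub>grp deRham i\<^esub> p = \<one>\<^bsub>grp deRham i\<^esub>"
  then show "x = \<one>\<^bsub>grp deRham i\<^esub>" using forms_torsion_free[OF _ p_pos] by simp
next
  fix i show "frob \<in> hom (grp deRham i) (grp deRham i)"
    by (auto simp: hom_def frob_Omega frob_simps)
next
  fix x :: "'l forms" and i
  show "diff deRham i (frob x) = frob (diff deRham i x) [^]\<^bsub>grp deRham (i + 1)\<^esub> p"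
    by (simp add: ext_d_frob)
next
  fix x \<alpha> \<beta> :: "'l forms" and i
  assume *: "\<alpha> \<in> carrier (grp deRham i)" "\<beta> \<in> carrier (grp deRham (i - 1))"
    and eq: "frob x = \<alpha> [^]\<^bsub>grp deRham i\<^esub> p \<otimes>\<^bsub>grp deRham i\<^esub> diff deRham (i - 1) \<beta>"
  \<comment> \<open>Applying \<open>psi\<close> to the relation removes \<open>frob\<close> on the
    left and, by \<open>psi_ext_d\<close>, makes the exact term divisible by p.\<close>
  have "x = psi (of_nat p * \<alpha> + ext_d \<beta>)" using psi_frob[of x] eq by simp
  also have "\<dots> = of_nat p * (psi \<alpha> + ext_d (psi \<beta>))"
    using additive_int_scale[OF additive_psi, of "int p" \<alpha>]
    by (simp add: additive.add[OF additive_psi] psi_ext_d int_scale_eq_of_int_mult ring_distribs)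
  finally have "x = (psi \<alpha> + ext_d (psi \<beta>)) [^]\<^bsub>grp deRham i\<^esub> p" by simp
  moreover have "psi \<alpha> + ext_d (psi \<beta>) \<in> carrier (grp deRham i)"
    using * Omega_ext_d[OF psi_Omega, of \<beta> "i - 1"] by (simp add: Omega_add psi_Omega)
  ultimately show "\<exists>y\<in>carrier (grp deRham i). x = y [^]\<^bsub>grp deRham i\<^esub> p" by blast
next
  fix \<omega> \<eta> :: "'l forms" and i
  assume w: "\<omega> \<in> carrier (grp deRham i)" and e: "\<eta> \<in> carrier (grp deRham (i + 1))"
    and eq: "diff deRham i \<omega> = \<eta> [^]\<^bsub>grp deRham (i + 1)\<^esub> p"
  obtain y where y: "y \<in> Omega i"
    "\<omega> = of_nat p * y + ext_d (htpy \<omega>) + htpy (ext_d \<omega>) + frob (psi \<omega>)"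
    using homotopy w by auto
  \<comment> \<open>As d\<open>\<omega>\<close> is divisible by p, this half of the homotopy joins
    the p-multiple; what remains is exact plus \<open>frob\<close> of
    \<open>psi \<omega>\<close>.\<close>
  have "htpy (ext_d \<omega>) = of_nat p * htpy \<eta>"
    using eq additive_int_scale[OF additive_htpy, of "int p" \<eta>] by (simp add: int_scale_eq_of_int_mult)
  with y(2) have "\<omega> = of_nat p * (y + htpy \<eta>) + (ext_d (htpy \<omega>) + frob (psi \<omega>))"
    by (simp add: ring_distribs add_ac)
  moreover have "y + htpy \<eta> \<in> Omega i" "htpy \<omega> \<in> Omega (i - 1)" "psi \<omega> \<in> Omega i"
    using y(1) w e htpy_Omega[of \<eta> "i + 1"] by (simp_all add: Omega_add htpy_Omega psi_Omega)
  ultimately show "\<exists>x\<in>carrier (grp deRham i). \<exists>\<alpha>\<in>carrier (grp deRham i).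
      \<exists>\<beta>\<in>carrier (grp deRham (i - 1)).
        \<omega> = \<alpha> [^]\<^bsub>grp deRham i\<^esub> p \<otimes>\<^bsub>grp deRham i\<^esub> (diff deRham (i - 1) \<beta> \<otimes>\<^bsub>grp deRham i\<^esub> frob x)"
    unfolding deRham_simps deRham_pow by blast
qed

text \<open>After \<open>frob_lift_eq\<close> the concrete inverse Cartier map is the abstract
  \<open>cart\<close>, and \<open>phi\<close> satisfies the recursion assumed in
  \<open>stationary\<close>.\<close>

lemma phi_iso:
  assumes "r \<ge> 1"
  shows "cochain_iso (mod_p p deRham) (bockstein_page p deRham r) (phi p (set bs) r)"
proof -
  interpret frobenius_cochain "deRham :: 'l forms cochain" p "\<lambda>i. frob" by (rule frobenius_deRham)
  have "cartier_inv p (set bs) = cart"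
    by (simp add: fun_eq_iff cartier_inv_def cart_def frob_lift_eq)
  then show ?thesis using assms by (intro stationary) simp_all
qed

end

theorem mainTheorem1:
  fixes p :: nat and B :: "'l::ab_group_add set"
  assumes "prime p"
    and "finite B" and "int_mod.independent B" and "int_mod.span B = (UNIV :: 'l set)"
  shows "cochain_iso (mod_p p deRham) (bockstein_page p deRham 1) (cartier_inv p B) \<and>
    (\<forall>r\<ge>1. cochain_iso (mod_p p deRham) (bockstein_page p deRham r) (phi p B r))"
proof -
  \<comment> \<open>The order is arbitrary; it affects signs of monomials inside the proof, while
    \<open>frob_lift\<close> and \<open>phi\<close> depend on the set \<open>B\<close>.\<close>
  obtain bs where bs: "set bs = B" "distinct bs" using finite_distinct_list[OF assms(2)] by blast
  interpret cartier bs p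
    using assms bs by unfold_locales simp_all
  \<comment> \<open>The first conjunct is the case r = 1, where \<open>phi\<close> unfolds to
    \<open>cartier_inv\<close>.\<close>
  show ?thesis using phi_iso phi_iso[of 1] by (simp add: bs)
qed

end
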